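(* The following problem belongs to the class NP: given a matrix $A\in\mathbb{Z}^{m\times n}$ and a positive integer $k$, decide whether the factor rank of $A$ (as a tropical matrix) is at most $k$.
   Context: The tropical semiring is $\mathbb{R}$ with $a\oplus b=\min\{a,b\}$ and $a\otimes b=a+b$; $(B\otimes C)_{ij}=\min_{\tau}\{B_{i\tau}+C_{\tau j}\}$. The factor rank of $A\in\mathbb{R}^{m\times n}$ is the smallest $k$ such that $A=B\otimes C$ for some $B\in\mathbb{R}^{m\times k}$, $C\in\mathbb{R}^{k\times n}$. Integer matrices are encoded as arrays of integers in decimal notation, so the input size of $A$ is $\sum_{i,j}[\log_{10}\max\{|A_{ij}|,1\}]+3mn$. *)

theory Defs
  imports
    Complex_Main
    "HOL-Computational_Algebra.Polynomial"
    "Jordan_Normal_Form.Matrix"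
begin

section \<open>Tropical matrices and factor rank\<close>

text \<open>The minimum ranges over a nonempty set only if \<open>B\<close> has at least one column;
  \<open>is_trop_factorization\<close> requires this, since a minimum over an empty index set
  does not exist in the real numbers.\<close>

definition trop_mat_mult :: "real mat \<Rightarrow> real mat \<Rightarrow> real mat" where
  "trop_mat_mult B C = mat (dim_row B) (dim_col C)
     (\<lambda>(i, j). Min ((\<lambda>t. B $$ (i, t) + C $$ (t, j)) ` {..<dim_col B}))"

definition is_trop_factorization :: "real mat \<Rightarrow> nat \<Rightarrow> real mat \<Rightarrow> real mat \<Rightarrow> bool" where
  "is_trop_factorization A k B C \<longleftrightarrow>
     k \<ge> 1 \<and> B \<in> carrier_mat (dim_row A) k \<and> C \<in> carrier_mat k (dim_col A) \<and>
     A = trop_mat_mult B C"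

text \<open>For a matrix with at least one row and one column the set of such \<open>k\<close> is nonempty:
  \<open>A\<close> times a square matrix with zero diagonal and sufficiently large
  off-diagonal entries equals \<open>A\<close>.\<close>

definition factor_rank :: "real mat \<Rightarrow> nat" where
  "factor_rank A = (LEAST k. \<exists>B C. is_trop_factorization A k B C)"


section \<open>Decimal encoding of instances\<close>

fun enc_nat :: "nat \<Rightarrow> string" where
  "enc_nat n = (if n < 10 then [char_of (48 + n)]
                else enc_nat (n div 10) @ [char_of (48 + n mod 10)])"

declare enc_nat.simps [simp del]

definition enc_int :: "int \<Rightarrow> string" where
  "enc_int a = (if a < 0 then CHR ''-'' else CHR ''+'') # enc_nat (nat \<bar>a\<bar>)"

text \<open>Rows are listed one after another. An entry is a sign, its decimal digits, and one
  terminator, which is a semicolon for the last entry of a row and a comma otherwise.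
  The resulting length is exactly the usual input size, see \<open>length_enc_mat\<close> below.\<close>

definition enc_mat :: "int mat \<Rightarrow> string" where
  "enc_mat A = concat (map (\<lambda>i. concat (map (\<lambda>j.
       enc_int (A $$ (i, j)) @ [if Suc j = dim_col A then CHR '';'' else CHR '','']) 
     [0..<dim_col A])) [0..<dim_row A])"

definition enc_instance :: "int mat \<Rightarrow> nat \<Rightarrow> string" where
  "enc_instance A k = enc_mat A @ enc_nat k"

lemma length_enc_nat: "int (length (enc_nat n)) = \<lfloor>log 10 (max (real n) 1)\<rfloor> + 1"
proof (induction n rule: enc_nat.induct)
  case (1 n)
  show ?case
  proof (cases "n < 10")
    case True
    have "0 \<le> log 10 (max (real n) 1)" "log 10 (max (real n) 1) < 1"
      using True by (auto simp: log_less_iff)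
    hence "\<lfloor>log 10 (max (real n) 1)\<rfloor> = 0" by (simp add: floor_eq_iff)
    thus ?thesis using True by (simp add: enc_nat.simps)
  next
    case False
    define d where "d = n div 10"
    have d: "d \<ge> 1" using False by (simp add: d_def)
    have IH: "int (length (enc_nat d)) = \<lfloor>log 10 (real d)\<rfloor> + 1"
      using 1 False d by (simp add: d_def max_def)
    have "\<lfloor>log 10 (real n)\<rfloor> = \<lfloor>log 10 (real d)\<rfloor> + 1"
    proof -
      define e where "e = nat \<lfloor>log 10 (real d)\<rfloor>"
      have e: "\<lfloor>log 10 (real d)\<rfloor> = int e" using d by (simp add: e_def)
      have "10 ^ e \<le> d" "d < 10 ^ (e + 1)"
        using floor_log_nat_eq_powr_iff[of 10 d e] e d by auto
      hence "10 ^ (e + 1) \<le> n" "n < 10 ^ (e + 1 + 1)"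
        by (auto simp: d_def)
      hence "\<lfloor>log (real 10) (real n)\<rfloor> = int (e + 1)"
        using floor_log_nat_eq_powr_iff[of 10 n "e + 1"] False by auto
      thus ?thesis using e by simp
    qed
    thus ?thesis using False IH by (simp add: enc_nat.simps[of n] d_def max_def)
  qed
qed

lemma length_enc_mat:
  "int (length (enc_mat A)) =
     (\<Sum>i<dim_row A. \<Sum>j<dim_col A. \<lfloor>log 10 (max \<bar>real_of_int (A $$ (i, j))\<bar> 1)\<rfloor>)
     + 3 * int (dim_row A) * int (dim_col A)"
proof -
  have *: "int (length (enc_int a)) = \<lfloor>log 10 (max \<bar>real_of_int a\<bar> 1)\<rfloor> + 2" for a
    by (simp add: enc_int_def length_enc_nat)
  show ?thesis
    by (simp add: enc_mat_def length_concat comp_def sum_list_distinct_conv_sum_set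
        interv_sum_list_conv_sum_set_nat * sum.distrib atLeast0LessThan algebra_simps)
qed


section \<open>The class NP\<close>

text \<open>Deterministic multitape Turing machines over the input alphabet \<open>char\<close>, with two-way
  infinite tapes. The tape alphabet is \<open>char option\<close>, where \<open>None\<close> is the blank. The states
  are \<open>0, ..., tm_states - 1\<close>. The transition function gets the symbols under the
  heads and returns the next state together with a symbol to write and a move for each tape.\<close>

datatype move = Left | Stay | Right

record tm =
  tm_states :: nat
  tm_tapes :: nat
  tm_start :: nat
  tm_accept :: nat
  tm_reject :: nat
  tm_delta :: "nat \<Rightarrow> char option list \<Rightarrow> nat \<times> (char option \<times> move) list"

definition wf_tm :: "tm \<Rightarrow> bool" where
  "wf_tm M \<longleftrightarrow>
     tm_start M < tm_states M \<and> tm_accept M < tm_states M \<and> tm_reject M < tm_states M \<and>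
     tm_accept M \<noteq> tm_reject M \<and>
     (\<forall>q ss. q < tm_states M \<and> length ss = tm_tapes M \<longrightarrow>
        fst (tm_delta M q ss) < tm_states M \<and> length (snd (tm_delta M q ss)) = tm_tapes M)"

text \<open>A tape is given by its contents and its head position, a configuration by a
  state and a list of tapes.\<close>

type_synonym tape = "(int \<Rightarrow> char option) \<times> int"
type_synonym config = "nat \<times> tape list"

definition tape_read :: "tape \<Rightarrow> char option" where
  "tape_read t = fst t (snd t)"

fun move_offset :: "move \<Rightarrow> int" where
  "move_offset Left = -1"
| "move_offset Stay = 0"
| "move_offset Right = 1"

fun tape_act :: "char option \<times> move \<Rightarrow> tape \<Rightarrow> tape" where
  "tape_act (s, d) (f, h) = (f(h := s), h + move_offset d)"

definition tm_halted :: "tm \<Rightarrow> config \<Rightarrow> bool" where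
  "tm_halted M c \<longleftrightarrow> fst c = tm_accept M \<or> fst c = tm_reject M"

definition tm_step :: "tm \<Rightarrow> config \<Rightarrow> config" where
  "tm_step M c = (if tm_halted M c then c else
     let (q', as) = tm_delta M (fst c) (map tape_read (snd c))
     in (q', map2 tape_act as (snd c)))"

definition input_tape :: "string \<Rightarrow> tape" where
  "input_tape w = ((\<lambda>i. if 0 \<le> i \<and> i < int (length w) then Some (w ! nat i) else None), 0)"

text \<open>A pair of strings is presented on the first two tapes, all further tapes being blank.\<close>

definition tm_init :: "tm \<Rightarrow> string \<Rightarrow> string \<Rightarrow> config" where
  "tm_init M x u =
     (tm_start M, input_tape x # input_tape u # replicate (tm_tapes M - 2) (input_tape []))"

definition tm_run :: "tm \<Rightarrow> string \<Rightarrow> string \<Rightarrow> nat \<Rightarrow> config" where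
  "tm_run M x u t = (tm_step M ^^ t) (tm_init M x u)"

definition tm_accepts :: "tm \<Rightarrow> string \<Rightarrow> string \<Rightarrow> bool" where
  "tm_accepts M x u \<longleftrightarrow> (\<exists>t. fst (tm_run M x u t) = tm_accept M)"

definition poly_time :: "tm \<Rightarrow> bool" where
  "poly_time M \<longleftrightarrow>
     (\<exists>p :: nat poly. \<forall>x u. tm_halted M (tm_run M x u (poly p (length x + length u))))"

definition NP :: "string set set" where
  "NP = {L. \<exists>M. wf_tm M \<and> tm_tapes M \<ge> 2 \<and> poly_time M \<and>
     (\<exists>q :: nat poly. \<forall>x. x \<in> L \<longleftrightarrow>
        (\<exists>u. length u \<le> poly q (length x) \<and> tm_accepts M x u))}"

end

(* If A has factor rank at most k, choose for every entry one column in which the minimum is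
   attained; at most mn columns suffice. A column b together with a row c only has to satisfy
   b i + c j >= A i j, with equality at the chosen entries. Rounding makes b and c integral, and
   shortening long gaps between the numbers b i and - c j makes them small, so they have
   polynomially many digits. A nondeterministic machine guesses the columns one after another, checks the
   inequalities digit by digit and marks the entries where equality holds.

   A verifier is a nondeterministic machine that reads its choices from the certificate. If it reads
   one symbol of the certificate in every step and rejects at its end, the time bound is automatic,
   and only the accepting runs have to be short. *)
theory Submission
  imports Defs
begin

section \<open>Nondeterministic programs over stacks\<close>

text \<open>The class NP is defined by concrete Turing machines, and writing the transition table of
  one by hand would bury the argument. Hence a small language over stacks: each stack lies on a tape
  with its top under the head, and the control states are the continuations of one fixed program, of
  which there are finitely many although its loops are unbounded. Soundness and time are then
  analysed on programs. Moving data between stacks reverses it, which dictates the data layout: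
  numbers have their least significant digit on top, and the matrix is kept with rows and columns in
  reverse order. To add numbers in lockstep, all of them are padded to a common length by guessed
  leading zeros; a wrong guess merely gets stuck. The inequality b + c >= a is checked as b + c = a
  + d with a guessed slack d. The value of k may be exponential in the length of the input, so it is
  kept as a decimal counter that is decremented once per guessed column.\<close>

datatype prog =
    Skip
  | Fail
  | Pop nat char
  | Push nat char
  | Write nat char
  | Empty nat
  | Seq prog prog
  | Choose "char \<Rightarrow> prog"
  | Star prog

section \<open>Semantics: timed execution and runs driven by a string of choices\<close>

type_synonym stacks = "nat \<Rightarrow> string"

text \<open>The number counts machine steps. \<open>Push\<close> takes two, since the head first
  moves left and then writes; \<open>Write\<close> is this second half. \<open>Seq\<close>,
  \<open>Choose\<close> and each round of \<open>Star\<close> cost one step for the change of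
  control state.\<close>

inductive exec :: "prog \<Rightarrow> stacks \<Rightarrow> nat \<Rightarrow> stacks \<Rightarrow> bool" where
  exec_Skip: "exec Skip s 1 s"
| exec_Pop: "s i = c # w \<Longrightarrow> exec (Pop i c) s 1 (s(i := w))"
| exec_Push: "exec (Push i c) s 2 (s(i := c # s i))"
| exec_Write: "exec (Write i c) s 1 (s(i := c # s i))"
| exec_Empty: "s i = [] \<Longrightarrow> exec (Empty i) s 1 s"
| exec_Seq: "exec p s a s' \<Longrightarrow> exec q s' b s'' \<Longrightarrow> exec (Seq p q) s (Suc (a + b)) s''"
| exec_Choose: "exec (f c) s a s' \<Longrightarrow> exec (Choose f) s (Suc a) s'"
| exec_Star0: "exec (Star p) s 1 s"
| exec_Star1: "exec p s a s' \<Longrightarrow> exec (Star p) s' b s'' \<Longrightarrow> exec (Star p) s (Suc (a + b)) s''"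

text \<open>A list of programs is a continuation: the work still to be done, in order. The control
  states of the machine will be such lists.\<close>

fun execs :: "prog list \<Rightarrow> stacks \<Rightarrow> bool" where
  "execs [] s \<longleftrightarrow> True"
| "execs (p # K) s \<longleftrightarrow> (\<exists>n t. exec p s n t \<and> execs K t)"

text \<open>The choices of a run are read off a string. Every step consumes one character of it, also
  those that make no choice: this makes the verifier below halt on every input within
  the length of the certificate.\<close>

fun run :: "prog list \<Rightarrow> stacks \<Rightarrow> string \<Rightarrow> bool" where
  "run [] s u \<longleftrightarrow> True"
| "run (p # K) s [] \<longleftrightarrow> False"
| "run (Skip # K) s (e # u) \<longleftrightarrow> run K s u"
| "run (Fail # K) s (e # u) \<longleftrightarrow> False"
| "run (Pop i c # K) s (e # u) \<longleftrightarrow>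
     (case s i of [] \<Rightarrow> False | d # w \<Rightarrow> c = d \<and> run K (s(i := w)) u)"
| "run (Push i c # K) s (e # u) \<longleftrightarrow> run (Write i c # K) s u"
| "run (Write i c # K) s (e # u) \<longleftrightarrow> run K (s(i := c # s i)) u"
| "run (Empty i # K) s (e # u) \<longleftrightarrow> s i = [] \<and> run K s u"
| "run (Seq p q # K) s (e # u) \<longleftrightarrow> run (p # q # K) s u"
| "run (Choose f # K) s (e # u) \<longleftrightarrow> run (f e # K) s u"
| "run (Star p # K) s (e # u) \<longleftrightarrow> (if e = CHR ''0'' then run K s u else run (p # Star p # K) s u)"

text \<open>Control steps unfolded by \<open>run\<close> are reassembled by the rules of
  \<open>exec\<close>. Step counts are existential here, so a \<open>Push\<close> can be justified
  by its second half.\<close>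

lemma run_imp_execs: "run K s u \<Longrightarrow> execs K s"
proof (induction K s u rule: run.induct)
  case (5 i c K s e u)
  then show ?case
    by (fastforce simp: fun_upd_def split: list.splits dest: exec_Pop)
next
  case (6 i c K s e u)
  then obtain n t where "exec (Write i c) s n t" "execs K t" by auto
  then show ?case by (auto elim: exec.cases intro!: exI exec_Push)
next
  case (9 p q K s e u)
  then show ?case by (fastforce intro: exec_Seq)
next
  case (10 f K s e u)
  then show ?case by (fastforce intro: exec_Choose)
next
  case (11 p K s e u)
  then show ?case by (fastforce intro: exec_Star0 exec_Star1 split: if_splits)
qed (auto intro: exec.intros)

text \<open>The string spells out the choices: the chosen character at \<open>Choose\<close>,
  \<open>0\<close> to leave a \<open>Star\<close>, \<open>1\<close> for another round, a filler
  elsewhere. Quantifying over the continuation and the rest of the string is what allows the pieces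
  to be concatenated.\<close>

lemma exec_imp_run:
  "exec p s n t \<Longrightarrow> \<exists>v. length v = n \<and> (\<forall>K u. run K t u \<longrightarrow> run (p # K) s (v @ u))"
proof (induction rule: exec.induct)
  case (exec_Push i c s)
  show ?case
    by (intro exI[of _ "''00''"] conjI allI impI) (simp, simp only: run.simps append.simps)
next
  case (exec_Seq p s a s' q b s'')
  then obtain v w where
    "length v = a" "\<forall>K u. run K s' u \<longrightarrow> run (p # K) s (v @ u)"
    "length w = b" "\<forall>K u. run K s'' u \<longrightarrow> run (q # K) s' (w @ u)" by auto
  then show ?case by (intro exI[of _ "CHR ''0'' # v @ w"]) auto
next
  case (exec_Choose f c s a s')
  then obtain v where "length v = a" "\<forall>K u. run K s' u \<longrightarrow> run (f c # K) s (v @ u)" by auto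
  then show ?case by (intro exI[of _ "c # v"]) auto
next
  case (exec_Star0 p s)
  show ?case by (rule exI[of _ "''0''"]) auto
next
  case (exec_Star1 p s a s' b s'')
  then obtain v w where
    "length v = a" "\<forall>K u. run K s' u \<longrightarrow> run (p # K) s (v @ u)"
    "length w = b" "\<forall>K u. run K s'' u \<longrightarrow> run (Star p # K) s' (w @ u)" by auto
  then show ?case by (intro exI[of _ "CHR ''1'' # v @ w"]) auto
next
  case (exec_Write i c s)
  show ?case
    by (intro exI[of _ "''0''"] conjI allI impI) (simp, simp only: run.simps append.simps)
qed (rule exI[of _ "''0''"], auto simp: fun_upd_def)+

section \<open>The finite set of continuations of a program\<close>

text \<open>An over-approximation of the continuations reachable from \<open>p # K\<close>, similar
  to the partial derivatives of a regular expression. A loop body returns to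
  \<open>Star p # K\<close>, and \<open>Choose\<close> branches over the finite type of characters;
  therefore the set is finite.\<close>

primrec conts :: "prog \<Rightarrow> prog list \<Rightarrow> prog list set" where
  "conts Skip K = {Skip # K}"
| "conts Fail K = {Fail # K}"
| "conts (Pop i c) K = {Pop i c # K}"
| "conts (Push i c) K = {Push i c # K, Write i c # K}"
| "conts (Write i c) K = {Write i c # K}"
| "conts (Empty i) K = {Empty i # K}"
| "conts (Seq p q) K = insert (Seq p q # K) (conts p (q # K) \<union> conts q K)"
| "conts (Choose f) K = insert (Choose f # K) (\<Union>c. conts (f c) K)"
| "conts (Star p) K = insert (Star p # K) (conts p (Star p # K))"

lemma self_in_conts: "p # K \<in> conts p K"
  by (cases p) auto

lemma finite_conts: "finite (conts p K)"
  by (induction p arbitrary: K) auto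

text \<open>Index 1 is excluded because the tape with this number holds the choices.\<close>

primrec uses_stacks :: "nat \<Rightarrow> prog \<Rightarrow> bool" where
  "uses_stacks n Skip \<longleftrightarrow> True"
| "uses_stacks n Fail \<longleftrightarrow> True"
| "uses_stacks n (Pop i c) \<longleftrightarrow> i < n \<and> i \<noteq> 1"
| "uses_stacks n (Push i c) \<longleftrightarrow> i < n \<and> i \<noteq> 1"
| "uses_stacks n (Write i c) \<longleftrightarrow> False"
| "uses_stacks n (Empty i) \<longleftrightarrow> i < n \<and> i \<noteq> 1"
| "uses_stacks n (Seq p q) \<longleftrightarrow> uses_stacks n p \<and> uses_stacks n q"
| "uses_stacks n (Choose f) \<longleftrightarrow> (\<forall>c. uses_stacks n (f c))"
| "uses_stacks n (Star p) \<longleftrightarrow> uses_stacks n p"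

text \<open>\<open>Write\<close> may stand only in front, as the unfinished half of a
  \<open>Push\<close>.\<close>

fun uses_stacks_cont :: "nat \<Rightarrow> prog list \<Rightarrow> bool" where
  "uses_stacks_cont n (Write i c # K) \<longleftrightarrow> i < n \<and> i \<noteq> 1 \<and> list_all (uses_stacks n) K"
| "uses_stacks_cont n K \<longleftrightarrow> list_all (uses_stacks n) K"

lemma uses_stacks_conts:
  "uses_stacks n p \<Longrightarrow> list_all (uses_stacks n) K \<Longrightarrow> L \<in> conts p K \<Longrightarrow> uses_stacks_cont n L"
proof (induction p arbitrary: K)
  case (Seq p q)
  then have "L = Seq p q # K \<or> L \<in> conts p (q # K) \<or> L \<in> conts q K" by simp
  then show ?case using Seq.IH[of "q # K"] Seq.IH(2)[of K] Seq.prems by auto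
next
  case (Choose f)
  then obtain c where "L = Choose f # K \<or> L \<in> conts (f c) K" by auto
  then show ?case using Choose.IH[OF rangeI, of c K] Choose.prems by auto
next
  case (Star p)
  then have "L = Star p # K \<or> L \<in> conts p (Star p # K)" by simp
  then show ?case using Star.IH[of "Star p # K"] Star.prems by auto
qed auto

text \<open>The tape holding the choices (number 1) as the selected tape stands for no action.\<close>

fun next_step :: "prog list \<Rightarrow> char \<Rightarrow> (nat \<Rightarrow> char option) \<Rightarrow>
    (prog list \<times> nat \<times> char option \<times> move) option" where
  "next_step [] e r = None"
| "next_step (Skip # K) e r = Some (K, 1, None, Stay)"
| "next_step (Fail # K) e r = None"
| "next_step (Pop i c # K) e r = (if r i = Some c then Some (K, i, Some c, Right) else None)"
| "next_step (Push i c # K) e r = Some (Write i c # K, i, r i, Left)"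
| "next_step (Write i c # K) e r = Some (K, i, Some c, Stay)"
| "next_step (Empty i # K) e r = (if r i = None then Some (K, 1, None, Stay) else None)"
| "next_step (Seq p q # K) e r = Some (p # q # K, 1, None, Stay)"
| "next_step (Choose f # K) e r = Some (f e # K, 1, None, Stay)"
| "next_step (Star p # K) e r = Some (if e = CHR ''0'' then K else p # Star p # K, 1, None, Stay)"

text \<open>A step inside \<open>p\<close> either stays among its continuations or hands over to
  \<open>K\<close>. With \<open>K = []\<close> this closes \<open>insert [] (conts p [])\<close>
  under steps, so that it can serve as a state space.\<close>

lemma next_step_conts:
  "L \<in> conts p K \<Longrightarrow> next_step L e r = Some (L', i, a) \<Longrightarrow> L' \<in> insert K (conts p K)"
proof (induction p arbitrary: K)
  case (Seq p q)
  then consider "L = Seq p q # K" | "L \<in> conts p (q # K)" | "L \<in> conts q K" by auto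
  then show ?case
  proof cases
    case 2
    then show ?thesis using Seq.IH(1)[OF 2] Seq.prems self_in_conts[of q K] by auto
  next
    case 3
    then show ?thesis using Seq.IH(2)[OF 3] Seq.prems by auto
  qed (use Seq.prems self_in_conts[of p "q # K"] in auto)
next
  case (Choose f)
  then consider "L = Choose f # K" | c where "L \<in> conts (f c) K" by auto
  then show ?case
  proof cases
    case 1
    then show ?thesis using Choose.prems self_in_conts by auto
  next
    case 2
    then show ?thesis using Choose.IH[OF rangeI 2] Choose.prems by auto
  qed
next
  case (Star p)
  then consider "L = Star p # K" | "L \<in> conts p (Star p # K)" by auto
  then show ?case
  proof cases
    case 2
    then show ?thesis using Star.IH[OF 2] Star.prems by auto
  qed (use Star.prems self_in_conts[of p "Star p # K"] in \<open>auto split: if_splits\<close>)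
qed (auto split: if_splits)

section \<open>Stacks on tapes and the compiled machine\<close>

text \<open>The top lies under the head and the stack extends to the right, followed by blanks. The
  cells to the left are arbitrary, so popping is a mere move.\<close>

definition stack_on :: "string \<Rightarrow> tape \<Rightarrow> bool" where
  "stack_on w t \<longleftrightarrow> (\<forall>j. fst t (snd t + int j) = (if j < length w then Some (w ! j) else None))"

lemma stack_on_input_tape: "stack_on w (input_tape w)"
  by (auto simp: stack_on_def input_tape_def)

lemma stack_on_read: "stack_on w t \<Longrightarrow> tape_read t = (case w of [] \<Rightarrow> None | c # _ \<Rightarrow> Some c)"
  unfolding stack_on_def tape_read_def by (drule spec[of _ 0]) (auto split: list.splits)

lemma stack_on_pop: "stack_on (c # w) t \<Longrightarrow> stack_on w (tape_act (Some c, Right) t)"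
  unfolding stack_on_def
proof (intro allI)
  fix j assume a: "\<forall>j. fst t (snd t + int j) = (if j < length (c # w) then Some ((c # w) ! j) else
      None)"
  show "fst (tape_act (Some c, Right) t) (snd (tape_act (Some c, Right) t) + int j) =
         (if j < length w then Some (w ! j) else None)"
    using a[rule_format, of "Suc j"] by (cases t) (auto simp: algebra_simps)
qed

lemma stack_on_write:
  "stack_on w (f, h + 1) \<Longrightarrow> stack_on (c # w) (tape_act (Some c, Stay) (f, h))"
  unfolding stack_on_def
proof (intro allI)
  fix j assume a: "\<forall>j. fst (f, h + 1) (snd (f, h + 1) + int j) = (if j < length w then Some (w !
      j) else None)"
  show "fst (tape_act (Some c, Stay) (f, h)) (snd (tape_act (Some c, Stay) (f, h)) + int j) =
         (if j < length (c # w) then Some ((c # w) ! j) else None)"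
    using a by (cases j) (auto simp: algebra_simps dest: spec)
qed

text \<open>Tape 1 advances in every step, whichever tape \<open>i\<close> is selected; this ties
  the running time to the certificate. The remaining tapes rewrite the symbol they read.\<close>

definition acts :: "nat \<Rightarrow> char option \<times> move \<Rightarrow> char option list \<Rightarrow> (char option \<times> move) list" where
  "acts i a ss = map (\<lambda>j. if j = 1 then (ss ! 1, Right) else if j = i then a else (ss ! j, Stay))
     [0..<length ss]"

text \<open>States have to be numbers, so \<open>h\<close> codes the continuations by
  \<open>0, ..., N - 1\<close>, and \<open>N\<close> is the rejecting state. It is entered when no
  step is possible and also when the certificate is exhausted.\<close>

definition prog_tm :: "nat \<Rightarrow> prog \<Rightarrow> (prog list \<Rightarrow> nat) \<Rightarrow> nat \<Rightarrow> tm" where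
  "prog_tm n p h N = \<lparr>tm_states = Suc N, tm_tapes = n, tm_start = h [p], tm_accept = h [],
     tm_reject = N,
     tm_delta = (\<lambda>q ss.
       let K = inv_into (insert [] (conts p [])) h q;
           stop = (N, acts 1 (None, Stay) ss)
       in if q < N then
            (case ss ! 1 of None \<Rightarrow> stop
             | Some e \<Rightarrow> (case next_step K e (\<lambda>i. ss ! i) of None \<Rightarrow> stop
                | Some (L, i, a) \<Rightarrow> (h L, acts i a ss)))
          else stop)\<rparr>"

text \<open>Pushing takes two machine steps, moving and then writing. Hence in a continuation that starts
  with \<open>Write\<close> the head is already one cell to the left of its stack.\<close>

definition lag :: "prog list \<Rightarrow> nat \<Rightarrow> int" where
  "lag K i = (case K of Write j c # _ \<Rightarrow> if i = j then 1 else 0 | _ \<Rightarrow> 0)"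

definition represents :: "nat \<Rightarrow> prog list \<Rightarrow> stacks \<Rightarrow> string \<Rightarrow> tape list \<Rightarrow> bool" where
  "represents n K s u ts \<longleftrightarrow> length ts = n \<and> n \<ge> 2 \<and> stack_on u (ts ! 1) \<and>
     (\<forall>i<n. i \<noteq> 1 \<longrightarrow> stack_on (s i) (fst (ts ! i), snd (ts ! i) + lag K i))"

locale compiled =
  fixes n :: nat and p :: prog and h :: "prog list \<Rightarrow> nat" and N :: nat
  assumes n: "n \<ge> 2"
    and bij: "bij_betw h (insert [] (conts p [])) {0..<N}"
    and stacks: "uses_stacks n p"
begin

abbreviation "S \<equiv> insert [] (conts p [])"
abbreviation "M \<equiv> prog_tm n p h N"

lemma h_less: "K \<in> S \<Longrightarrow> h K < N"
  using bij by (auto simp: bij_betw_def)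

lemma h_inj: "K \<in> S \<Longrightarrow> L \<in> S \<Longrightarrow> h K = h L \<longleftrightarrow> K = L"
  using bij by (auto simp: bij_betw_def inj_on_def)

lemma inv_h: "K \<in> S \<Longrightarrow> inv_into S h (h K) = K"
  using bij by (simp add: bij_betw_def inv_into_f_f)

lemma inv_in: "q < N \<Longrightarrow> inv_into S h q \<in> S"
  using bij by (intro inv_into_into) (auto simp: bij_betw_def)

lemma next_in: "K \<in> S \<Longrightarrow> next_step K e r = Some (L, i, a) \<Longrightarrow> L \<in> S"
  using next_step_conts[of K p "[]"] by (cases "K = []") auto

lemma start_in: "[p] \<in> S"
  using self_in_conts[of p "[]"] by simp

lemma uses_stacks_S: "K \<in> S \<Longrightarrow> uses_stacks_cont n K"
  using uses_stacks_conts[OF stacks, of "[]" K] by auto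

lemma wf: "wf_tm M"
proof -
  have "fst (tm_delta M q ss) < Suc N \<and> length (snd (tm_delta M q ss)) = n"
    if "q < Suc N" "length ss = n" for q ss
    using that h_less next_in inv_in[of q]
    by (auto simp: prog_tm_def Let_def acts_def less_Suc_eq split: option.splits)
  moreover have "h [] < N" "h [p] < N" using h_less[of "[]"] h_less[OF start_in] by auto
  ultimately show ?thesis by (auto simp: wf_tm_def prog_tm_def)
qed

lemma nth_acts: "j < length ts \<Longrightarrow> length ts \<ge> 2 \<Longrightarrow>
   map2 tape_act (acts i a (map tape_read ts)) ts ! j =
     (if j = 1 then tape_act (tape_read (ts ! j), Right) (ts ! j)
      else if j = i then tape_act a (ts ! j)
      else tape_act (tape_read (ts ! j), Stay) (ts ! j))"
  by (auto simp: acts_def)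

lemma step_halt:
  assumes "K \<in> S" "K \<noteq> []" "length ts = n"
    and "u = [] \<or> (\<exists>e v. u = e # v \<and> next_step K e (\<lambda>i. map tape_read ts ! i) = None)"
    and "stack_on u (ts ! 1)"
  shows "fst (tm_step M (h K, ts)) = N"
proof -
  have "h K < N" "h K \<noteq> h []" using h_less h_inj assms by auto
  moreover have "map tape_read ts ! 1 = (case u of [] \<Rightarrow> None | c # _ \<Rightarrow> Some c)"
    using stack_on_read[OF assms(5)] n assms(3) by simp
  ultimately show ?thesis using assms(4) inv_h[OF assms(1)]
    by (auto simp: tm_step_def tm_halted_def prog_tm_def Let_def)
qed

lemma step_next:
  assumes "K \<in> S" "length ts = n" "stack_on (e # v) (ts ! 1)"
    and "next_step K e (\<lambda>i. map tape_read ts ! i) = Some (L, i, a)"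
  shows "tm_step M (h K, ts) = (h L, map2 tape_act (acts i a (map tape_read ts)) ts)"
proof -
  have "K \<noteq> []" using assms(4) by auto
  then have "h K < N" "h K \<noteq> h []" using h_less h_inj assms by auto
  moreover have "map tape_read ts ! 1 = Some e"
    using stack_on_read[OF assms(3)] n assms(2) by simp
  ultimately show ?thesis using assms(4) inv_h[OF assms(1)]
    by (auto simp: tm_step_def tm_halted_def prog_tm_def Let_def)
qed

text \<open>Each step consumes one character of tape 1, and one more step finds the blank behind
  them. The bound is thus independent of the program and of the other tapes.\<close>

lemma halts:
  "K \<in> S \<Longrightarrow> length ts = n \<Longrightarrow> stack_on u (ts ! 1) \<Longrightarrow>
   tm_halted M ((tm_step M ^^ Suc (length u)) (h K, ts))"
proof (induction u arbitrary: K ts)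
  case Nil
  then show ?case
  proof (cases "K = []")
    case True
    then show ?thesis by (auto simp: tm_step_def tm_halted_def prog_tm_def)
  next
    case False
    then show ?thesis using step_halt[of K ts "[]"] Nil by (auto simp: tm_halted_def prog_tm_def)
  qed
next
  case (Cons e u)
  have stay: "tm_halted M ((tm_step M ^^ k) c)" if "tm_halted M c" for k c
  proof -
    have "(tm_step M ^^ k) c = c" using that by (induction k) (auto simp: tm_step_def)
    then show ?thesis using that by simp
  qed
  have eq: "(tm_step M ^^ Suc (length (e # u))) (h K, ts) =
      (tm_step M ^^ Suc (length u)) (tm_step M (h K, ts))"
    by (simp add: funpow_swap1)
  consider "K = []" | "K \<noteq> []" "next_step K e (\<lambda>i. map tape_read ts ! i) = None"
    | L i a where "next_step K e (\<lambda>i. map tape_read ts ! i) = Some (L, i, a)"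
    by (cases "next_step K e (\<lambda>i. map tape_read ts ! i)") auto
  then show ?case
  proof cases
    case 1
    then show ?thesis by (intro stay) (auto simp: tm_halted_def prog_tm_def)
  next
    case 2
    then have "fst (tm_step M (h K, ts)) = N" using Cons.prems by (intro step_halt) auto
    then show ?thesis unfolding eq by (intro stay) (auto simp: tm_halted_def prog_tm_def)
  next
    case 3
    let ?ts = "map2 tape_act (acts i a (map tape_read ts)) ts"
    have "stack_on u (?ts ! 1)"
      using Cons.prems n stack_on_pop[of e u "ts ! 1"] stack_on_read[of "e # u" "ts ! 1"]
      by (simp add: nth_acts del: nth_map)
    moreover have "length ?ts = n" using Cons.prems by (simp add: acts_def)
    moreover have "L \<in> S" using next_in Cons.prems 3 by blast
    ultimately show ?thesis unfolding eq using step_next[OF Cons.prems(1-3) 3] Cons.IH by simp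
  qed
qed

text \<open>Simulation of a single step, in which machine and \<open>run\<close> both consume
  \<open>e\<close>. A \<open>Push\<close> leaves the abstract stacks alone and shows up only in
  \<open>lag\<close>; the \<open>Write\<close> that follows changes the stack and resets the
  lag.\<close>

lemma run_next_step:
  assumes rep: "represents n K s (e # v) ts" and K: "uses_stacks_cont n K" "K \<noteq> []"
    and r: "r = (\<lambda>i. map tape_read ts ! i)"
  shows "next_step K e r = None \<Longrightarrow> \<not> run K s (e # v)"
    and "next_step K e r = Some (L, i, a) \<Longrightarrow>
      \<exists>s'. run K s (e # v) = run L s' v \<and>
        represents n L s' v (map2 tape_act (acts i a (map tape_read ts)) ts)"
proof -
  have len: "length ts = n" and u: "stack_on (e # v) (ts ! 1)"
    and st: "\<And>i. i < n \<Longrightarrow> i \<noteq> 1 \<Longrightarrow> stack_on (s i) (fst (ts ! i), snd (ts ! i) + lag K i)"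
    using rep by (auto simp: represents_def)
  have lag0: "lag L i = 0" if "list_all (uses_stacks n) L" for L i
    using that by (cases "(n, L)" rule: uses_stacks_cont.cases) (auto simp: lag_def)
  have read: "r i = (case s i of [] \<Rightarrow> None | c # _ \<Rightarrow> Some c)"
    if "i < n" "i \<noteq> 1" "lag K i = 0" for i
    using that st[of i] stack_on_read[of "s i" "ts ! i"] len by (simp add: r)
  have u': "stack_on v (tape_act (tape_read (ts ! 1), Right) (ts ! 1))"
    using stack_on_pop[OF u] stack_on_read[OF u] by simp
  \<comment> \<open>Reduces the invariant to the selected tape \<open>i\<close>: the other stacks
    are rewritten in place, and tape 1 is covered by \<open>u'\<close>.\<close>
  have repI: "represents n L s' v (map2 tape_act (acts i a (map tape_read ts)) ts)"
    if other: "\<And>j. j < n \<Longrightarrow> j \<noteq> 1 \<Longrightarrow> j \<noteq> i \<Longrightarrow> s' j = s j \<and> lag L j = lag K j"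
      and act: "i < n \<Longrightarrow> i \<noteq> 1 \<Longrightarrow> stack_on (s' i)
        (fst (tape_act a (ts ! i)), snd (tape_act a (ts ! i)) + lag L i)" for L s' i a
  proof -
    have "stack_on (s' j) (fst t, snd t + lag L j)"
      if j: "j < n" "j \<noteq> 1" and t: "t = map2 tape_act (acts i a (map tape_read ts)) ts ! j" for j t
    proof (cases "j = i")
      case True
      then show ?thesis using j act by (simp add: t nth_acts len n)
    next
      case False
      have "fst (tape_act (tape_read (ts ! j), Stay) (ts ! j)) = fst (ts ! j)"
        "snd (tape_act (tape_read (ts ! j), Stay) (ts ! j)) = snd (ts ! j)"
        by (cases "ts ! j", auto simp: tape_read_def)+
      then show ?thesis
        using st[OF j] other[OF j False] False j(2) by (simp add: t nth_acts len n j)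
    qed
    moreover have "stack_on v (map2 tape_act (acts i a (map tape_read ts)) ts ! 1)"
      using u' n by (simp add: nth_acts len)
    ultimately show ?thesis using n len by (auto simp: represents_def acts_def)
  qed
  obtain p K' where KK: "K = p # K'" using K(2) by (cases K) auto
  show "\<not> run K s (e # v)" if "next_step K e r = None"
    using that K read unfolding KK
    by (cases p) (auto split: if_splits list.splits simp: lag_def)
  assume nx: "next_step K e r = Some (L, i, a)"
  show "\<exists>s'. run K s (e # v) = run L s' v \<and>
        represents n L s' v (map2 tape_act (acts i a (map tape_read ts)) ts)"
  proof (cases p)
    case (Pop j c)
    then have j: "j < n" "j \<noteq> 1" and K': "list_all (uses_stacks n) K'" and lg: "\<And>i. lag K i = 0"
      using K by (auto simp: KK lag_def)
    from nx Pop have "r j = Some c" and La: "L = K'" "i = j" "a = (Some c, Right)"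
      by (auto simp: KK split: if_splits)
    then obtain w where w: "s j = c # w" using read[OF j lg] by (auto split: list.splits)
    show ?thesis
      using st[OF j] lg lag0[OF K'] La w stack_on_pop[of c w "ts ! j"]
      by (intro exI[of _ "s(j := w)"] conjI repI) (auto simp: KK Pop fun_upd_def)
  next
    case (Push j c)
    then have j: "j < n" "j \<noteq> 1" and K': "list_all (uses_stacks n) K'" and lg: "\<And>i. lag K i = 0"
      using K by (auto simp: KK lag_def)
    from nx Push have La: "L = Write j c # K'" "i = j" "a = (r j, Left)" by (auto simp: KK)
    have "fst (ts ! j) (snd (ts ! j)) = r j" using j len by (simp add: r tape_read_def)
    then have "fst (tape_act (r j, Left) (ts ! j)) = fst (ts ! j)"
      by (cases "ts ! j") (auto)
    moreover have "snd (tape_act (r j, Left) (ts ! j)) = snd (ts ! j) - 1"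
      by (cases "ts ! j") auto
    ultimately show ?thesis
      using st[OF j] lg La
      by (intro exI[of _ s] conjI repI) (auto simp: KK Push lag_def)
  next
    case (Write j c)
    then have j: "j < n" "j \<noteq> 1" and K': "list_all (uses_stacks n) K'"
      and lg: "\<And>i. lag K i = (if i = j then 1 else 0)"
      using K by (auto simp: KK lag_def)
    from nx Write have La: "L = K'" "i = j" "a = (Some c, Stay)" by (auto simp: KK)
    show ?thesis
      using st[OF j] lg La lag0[OF K'] stack_on_write[of "s j" "fst (ts ! j)" "snd (ts ! j)" c]
      by (intro exI[of _ "s(j := c # s j)"] conjI repI) (auto simp: KK Write fun_upd_def)
  next
    case (Empty j)
    then have j: "j < n" "j \<noteq> 1" and K': "list_all (uses_stacks n) K'" and lg: "\<And>i. lag K i = 0"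
      using K by (auto simp: KK lag_def)
    from nx Empty have "r j = None" and La: "L = K'" "i = 1"
      by (auto simp: KK split: if_splits)
    then have "s j = []" using read[OF j lg] by (auto split: list.splits)
    then show ?thesis using lg La lag0[OF K']
      by (intro exI[of _ s] conjI repI) (auto simp: KK Empty)
  next
    case Fail
    then show ?thesis using nx by (simp add: KK)
  next
    case (Choose f)
    have "\<And>i. lag K i = 0" "\<And>i. lag (f e # K') i = 0"
      using K lag0[of "f e # K'"] by (auto simp: KK Choose lag_def)
    then show ?thesis using nx
      by (intro exI[of _ s] conjI repI) (auto simp: KK Choose)
  next
    case (Seq f g)
    have "\<And>i. lag K i = 0" "\<And>i. lag (f # g # K') i = 0"
      using K lag0[of "f # g # K'"] by (auto simp: KK Seq lag_def)
    then show ?thesis using nx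
      by (intro exI[of _ s] conjI repI) (auto simp: KK Seq)
  next
    case (Star f)
    have "\<And>i. lag K i = 0" "\<And>i. lag (f # Star f # K') i = 0" "\<And>i. lag K' i = 0"
      using K lag0[of "f # Star f # K'"] lag0[of K'] by (auto simp: KK Star lag_def)
    then show ?thesis using nx
      by (intro exI[of _ s] conjI repI) (auto simp: KK Star)
  next
    case Skip
    have "\<And>i. lag K i = 0" "\<And>i. lag K' i = 0"
      using K lag0[of K'] by (auto simp: KK Skip lag_def)
    then show ?thesis using nx
      by (intro exI[of _ s] conjI repI) (auto simp: KK Skip)
  qed
qed

lemma reach_Suc:
  assumes "fst c \<noteq> a"
  shows "(\<exists>t. fst ((tm_step M ^^ t) c) = a) \<longleftrightarrow> (\<exists>t. fst ((tm_step M ^^ t) (tm_step M c)) = a)"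
proof
  assume "\<exists>t. fst ((tm_step M ^^ t) c) = a"
  then obtain t where t: "fst ((tm_step M ^^ t) c) = a" by blast
  then show "\<exists>t. fst ((tm_step M ^^ t) (tm_step M c)) = a"
    using assms by (cases t) (auto simp: funpow_swap1)
next
  assume "\<exists>t. fst ((tm_step M ^^ t) (tm_step M c)) = a"
  then obtain t where "fst ((tm_step M ^^ Suc t) c) = a" by (auto simp: funpow_swap1)
  then show "\<exists>t. fst ((tm_step M ^^ t) c) = a" by blast
qed

lemma not_reach:
  assumes "fst c = N"
  shows "fst ((tm_step M ^^ t) c) \<noteq> h []"
proof -
  have "(tm_step M ^^ t) c = c"
    using assms by (induction t) (auto simp: tm_step_def tm_halted_def prog_tm_def)
  then show ?thesis using assms h_less[of "[]"] by auto
qed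

text \<open>Both sides consume one character per step, so induction on the certificate suffices and
  step numbers need not be matched.\<close>

lemma accepts_iff_run:
  "K \<in> S \<Longrightarrow> represents n K s u ts \<Longrightarrow>
   (\<exists>t. fst ((tm_step M ^^ t) (h K, ts)) = h []) \<longleftrightarrow> run K s u"
proof (induction u arbitrary: K s ts)
  case Nil
  show ?case
  proof (cases "K = []")
    case True
    then show ?thesis by (auto intro: exI[of _ 0])
  next
    case False
    then have "h K \<noteq> h []" using h_inj Nil by auto
    moreover have "fst (tm_step M (h K, ts)) = N"
      using step_halt[OF Nil(1) False, of ts "[]"] Nil by (auto simp: represents_def)
    moreover have "\<not> run K s []" using False by (cases K) auto
    ultimately show ?thesis using reach_Suc[of "(h K, ts)" "h []"] not_reach by auto
  qed
next
  case (Cons e v)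
  have len: "length ts = n" and u: "stack_on (e # v) (ts ! 1)"
    using Cons.prems by (auto simp: represents_def)
  show ?case
  proof (cases "K = []")
    case True
    then show ?thesis by (auto intro: exI[of _ 0])
  next
    case False
    then have ne: "h K \<noteq> h []" using h_inj Cons.prems by auto
    show ?thesis
    proof (cases "next_step K e (\<lambda>i. map tape_read ts ! i)")
      case None
      then have "fst (tm_step M (h K, ts)) = N"
        using step_halt[OF Cons.prems(1) False len _ u] by auto
      moreover have "\<not> run K s (e # v)"
        using run_next_step(1)[OF Cons.prems(2) uses_stacks_S[OF Cons.prems(1)] False refl None] .
      ultimately show ?thesis using ne reach_Suc[of "(h K, ts)" "h []"] not_reach by auto
    next
      case (Some y)
      then obtain L i a where y: "next_step K e (\<lambda>i. map tape_read ts ! i) = Some (L, i, a)"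
        by (cases y) auto
      obtain s' where s': "run K s (e # v) = run L s' v"
        "represents n L s' v (map2 tape_act (acts i a (map tape_read ts)) ts)"
        using run_next_step(2)[OF Cons.prems(2) uses_stacks_S[OF Cons.prems(1)] False refl y]
            by blast
      show ?thesis
        using ne reach_Suc[of "(h K, ts)" "h []"] s' Cons.IH[OF next_in[OF Cons.prems(1) y] s'(2)]
          step_next[OF Cons.prems(1) len u y] by simp
    qed
  qed
qed

end

section \<open>From programs to membership in NP\<close>

text \<open>The certificate is the choice string of a run, so the length of some short run on each
  member bounds the certificate. Soundness, in contrast, concerns runs of any length.\<close>

theorem NP_I:
  assumes n: "n \<ge> 2" and stacks: "uses_stacks n p"
    and sound: "\<And>x k s. exec p ((\<lambda>_. [])(0 := x)) k s \<Longrightarrow> x \<in> L"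
    and complete: "\<And>x. x \<in> L \<Longrightarrow>
      \<exists>k s. exec p ((\<lambda>_. [])(0 := x)) k s \<and> k \<le> poly q (length x)"
  shows "L \<in> NP"
proof -
  obtain h where "bij_betw h (insert [] (conts p [])) {0..<card (insert [] (conts p []))}"
    using ex_bij_betw_finite_nat[of "insert [] (conts p [])"] finite_conts by auto
  then interpret compiled n p h "card (insert [] (conts p []))"
    by unfold_locales (use n stacks in auto)
  have init: "represents n [p] ((\<lambda>_. [])(0 := x)) u (snd (tm_init M x u))"
    and fst_init: "fst (tm_init M x u) = h [p]" for x u
  proof -
    have "lag [p] i = 0" for i using stacks by (auto simp: lag_def split: prog.splits)
    moreover have "stack_on (((\<lambda>_. [])(0 := x)) i) (snd (tm_init M x u) ! i)"
      if "i < n" "i \<noteq> 1" for i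
      using that n stack_on_input_tape
      by (cases i) (auto simp: tm_init_def prog_tm_def nth_Cons')
    ultimately show "represents n [p] ((\<lambda>_. [])(0 := x)) u (snd (tm_init M x u))"
      using n stack_on_input_tape by (auto simp: represents_def tm_init_def prog_tm_def)
  qed (simp add: tm_init_def prog_tm_def)
  have init_eq: "tm_init M x u = (h [p], snd (tm_init M x u))" for x u
    using fst_init[of x u] by (metis prod.collapse)
  have run: "tm_accepts M x u \<longleftrightarrow> run [p] ((\<lambda>_. [])(0 := x)) u" for x u
    unfolding tm_accepts_def tm_run_def using accepts_iff_run[OF start_in init, of x u]
        init_eq[of x u]
    by (simp add: prog_tm_def)
  have "poly_time M"
    unfolding poly_time_def
  \<comment> \<open>The polynomial \<open>n + 1\<close> at \<open>n = length x + length u\<close>: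
    the machine halts after \<open>length u + 1\<close> steps, and the other \<open>length x\<close>
    steps change nothing.\<close>
  proof (intro exI[of _ "[:1, 1:]"] allI)
    fix x u
    have "tm_halted M ((tm_step M ^^ Suc (length u)) (tm_init M x u))"
      using halts[OF start_in, of "snd (tm_init M x u)" u] init[of x u] init_eq[of x u]
      by (simp add: represents_def)
    then have "tm_halted M ((tm_step M ^^ k) ((tm_step M ^^ Suc (length u)) (tm_init M x u)))" for k
    proof (induction k)
      case (Suc k)
      then show ?case by (simp add: tm_step_def)
    qed simp
    from this[of "length x"]
    have "tm_halted M ((tm_step M ^^ (length x + Suc (length u))) (tm_init M x u))"
      by (simp only: funpow_add o_apply)
    then show "tm_halted M (tm_run M x u (poly [:1, 1:] (length x + length u)))"
      by (simp add: tm_run_def)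
  qed
  moreover have "x \<in> L \<longleftrightarrow> (\<exists>u. length u \<le> poly q (length x) \<and> tm_accepts M x u)" for x
  proof
    assume "x \<in> L"
    then obtain k s where "exec p ((\<lambda>_. [])(0 := x)) k s" "k \<le> poly q (length x)"
      using complete by blast
    then obtain v where "length v = k" "run [p] ((\<lambda>_. [])(0 := x)) (v @ [])"
      using exec_imp_run by (metis run.simps(1))
    then show "\<exists>u. length u \<le> poly q (length x) \<and> tm_accepts M x u"
      using \<open>k \<le> _\<close> run by auto
  next
    assume "\<exists>u. length u \<le> poly q (length x) \<and> tm_accepts M x u"
    then obtain u where "run [p] ((\<lambda>_. [])(0 := x)) u" using run by auto
    then show "x \<in> L" using run_imp_execs sound by fastforce
  qed
  moreover have "tm_tapes M \<ge> 2" using n by (simp add: prog_tm_def)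
  ultimately show ?thesis unfolding NP_def using wf by blast
qed

section \<open>Input-output relation and running time\<close>

definition rel :: "prog \<Rightarrow> stacks \<Rightarrow> stacks \<Rightarrow> bool" where
  "rel p s t \<longleftrightarrow> (\<exists>n. exec p s n t)"

text \<open>An upper bound instead of an exact count, so that estimates can be rounded. Completeness
  works with \<open>reaches\<close>, soundness with the timeless \<open>rel\<close>.\<close>

definition reaches :: "prog \<Rightarrow> stacks \<Rightarrow> nat \<Rightarrow> stacks \<Rightarrow> bool" where
  "reaches p s n t \<longleftrightarrow> (\<exists>m\<le>n. exec p s m t)"

inductive_simps exec_simps:
  "exec Skip s n t" "exec Fail s n t" "exec (Pop i c) s n t" "exec (Push i c) s n t"
  "exec (Empty i) s n t" "exec (Seq p q) s n t" "exec (Choose f) s n t"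

lemma rel_simps [simp]:
  "rel Skip s t \<longleftrightarrow> t = s"
  "rel Fail s t \<longleftrightarrow> False"
  "rel (Pop i c) s t \<longleftrightarrow> (\<exists>w. s i = c # w \<and> t = s(i := w))"
  "rel (Push i c) s t \<longleftrightarrow> t = s(i := c # s i)"
  "rel (Empty i) s t \<longleftrightarrow> s i = [] \<and> t = s"
  "rel (Seq p q) s t \<longleftrightarrow> (\<exists>r. rel p s r \<and> rel q r t)"
  "rel (Choose f) s t \<longleftrightarrow> (\<exists>c. rel (f c) s t)"
  unfolding rel_def exec_simps by blast+

lemma rel_Star: "rel (Star p) = (rel p)\<^sup>*\<^sup>*"
proof (intro ext iffI)
  fix s t assume "rel (Star p) s t"
  then obtain n where "exec (Star p) s n t" by (auto simp: rel_def)
  then show "(rel p)\<^sup>*\<^sup>* s t"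
  proof (induction "Star p" s n t rule: exec.induct)
    case (exec_Star1 s a s' b s'')
    then have "rel p s s'" by (auto simp: rel_def)
    then show ?case using exec_Star1 by (meson converse_rtranclp_into_rtranclp)
  qed auto
next
  fix s t assume "(rel p)\<^sup>*\<^sup>* s t"
  then show "rel (Star p) s t"
    by (induction rule: converse_rtranclp_induct) (auto simp: rel_def intro: exec.intros)
qed

lemma reaches_mono: "reaches p s m t \<Longrightarrow> m \<le> n \<Longrightarrow> reaches p s n t"
  unfolding reaches_def by (meson le_trans)

lemma reaches_Skip: "reaches Skip s 1 s"
  and reaches_Pop: "s i = c # w \<Longrightarrow> reaches (Pop i c) s 1 (s(i := w))"
  and reaches_Push: "reaches (Push i c) s 2 (s(i := c # s i))"
  and reaches_Empty: "s i = [] \<Longrightarrow> reaches (Empty i) s 1 s"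
  and reaches_Seq: "reaches p s a r \<Longrightarrow> reaches q r b t \<Longrightarrow> reaches (Seq p q) s (Suc (a + b)) t"
  and reaches_Choose: "reaches (f c) s a t \<Longrightarrow> reaches (Choose f) s (Suc a) t"
  and reaches_Star0: "reaches (Star p) s 1 s"
  and reaches_Star1: "reaches p s a r \<Longrightarrow> reaches (Star p) r b t \<Longrightarrow> reaches (Star p) s (Suc (a + b)) t"
  unfolding reaches_def
  by (meson exec.intros add_le_mono Suc_le_mono le_refl)+

lemmas reaches_Star = reaches_mono[OF reaches_Star1]

lemma reaches_iterate:
  "(\<And>i. i < k \<Longrightarrow> reaches p (\<sigma> i) a (\<sigma> (Suc i))) \<Longrightarrow> reaches (Star p) (\<sigma> 0) (k * Suc a + 1) (\<sigma> k)"
proof (induction k arbitrary: \<sigma>)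
  case 0
  then show ?case using reaches_Star0[of p "\<sigma> 0"] by simp
next
  case (Suc k)
  from Suc.IH[of "\<lambda>i. \<sigma> (Suc i)"] have star: "reaches (Star p) (\<sigma> 1) (k * Suc a + 1) (\<sigma> (Suc k))"
    using Suc.prems by simp
  have "reaches p (\<sigma> 0) a (\<sigma> 1)" using Suc.prems[of 0] by simp
  from this star show ?case by (rule reaches_Star) simp
qed

section \<open>Sequential blocks; moving, guessing and clearing a stack\<close>

definition block :: "prog list \<Rightarrow> prog" where
  "block ps = foldr Seq ps Skip"

lemma rel_block_Nil [simp]: "rel (block []) s t \<longleftrightarrow> t = s"
  by (simp add: block_def)

lemma rel_block_Cons: "rel (block (p # ps)) s t \<longleftrightarrow> (\<exists>r. rel p s r \<and> rel (block ps) r t)"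
  by (simp add: block_def)

lemma rel_block_simps [simp]:
  "rel (block (Pop i c # ps)) s t \<longleftrightarrow> (\<exists>w. s i = c # w \<and> rel (block ps) (s(i := w)) t)"
  "rel (block (Push i c # ps)) s t \<longleftrightarrow> rel (block ps) (s(i := c # s i)) t"
  "rel (block (Empty i # ps)) s t \<longleftrightarrow> s i = [] \<and> rel (block ps) s t"
  "rel (block (Star p # ps)) s t \<longleftrightarrow> (\<exists>r. rel (Star p) s r \<and> rel (block ps) r t)"
  "rel (block (Choose f # ps)) s t \<longleftrightarrow> (\<exists>c r. rel (f c) s r \<and> rel (block ps) r t)"
  by (auto simp: rel_block_Cons)

lemma uses_stacks_block [simp]: "uses_stacks n (block ps) \<longleftrightarrow> list_all (uses_stacks n) ps"
  by (induction ps) (auto simp: block_def)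

lemma reaches_block0: "reaches (block []) s 1 s"
  using reaches_Skip by (simp add: block_def)

lemma reaches_block:
  "reaches p s a r \<Longrightarrow> reaches (block ps) r b t \<Longrightarrow> reaches (block (p # ps)) s (Suc (a + b)) t"
  using reaches_Seq by (simp add: block_def)

definition move :: "nat \<Rightarrow> nat \<Rightarrow> prog" where
  "move i j = block [Star (Choose (\<lambda>c. block [Pop i c, Push j c])), Empty i]"

definition guess :: "(char \<Rightarrow> bool) \<Rightarrow> nat \<Rightarrow> prog" where
  "guess P i = Star (Choose (\<lambda>c. if P c then Push i c else Fail))"

definition clear :: "(char \<Rightarrow> bool) \<Rightarrow> nat \<Rightarrow> prog" where
  "clear P i = block [Star (Choose (\<lambda>c. if P c then Pop i c else Fail)), Empty i]"

lemma uses_stacks_macros [simp]: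
  "uses_stacks n (move i j) \<longleftrightarrow> i < n \<and> i \<noteq> 1 \<and> j < n \<and> j \<noteq> 1"
  "i < n \<Longrightarrow> i \<noteq> 1 \<Longrightarrow> uses_stacks n (guess P i)"
  "i < n \<Longrightarrow> i \<noteq> 1 \<Longrightarrow> uses_stacks n (clear P i)"
  by (auto simp: move_def guess_def clear_def)

text \<open>The loop may stop at any time, but \<open>Empty i\<close> then fails unless everything
  has been moved.\<close>

lemma rel_move:
  assumes "i \<noteq> j" "rel (move i j) s t"
  shows "t = s(i := [], j := rev (s i) @ s j)"
proof -
  let ?p = "Choose (\<lambda>c. block [Pop i c, Push j c])"
  have "(rel ?p)\<^sup>*\<^sup>* s t" "t i = []" using assms(2) by (auto simp: move_def rel_Star)
  then show ?thesis
  proof (induction rule: converse_rtranclp_induct)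
    case (step r r')
    then show ?case using assms(1) by (auto simp: fun_eq_iff)
  qed (auto simp: fun_eq_iff)
qed

text \<open>Eight steps per character: one for the loop, one for the choice and six for the
  block.\<close>

lemma reaches_move:
  assumes "i \<noteq> j"
  shows "reaches (move i j) s (8 * length (s i) + 5) (s(i := [], j := rev (s i) @ s j))"
proof -
  let ?p = "Choose (\<lambda>c. block [Pop i c, Push j c])"
  have loop: "reaches (Star ?p) s (8 * length w + 1) (s(i := [], j := rev w @ s j))" if
      "w = s i" for w s
    using that
  proof (induction w arbitrary: s)
    case Nil
    then have "s(i := [], j := rev [] @ s j) = s" by auto
    with reaches_Star0[of ?p s] show ?case by (simp only: list.size mult_0_right add_0)
  next
    case (Cons c w)
    let ?s = "s(i := w, j := c # s j)"
    have "?s = (s(i := w))(j := c # (s(i := w)) j)" using assms by simp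
    then have push: "reaches (Push j c) (s(i := w)) 2 ?s" using reaches_Push by metis
    have "reaches (Pop i c) s 1 (s(i := w))" using Cons.prems by (metis reaches_Pop)
    from reaches_block[OF this reaches_block[OF push reaches_block0]]
    have "reaches (block [Pop i c, Push j c]) s 6 ?s" by (simp add: eval_nat_numeral)
    then have "reaches ?p s 7 ?s"
      using reaches_Choose[of "\<lambda>c. block [Pop i c, Push j c]"] by (simp add: eval_nat_numeral)
    moreover have "reaches (Star ?p) ?s (8 * length w + 1) (?s(i := [], j := rev w @ ?s j))"
      using assms by (intro Cons.IH) auto
    moreover have "?s(i := [], j := rev w @ ?s j) = s(i := [], j := rev (c # w) @ s j)"
      using assms by auto
    ultimately have "reaches (Star ?p) ?s (8 * length w + 1) (s(i := [], j := rev (c # w) @ s j))"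
      by (simp only:)
    with \<open>reaches ?p s 7 ?s\<close> show ?case by (rule reaches_Star) simp
  qed
  let ?t = "s(i := [], j := rev (s i) @ s j)"
  have "reaches (Empty i) ?t 1 ?t" by (rule reaches_Empty) (use assms in simp)
  from reaches_block[OF loop[OF refl] reaches_block[OF this reaches_block0]]
  show ?thesis unfolding move_def by (rule reaches_mono) simp
qed

lemma rel_guess:
  assumes "rel (guess P i) s t"
  obtains w where "\<forall>c\<in>set w. P c" "t = s(i := w @ s i)"
proof -
  have "(rel (Choose (\<lambda>c. if P c then Push i c else Fail)))\<^sup>*\<^sup>* s t"
    using assms by (simp add: guess_def rel_Star)
  then have "\<exists>w. (\<forall>c\<in>set w. P c) \<and> t = s(i := w @ s i)"
  proof (induction rule: rtranclp_induct)
    case base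
    then show ?case by (intro exI[of _ "[]"]) auto
  next
    case (step r t)
    then obtain w where w: "\<forall>c\<in>set w. P c" "r = s(i := w @ s i)" by blast
    from step(2) obtain c where "P c" "t = r(i := c # r i)" by (auto split: if_splits)
    with w show ?case by (intro exI[of _ "c # w"]) (auto simp: fun_upd_def)
  qed
  with that show ?thesis by blast
qed

lemma reaches_guess:
  "\<forall>c\<in>set w. P c \<Longrightarrow> reaches (guess P i) s (4 * length w + 1) (s(i := w @ s i))"
  unfolding guess_def
proof (induction w arbitrary: s rule: rev_induct)
  case Nil
  show ?case using reaches_Star0[of _ s] by simp
next
  case (snoc c w)
  let ?p = "Choose (\<lambda>c. if P c then Push i c else Fail)"
  have "reaches ?p s 3 (s(i := c # s i))"
    using reaches_Choose[of "\<lambda>c. if P c then Push i c else Fail" c s 2] reaches_Push snoc.prems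
    by (simp add: eval_nat_numeral)
  moreover
  let ?s = "s(i := c # s i)"
  have "reaches (Star ?p) ?s (4 * length w + 1) (?s(i := w @ ?s i))"
    using snoc.prems by (intro snoc.IH) auto
  then have "reaches (Star ?p) ?s (4 * length w + 1) (s(i := (w @ [c]) @ s i))"
    by (simp only: fun_upd_upd fun_upd_same append.simps append_assoc)
  ultimately show ?case by (rule reaches_Star) simp
qed

lemma rel_clear:
  assumes "rel (clear P i) s t"
  shows "t = s(i := [])" "\<forall>c\<in>set (s i). P c"
proof -
  have "(rel (Choose (\<lambda>c. if P c then Pop i c else Fail)))\<^sup>*\<^sup>* s t" "t i = []"
    using assms by (auto simp: clear_def rel_Star)
  then have "t = s(i := []) \<and> (\<forall>c\<in>set (s i). P c)"
  proof (induction rule: converse_rtranclp_induct)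
    case (step r r')
    then show ?case by (auto simp: fun_eq_iff split: if_splits)
  qed (auto simp: fun_eq_iff)
  then show "t = s(i := [])" "\<forall>c\<in>set (s i). P c" by auto
qed

lemma reaches_clear:
  assumes "\<forall>c\<in>set (s i). P c"
  shows "reaches (clear P i) s (3 * length (s i) + 5) (s(i := []))"
proof -
  let ?p = "Choose (\<lambda>c. if P c then Pop i c else Fail)"
  have loop: "reaches (Star ?p) s (3 * length w + 1) (s(i := []))" if "w = s i"
      "\<forall>c\<in>set w. P c" for w s
    using that
  proof (induction w arbitrary: s)
    case Nil
    then have "s(i := []) = s" by auto
    with reaches_Star0[of ?p s] show ?case by (simp only: list.size mult_0_right add_0)
  next
    case (Cons c w)
    have "P c" using Cons.prems by (metis list.set_intros(1))
    then have "reaches (if P c then Pop i c else Fail) s 1 (s(i := w))"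
      using Cons.prems reaches_Pop[of s i c w] by simp
    from reaches_Choose[of "\<lambda>c. if P c then Pop i c else Fail", OF this] have
        "reaches ?p s 2 (s(i := w))" by (simp add: eval_nat_numeral)
    moreover
    let ?s = "s(i := w)"
    have "set w \<subseteq> set (s i)" using Cons.prems(1) by (metis set_subset_Cons)
    then have "reaches (Star ?p) ?s (3 * length w + 1) (?s(i := []))"
      using Cons.prems by (intro Cons.IH) auto
    then have "reaches (Star ?p) ?s (3 * length w + 1) (s(i := []))" by (simp only: fun_upd_upd)
    ultimately show ?case by (rule reaches_Star) simp
  qed
  have "reaches (Empty i) (s(i := [])) 1 (s(i := []))" by (rule reaches_Empty) simp
  from reaches_block[OF loop[of "s i" s, OF refl assms] reaches_block[OF this reaches_block0]]
  show ?thesis unfolding clear_def by (rule reaches_mono) simp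
qed

section \<open>Running time of loop-free programs\<close>

primrec loop_free :: "prog \<Rightarrow> bool" where
  "loop_free Skip \<longleftrightarrow> True"
| "loop_free Fail \<longleftrightarrow> True"
| "loop_free (Pop i c) \<longleftrightarrow> True"
| "loop_free (Push i c) \<longleftrightarrow> True"
| "loop_free (Write i c) \<longleftrightarrow> True"
| "loop_free (Empty i) \<longleftrightarrow> True"
| "loop_free (Seq p q) \<longleftrightarrow> loop_free p \<and> loop_free q"
| "loop_free (Choose f) \<longleftrightarrow> (\<forall>c. loop_free (f c))"
| "loop_free (Star p) \<longleftrightarrow> False"

text \<open>The worst case over all choices is a maximum over the finite type of characters. It
  yields a time bound for straight-line code from its \<open>rel\<close> alone; the value at
  \<open>Star\<close> is a placeholder, since only loop-free programs are measured.\<close>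

primrec cost :: "prog \<Rightarrow> nat" where
  "cost Skip = 1"
| "cost Fail = 1"
| "cost (Pop i c) = 1"
| "cost (Push i c) = 2"
| "cost (Write i c) = 1"
| "cost (Empty i) = 1"
| "cost (Seq p q) = Suc (cost p + cost q)"
| "cost (Choose f) = Suc (Max (range (\<lambda>c. cost (f c))))"
| "cost (Star p) = 0"

lemma loop_free_block [simp]: "loop_free (block ps) \<longleftrightarrow> list_all loop_free ps"
  by (induction ps) (auto simp: block_def)

lemma reaches_loop_free:
  assumes "loop_free p" "rel p s t"
  shows "reaches p s (cost p) t"
proof -
  have "n \<le> cost p" if "exec p s n t" "loop_free p" for n
    using that
  proof (induction rule: exec.induct)
    case (exec_Choose f c s a s')
    then have "a \<le> cost (f c)" by simp
    also have "\<dots> \<le> Max (range (\<lambda>c. cost (f c)))" by (intro Max_ge) auto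
    finally show ?case by simp
  qed auto
  then show ?thesis using assms by (auto simp: rel_def reaches_def)
qed

definition require :: "bool \<Rightarrow> prog \<Rightarrow> prog" where
  "require P p = (if P then p else Fail)"

lemma require_simps [simp]:
  "rel (require P p) s t \<longleftrightarrow> P \<and> rel p s t"
  "uses_stacks n (require P p) \<longleftrightarrow> (P \<longrightarrow> uses_stacks n p)"
  "loop_free (require P p) \<longleftrightarrow> (P \<longrightarrow> loop_free p)"
  "require True p = p"
  by (simp_all add: require_def)

section \<open>Digit strings\<close>

text \<open>A digit may be negative, so that a digit string has no separate sign. The least significant
  digit comes first.\<close>

definition digit_val :: "char \<Rightarrow> int" where
  "digit_val c = of_char c - 100"

definition digit :: "int \<Rightarrow> char" where
  "digit d = char_of (nat (d + 100))"

definition is_digit :: "char \<Rightarrow> bool" where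
  "is_digit c \<longleftrightarrow> \<bar>digit_val c\<bar> \<le> 9"

primrec val :: "string \<Rightarrow> int" where
  "val [] = 0"
| "val (c # w) = digit_val c + 10 * val w"

lemma digit_val_digit [simp]: "-100 \<le> d \<Longrightarrow> d < 156 \<Longrightarrow> digit_val (digit d) = d"
proof -
  assume d: "-100 \<le> d" "d < 156"
  then have "of_char (char_of (nat (d + 100)) :: char) = (nat (d + 100) :: nat)"
    by (subst of_char_of) simp
  then have "int (of_char (char_of (nat (d + 100)) :: char)) = d + 100" using d by simp
  then show ?thesis unfolding digit_val_def digit_def by (metis add_diff_cancel_right'
      of_nat_of_char)
qed

lemma digit_digit_val [simp]: "digit (digit_val c) = c"
proof -
  have "digit_val c + 100 = int (of_char c)" unfolding digit_val_def by (simp add: of_nat_of_char)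
  then show ?thesis unfolding digit_def by (simp add: char_of_char)
qed

lemma is_digit_digit [simp]: "\<bar>d\<bar> \<le> 9 \<Longrightarrow> is_digit (digit d)"
  by (simp add: is_digit_def)

text \<open>The offset 100 in \<open>digit_val\<close> puts the digits -9, ..., 9 at the character
  codes 91 to 109, away from the separators with the codes 44, 117, 118 and 124.\<close>

lemma not_digit [simp]:
  "\<not> is_digit CHR '',''" "\<not> is_digit CHR ''u''" "\<not> is_digit CHR ''v''" "\<not> is_digit CHR ''|''"
  by (simp_all add: is_digit_def digit_val_def of_char_def)

lemma val_append: "val (v @ w) = val v + 10 ^ length v * val w"
  by (induction v) (auto simp: algebra_simps)

abbreviation digits :: "string \<Rightarrow> bool" where
  "digits w \<equiv> \<forall>c\<in>set w. is_digit c"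

text \<open>A terminator that is not a digit makes a digit string uniquely readable; the parsing
  arguments below rest on this.\<close>

lemma digits_append_unique:
  assumes "v @ d # v' = w @ e # w'" "digits v" "digits w" "\<not> is_digit d" "\<not> is_digit e"
  shows "v = w" "d = e" "v' = w'"
proof -
  have "v = takeWhile is_digit (v @ d # v')" "w = takeWhile is_digit (w @ e # w')"
    using assms(2-) by simp_all
  then show "v = w" using assms(1) by simp
  then show "d = e" "v' = w'" using assms(1) by auto
qed

section \<open>The program\<close>

text \<open>The stacks 0 (input), 2, 4, 6, 8, 9 hold the rest of the input, the matrix, the current
  entry of the column \<open>B\<close>, the current row of \<open>C\<close>, a carry and the number of remaining columns;
  the stacks 3, 5, 7 hold in reverse order what was read from 2, 4, 6. In the matrix, an entry ends
  with \<open>u\<close> or, if it is marked, with \<open>v\<close>, and a row ends with a vertical bar.\<close>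

definition st :: "string \<Rightarrow> string \<Rightarrow> string \<Rightarrow> string \<Rightarrow> string \<Rightarrow> string \<Rightarrow> string \<Rightarrow> string \<Rightarrow> string \<Rightarrow>
    stacks" where
  "st x a a' b b' c c' z k = (\<lambda>_. [])(0 := x, 2 := a, 3 := a', 4 := b, 5 := b', 6 := c, 7 := c',
    8 := z, 9 := k)"

lemma st_nth [simp]:
  "st x a a' b b' c c' z k 0 = x" "st x a a' b b' c c' z k 2 = a" "st x a a' b b' c c' z k 3 = a'"
  "st x a a' b b' c c' z k 4 = b" "st x a a' b b' c c' z k 5 = b'" "st x a a' b b' c c' z k 6 = c"
  "st x a a' b b' c c' z k 7 = c'" "st x a a' b b' c c' z k 8 = z" "st x a a' b b' c c' z k 9 = k"
  by (simp_all add: st_def)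

lemma st_upd [simp]:
  "(st x a a' b b' c c' z k)(0 := w) = st w a a' b b' c c' z k"
  "(st x a a' b b' c c' z k)(2 := w) = st x w a' b b' c c' z k"
  "(st x a a' b b' c c' z k)(3 := w) = st x a w b b' c c' z k"
  "(st x a a' b b' c c' z k)(4 := w) = st x a a' w b' c c' z k"
  "(st x a a' b b' c c' z k)(5 := w) = st x a a' b w c c' z k"
  "(st x a a' b b' c c' z k)(6 := w) = st x a a' b b' w c' z k"
  "(st x a a' b b' c c' z k)(7 := w) = st x a a' b b' c w z k"
  "(st x a a' b b' c c' z k)(8 := w) = st x a a' b b' c c' w k"
  "(st x a a' b b' c c' z k)(9 := w) = st x a a' b b' c c' z w"
  by (auto simp: st_def fun_eq_iff)

lemma st_inject [simp]:
  "st x a a' b b' c c' z k = st y d d' e e' f f' v l \<longleftrightarrow>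
   x = y \<and> a = d \<and> a' = d' \<and> b = e \<and> b' = e' \<and> c = f \<and> c' = f' \<and> z = v \<and> k = l"
proof
  assume eq: "st x a a' b b' c c' z k = st y d d' e e' f f' v l"
  have "st x a a' b b' c c' z k i = st y d d' e e' f f' v l i" for i using eq by simp
  from this[of 0] this[of 2] this[of 3] this[of 4] this[of 5] this[of 6] this[of 7] this[of 8]
      this[of 9]
  show "x = y \<and> a = d \<and> a' = d' \<and> b = e \<and> b' = e' \<and> c = f \<and> c' = f' \<and> z = v \<and> k = l" by simp
qed auto

text \<open>One column of the written addition b + c = a + d, with incoming carry \<open>z\<close>
  and outgoing carry \<open>z'\<close>, both possibly negative. The slack digit \<open>d\<close> is
  guessed and not stored; as it is nonnegative, the slack is too, and \<open>tight\<close> makes it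
  zero.\<close>

definition digit_step :: "bool \<Rightarrow> prog" where
  "digit_step tight = Choose (\<lambda>z. Choose (\<lambda>z'. Choose (\<lambda>b. Choose (\<lambda>c. Choose (\<lambda>a. Choose (\<lambda>d.
     require (is_digit b \<and> is_digit c \<and> is_digit a \<and> is_digit d \<and> 0 \<le> digit_val d \<and>
        (tight \<longrightarrow> digit_val d = 0) \<and>
        digit_val z + digit_val b + digit_val c = digit_val a + digit_val d + 10 * digit_val z')
     (block [Pop 8 z, Push 8 z', Pop 4 b, Push 5 b, Pop 6 c, Push 7 c, Pop 2 a, Push 3 a])))))))"

text \<open>Popping the mark and the comma and finding stack 4 empty shows that all three numbers
  ended at the same digit; the carry 0 makes the addition exact.\<close>

definition entry_end :: "char \<Rightarrow> char \<Rightarrow> prog" where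
  "entry_end m m' = block [Pop 8 (digit 0), Pop 2 m, Push 3 m', Pop 6 CHR '','', Push 7 CHR '','',
    Empty 4]"

text \<open>The old mark \<open>m\<close> and the new mark \<open>m'\<close> are guessed, and
  equality is enforced only when \<open>u\<close> turns into \<open>v\<close>. Dropping a mark is
  allowed and harmless, since it only makes acceptance harder.\<close>

definition entry :: prog where
  "entry = Choose (\<lambda>m. Choose (\<lambda>m'.
     require ({m, m'} \<subseteq> {CHR ''u'', CHR ''v''}) (block [Push 8 (digit 0),
         Star (digit_step (m = CHR ''u'' \<and> m' = CHR ''v'')),
       entry_end m m', move 5 4])))"

text \<open>The entry of \<open>B\<close> is guessed for this row and discarded at its end, whereas
  the row of \<open>C\<close> is kept for the whole pass and is rewound by
  \<open>move 7 6\<close>.\<close>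

definition row :: prog where
  "row = block [guess is_digit 4, Star entry, block [Pop 2 CHR ''|'', Push 3 CHR ''|'', Empty 6],
     move 7 6, clear is_digit 4]"

text \<open>Decimal borrowing: low zeros become nines, parked on stack 8 until the first nonzero
  digit has been lowered. At the value 0 there is no such digit and the run fails.\<close>

definition decrement :: prog where
  "decrement = block [Star (block [Pop 9 (digit 0), Push 8 (digit 9)]),
     Choose (\<lambda>c. require (1 \<le> digit_val c \<and> digit_val c \<le> 9)
       (block [Pop 9 c, Push 9 (digit (digit_val c - 1))])),
     Star (block [Pop 8 (digit 9), Push 9 (digit 9)]), Empty 8]"

text \<open>A pass treats one column of \<open>B\<close> together with the matching row of
  \<open>C\<close>. Every pass is charged to the counter, so there are at most \<open>k\<close> of
  them.\<close>

definition pass :: prog where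
  "pass = block [decrement, Star (block [Push 6 CHR '','', guess is_digit 6]),
     Star row, Empty 2, move 3 2, clear (\<lambda>_. True) 6]"

definition final :: prog where
  "final = clear (\<lambda>c. c \<noteq> CHR ''u'') 2"

section \<open>Soundness\<close>

lemma rel_digit_step:
  "rel (digit_step tight) (st x a a' b b' c c' z k) r \<longleftrightarrow>
   (\<exists>z0 z1 b0 c0 a0 d.
     (is_digit b0 \<and> is_digit c0 \<and> is_digit a0 \<and> is_digit d \<and> 0 \<le> digit_val d \<and>
      (tight \<longrightarrow> digit_val d = 0) \<and>
      digit_val z0 + digit_val b0 + digit_val c0 = digit_val a0 + digit_val d + 10 * digit_val z1) \<and>
     (\<exists>zs. z = z0 # zs \<and> (\<exists>bs. b = b0 # bs \<and> (\<exists>cs. c = c0 # cs \<and> (\<exists>as. a = a0 # as \<and>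
     r = st x as (a0 # a') bs (b0 # b') cs (c0 # c') (z1 # zs) k)))))"
  unfolding digit_step_def by simp

text \<open>Weighting the column equations by powers of ten and adding them makes the intermediate
  carries cancel. The number \<open>d\<close> collects the guessed slack digits, which no stack
  records.\<close>

lemma rel_digit_steps:
  "rel (Star (digit_step tight)) s t \<Longrightarrow> s = st x a a' b b' c c' [z] k \<Longrightarrow>
   \<exists>a0 b0 c0 a1 b1 c1 z' d. t = st x a1 (rev a0 @ a') b1 (rev b0 @ b') c1 (rev c0 @ c') [z'] k \<and>
     a = a0 @ a1 \<and> b = b0 @ b1 \<and> c = c0 @ c1 \<and> digits a0 \<and> digits b0 \<and> digits c0 \<and>
     length b0 = length a0 \<and> length c0 = length a0 \<and> 0 \<le> d \<and> (tight \<longrightarrow> d = 0) \<and>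
     digit_val z + val b0 + val c0 = val a0 + d + 10 ^ length a0 * digit_val z'"
  unfolding rel_Star
proof (induction arbitrary: a a' b b' c c' z rule: converse_rtranclp_induct)
  case base
  show ?case unfolding base by (rule exI[of _ "[]"], rule exI[of _ "[]"], rule exI[of _ "[]"],
      rule exI[of _ a], rule exI[of _ b], rule exI[of _ c], rule exI[of _ z], rule exI[of _ 0]) auto
next
  case (step s r)
  from step.hyps(1)[unfolded step.prems rel_digit_step]
  obtain z0 z1 zs b0 bs c0 cs a0 as d where
    dig: "is_digit b0" "is_digit c0" "is_digit a0" "is_digit d" "0 \<le> digit_val d"
      "tight \<longrightarrow> digit_val d = 0"
    and z1: "digit_val z0 + digit_val b0 + digit_val c0 = digit_val a0 + digit_val d +
        10 * digit_val z1"
    and z: "[z] = z0 # zs" and eq: "b = b0 # bs" "c = c0 # cs" "a = a0 # as"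
    and "r = st x as (a0 # a') bs (b0 # b') cs (c0 # c') (z1 # zs) k"
    by (elim exE conjE) (rule that, assumption+)
  then have r: "r = st x as (a0 # a') bs (b0 # b') cs (c0 # c') [z1] k" by simp
  from step.IH[OF r] obtain av bv cv a1 b1 c1 z' e where
    t: "t = st x a1 (rev av @ a0 # a') b1 (rev bv @ b0 # b') c1 (rev cv @ c0 # c') [z'] k"
    and eqs: "as = av @ a1" "bs = bv @ b1" "cs = cv @ c1" "digits av" "digits bv" "digits cv"
     "length bv = length av" "length cv = length av" "0 \<le> e" "tight \<longrightarrow> e = 0"
    and v: "digit_val z1 + val bv + val cv = val av + e + 10 ^ length av * digit_val z'"
    by blast
  have "10 * (digit_val z1 + val bv + val cv) = 10 * (val av + e + 10 ^ length av * digit_val z')"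
    using v by simp
  then have "digit_val z + val (b0 # bv) + val (c0 # cv)
      = val (a0 # av) + (digit_val d + 10 * e) + 10 ^ length (a0 # av) * digit_val z'"
    using z1 z by (simp add: algebra_simps)
  with t eq eqs dig show ?case
    apply -
    apply (rule exI[of _ "a0 # av"], rule exI[of _ "b0 # bv"], rule exI[of _ "c0 # cv"],
        rule exI[of _ a1], 
        rule exI[of _ b1], rule exI[of _ c1], rule exI[of _ z'], rule exI[of _ "digit_val d +
            10 * e"])
    by auto
qed

section \<open>Marked matrices, their encoding, and what a pass does to them\<close>

type_synonym cell = "string \<times> bool"

definition mark :: "bool \<Rightarrow> char" where
  "mark m = (if m then CHR ''v'' else CHR ''u'')"

definition enc_cell :: "cell \<Rightarrow> string" where
  "enc_cell e = fst e @ [mark (snd e)]"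

definition enc_cells :: "cell list \<Rightarrow> string" where
  "enc_cells es = concat (map enc_cell es) @ ''|''"

definition enc_rows :: "cell list list \<Rightarrow> string" where
  "enc_rows = concat \<circ> map enc_cells"

definition enc_vec :: "string list \<Rightarrow> string" where
  "enc_vec cs = concat (map (\<lambda>c. c @ '','') cs)"

lemma not_digit_mark [simp]: "\<not> is_digit (mark m)"
  by (simp add: mark_def)

text \<open>The mark of a cell records that the minimum is attained in one of the columns seen so far.\<close>

definition cell_rel :: "int \<Rightarrow> int \<Rightarrow> cell \<Rightarrow> cell \<Rightarrow> bool" where
  "cell_rel b c e e' \<longleftrightarrow> fst e' = fst e \<and> val (fst e) \<le> b + c \<and>
     (snd e' \<longrightarrow> snd e \<or> val (fst e) = b + c)"

text \<open>The carry is zero at both ends, so the invariant of the digit loop becomes b + c = a + d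
  with d >= 0. The separators popped afterwards show which numbers the loop has read.\<close>

lemma rel_entry:
  assumes "rel entry (st x a a' b [] c c' [] k) t"
    and c: "c = enc_vec cs" "\<forall>w\<in>set cs. digits w"
  obtains e e' r d ds where "a = enc_cell e @ r" "cs = d # ds" "cell_rel (val b) (val d) e e'"
    "digits b" "digits (fst e)" "t = st x r (rev (enc_cell e') @ a') b [] (enc_vec ds) (rev (d @
      '','') @ c') [] k"
proof -
  from assms(1) obtain m m' s1 s2 s3 where m: "{m, m'} \<subseteq> {CHR ''u'', CHR ''v''}"
    and s1: "s1 = st x a a' b [] c c' [digit 0] k"
    and s2: "rel (Star (digit_step (m = CHR ''u'' \<and> m' = CHR ''v''))) s1 s2"
    and s3: "rel (entry_end m m') s2 s3" and t: "rel (move 5 4) s3 t"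
    unfolding entry_def
    by (simp add: rel_block_Cons[of "entry_end _ _"] rel_block_Cons[of "move _ _"]
        del: insert_subset)
      (elim exE conjE, rule that, assumption, rule refl, assumption+)
  from rel_digit_steps[OF s2 s1] obtain a0 b0 c0 a1 b1 c1 z d where
    r2: "s2 = st x a1 (rev a0 @ a') b1 (rev b0 @ []) c1 (rev c0 @ c') [z] k"
    and eqs: "a = a0 @ a1" "b = b0 @ b1" "c = c0 @ c1" "digits a0" "digits b0" "digits c0"
     "0 \<le> d" "m = CHR ''u'' \<and> m' = CHR ''v'' \<longrightarrow> d = 0"
    and v: "digit_val (digit 0) + val b0 + val c0 = val a0 + d + 10 ^ length a0 * digit_val z"
    by blast
  from s3[unfolded r2] obtain ar cr where z: "z = digit 0" and a1: "a1 = m # ar" and c1: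
      "c1 = CHR '','' # cr"
    and b1: "b1 = []" and r3: "s3 = st x ar (m' # rev a0 @ a') []
        (rev b0) cr (CHR '','' # rev c0 @ c') [] k"
    by (auto simp: entry_end_def)
  have t': "t = st x ar (m' # rev a0 @ a') b [] cr (CHR '','' # rev c0 @ c') [] k"
    using rel_move[OF _ t] b1 eqs by (simp add: r3)
  have nd: "\<not> is_digit m" using m by auto
  have "cs \<noteq> []" using c eqs c1 by (auto simp: enc_vec_def)
  then obtain w ds where cs: "cs = w # ds" by (cases cs) auto
  then have "c0 @ CHR '','' # cr = w @ CHR '','' # enc_vec ds"
    using c eqs c1 by (simp add: enc_vec_def)
  from digits_append_unique[OF this] have cw: "c0 = w" "cr = enc_vec ds" using eqs c cs by auto
  have "cell_rel (val b) (val w) (a0, m = CHR ''v'') (a0, m' = CHR ''v'')"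
    using v z eqs b1 cw m by (auto simp: cell_rel_def)
  moreover have "a = enc_cell (a0, m = CHR ''v'') @ ar"
    using eqs a1 m by (auto simp: enc_cell_def mark_def)
  moreover have "rev (enc_cell (a0, m' = CHR ''v'')) = m' # rev a0"
    using m by (auto simp: enc_cell_def mark_def)
  ultimately show ?thesis using that[of "(a0, m = CHR ''v'')" ar w ds "(a0, m' = CHR ''v'')"]
      cs eqs b1 t' cw
    by simp
qed

lemmas rel_block_macros = rel_block_Cons[of "move i j" for i j] rel_block_Cons[of
    "guess P i" for P i]
  rel_block_Cons[of "clear P i" for P i] rel_block_Cons[of "block ps" for ps]

fun cells_rel :: "int \<Rightarrow> int list \<Rightarrow> cell list \<Rightarrow> cell list \<Rightarrow> bool" where
  "cells_rel b [] [] [] \<longleftrightarrow> True"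
| "cells_rel b (c # cs) (e # es) (e' # es') \<longleftrightarrow> cell_rel b c e e' \<and> cells_rel b cs es es'"
| "cells_rel b _ _ _ \<longleftrightarrow> False"

fun rows_rel :: "int list \<Rightarrow> int list \<Rightarrow> cell list list \<Rightarrow> cell list list \<Rightarrow> bool" where
  "rows_rel cs [] [] [] \<longleftrightarrow> True"
| "rows_rel cs (b # bs) (R # Rs) (R' # Rs') \<longleftrightarrow> cells_rel b cs R R' \<and> rows_rel cs bs Rs Rs'"
| "rows_rel cs _ _ _ \<longleftrightarrow> False"

definition wf_cells :: "cell list \<Rightarrow> bool" where
  "wf_cells es \<longleftrightarrow> (\<forall>e\<in>set es. digits (fst e))"

lemma wf_cells_simps [simp]:
  "wf_cells []" "wf_cells (e # es) \<longleftrightarrow> digits (fst e) \<and> wf_cells es"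
  by (simp_all add: wf_cells_def)

lemma cells_rel_wf: "cells_rel b cs es es' \<Longrightarrow> wf_cells es \<Longrightarrow> wf_cells es'"
  by (induction b cs es es' rule: cells_rel.induct) (auto simp: cell_rel_def)

lemma rows_rel_wf: "rows_rel cs bs Rs Rs' \<Longrightarrow> list_all wf_cells Rs \<Longrightarrow> list_all wf_cells Rs'"
  by (induction cs bs Rs Rs' rule: rows_rel.induct) (auto intro: cells_rel_wf)

lemma mark_simps [simp]: "CHR ''|'' \<noteq> mark m" "mark m \<noteq> CHR ''|''" "mark m = mark m' \<longleftrightarrow> m = m'"
  by (simp_all add: mark_def)

text \<open>A pass knows the cells only through their encoding. Marks and bars are not digits, so
  the encoding determines the cells.\<close>

lemma enc_cells_unique:
  "enc_cells es @ r = enc_cells es' @ r' \<Longrightarrow> wf_cells es \<Longrightarrow> wf_cells es' \<Longrightarrow> es = es' \<and> r = r'"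
proof (induction es arbitrary: es')
  case Nil
  show ?case
  proof (cases es')
    case Nil
    then show ?thesis using Nil.prems by (simp add: enc_cells_def)
  next
    case (Cons e es2)
    then have "[] @ CHR ''|'' # r = fst e @ mark (snd e) # enc_cells es2 @ r'"
      using Nil.prems by (simp add: enc_cells_def enc_cell_def)
    from digits_append_unique(2)[OF this] Cons Nil.prems show ?thesis by simp
  qed
next
  case (Cons e es)
  show ?case
  proof (cases es')
    case Nil
    then have "fst e @ mark (snd e) # enc_cells es @ r = [] @ CHR ''|'' # r'"
      using Cons.prems by (simp add: enc_cells_def enc_cell_def)
    from digits_append_unique(2)[OF this] Nil Cons.prems show ?thesis by simp
  next
    fix e' es2 assume es': "es' = e' # es2"
    then have "fst e @ mark (snd e) # enc_cells es @ r = fst e' @ mark (snd e') # enc_cells es2 @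
        r'"
      using Cons.prems by (simp add: enc_cells_def enc_cell_def)
    from digits_append_unique[OF this] es' Cons.prems
    have "fst e = fst e'" "mark (snd e) = mark (snd e')" "enc_cells es @ r = enc_cells es2 @ r'"
        by auto
    then show ?thesis using Cons.IH[of es2] Cons.prems es'
      by (simp add: prod_eq_iff)
  qed
qed

lemma enc_rows_simps [simp]: "enc_rows [] = []" "enc_rows (R # Rs) = enc_cells R @ enc_rows Rs"
  by (simp_all add: enc_rows_def)

lemma enc_rows_append [simp]: "enc_rows (Rs @ Rs') = enc_rows Rs @ enc_rows Rs'"
  by (simp add: enc_rows_def)

lemma enc_rows_inject:
  "enc_rows Rs = enc_rows Rs' \<Longrightarrow> list_all wf_cells Rs \<Longrightarrow> list_all wf_cells Rs' \<Longrightarrow> Rs = Rs'"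
proof (induction Rs arbitrary: Rs')
  case Nil
  then show ?case by (cases Rs') (auto simp: enc_cells_def)
next
  case (Cons R Rs)
  show ?case
  proof (cases Rs')
    case Nil
    then show ?thesis using Cons.prems by (simp add: enc_cells_def)
  next
    fix R' Qs assume Rs': "Rs' = R' # Qs"
    then have "R = R' \<and> enc_rows Rs = enc_rows Qs"
      using Cons.prems by (intro enc_cells_unique) auto
    then show ?thesis using Cons.IH[of Qs] Cons.prems Rs' by simp
  qed
qed

text \<open>The loop may stop after any number of entries, whence the splitting of
  \<open>cs\<close>; \<open>Empty 6\<close> in \<open>row\<close> later forces the second part to be
  empty.\<close>

lemma rel_entries:
  "rel (Star entry) s t \<Longrightarrow> s = st x a a' b [] (enc_vec cs) c' [] k \<Longrightarrow> \<forall>w\<in>set cs. digits w \<Longrightarrow>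
   \<exists>es es' cs1 cs2 r. a = concat (map enc_cell es) @ r \<and> cs = cs1 @ cs2 \<and> wf_cells es \<and>
     cells_rel (val b) (map val cs1) es es' \<and>
     t = st x r (rev (concat (map enc_cell es')) @ a') b [] (enc_vec cs2) (rev (enc_vec cs1) @
         c') [] k"
  unfolding rel_Star
proof (induction arbitrary: a a' c' cs rule: converse_rtranclp_induct)
  case base
  show ?case unfolding base
    by (rule exI[of _ "[]"], rule exI[of _ "[]"], rule exI[of _ "[]"], rule exI[of _ cs],
        rule exI[of _ a])
      (simp add: enc_vec_def)
next
  case (step s r)
  from rel_entry[OF step.hyps(1)[unfolded step.prems] refl step.prems(2)]
  obtain e e' ar d ds where e: "a = enc_cell e @ ar" "cs = d # ds" "cell_rel (val b) (val d) e e'"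
    "digits (fst e)"
    and r: "r = st x ar (rev (enc_cell e') @ a') b [] (enc_vec ds) (rev (d @ '','') @ c') [] k"
        by metis
  from step.IH[OF r] step.prems(2) e obtain es es' cs1 cs2 r' where IH:
    "ar = concat (map enc_cell es) @ r'" "ds = cs1 @ cs2" "wf_cells es"
     "cells_rel (val b) (map val cs1) es es'"
     "t = st x r' (rev (concat (map enc_cell es')) @ rev (enc_cell e') @ a') b [] (enc_vec cs2)
       (rev (enc_vec cs1) @ rev (d @ '','') @ c') [] k" by auto
  then show ?case using e
    by (intro exI[of _ "e # es"] exI[of _ "e' # es'"] exI[of _ "d # cs1"] exI[of _ cs2]
        exI[of _ r'])
      (simp add: enc_vec_def)
qed

lemma rel_row:
  assumes "rel row (st x a a' [] [] (enc_vec cs) [] [] k) t" "\<forall>w\<in>set cs. digits w"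
  obtains b es es' r where "a = enc_cells es @ r" "wf_cells es" "cells_rel b (map val cs) es es'"
    "t = st x r (rev (enc_cells es') @ a') [] [] (enc_vec cs) [] [] k"
proof -
  from assms(1) obtain s1 s2 s3 s4 where
    s1: "rel (guess is_digit 4) (st x a a' [] [] (enc_vec cs) [] [] k) s1"
    and s2: "rel (Star entry) s1 s2" and s3: "rel (block [Pop 2 CHR ''|'', Push 3 CHR ''|'',
        Empty 6]) s2 s3"
    and s4: "rel (move 7 6) s3 s4" and t: "rel (clear is_digit 4) s4 t"
    unfolding row_def by (simp only: rel_block_macros rel_block_simps rel_block_Nil) blast
  from rel_guess[OF s1] obtain b where "s1 = st x a a' b [] (enc_vec cs) [] [] k" by auto
  from rel_entries[OF s2 this assms(2)] obtain es es' cs1 cs2 r where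
    r: "a = concat (map enc_cell es) @ r" "cs = cs1 @ cs2" "wf_cells es"
     "cells_rel (val b) (map val cs1) es es'"
    and s2': "s2 = st x r (rev (concat (map enc_cell es')) @ a') b []
        (enc_vec cs2) (rev (enc_vec cs1)) [] k"
    by auto
  from s3[unfolded s2'] obtain r' where r': "r = CHR ''|'' # r'" "enc_vec cs2 = []"
    "s3 = st x r' (CHR ''|'' # rev (concat (map enc_cell es')) @ a') b [] []
      (rev (enc_vec cs1)) [] k"
    by auto
  then have "cs2 = []" by (cases cs2) (auto simp: enc_vec_def)
  moreover have "t = st x r' (CHR ''|'' # rev (concat (map enc_cell es')) @ a') [] []
      (enc_vec cs1) [] [] k"
    using rel_clear(1)[OF t] rel_move[OF _ s4] r'(3) by simp
  ultimately show ?thesis using that[of es r' "val b" es'] r r'(1) by (simp add: enc_cells_def)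
qed

lemma rel_rows:
  "rel (Star row) s t \<Longrightarrow> s = st x a a' [] [] (enc_vec cs) [] [] k \<Longrightarrow> \<forall>w\<in>set cs. digits w \<Longrightarrow>
   \<exists>Rs bs Rs' r. a = enc_rows Rs @ r \<and> list_all wf_cells Rs \<and> rows_rel (map val cs) bs Rs Rs' \<and>
     t = st x r (rev (enc_rows Rs') @ a') [] [] (enc_vec cs) [] [] k"
  unfolding rel_Star
proof (induction arbitrary: a a' rule: converse_rtranclp_induct)
  case base
  show ?case unfolding base
    by (rule exI[of _ "[]"], rule exI[of _ "[]"], rule exI[of _ "[]"], rule exI[of _ a]) simp
next
  case (step s r)
  from rel_row[OF step.hyps(1)[unfolded step.prems] step.prems(2)]
  obtain b es es' ar where e: "a = enc_cells es @ ar" "wf_cells es"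
      "cells_rel b (map val cs) es es'"
    and r: "r = st x ar (rev (enc_cells es') @ a') [] [] (enc_vec cs) [] [] k" by metis
  from step.IH[OF r step.prems(2)] obtain Rs bs Rs' r' where
    "ar = enc_rows Rs @ r'" "list_all wf_cells Rs" "rows_rel (map val cs) bs Rs Rs'"
    "t = st x r' (rev (enc_rows Rs') @ rev (enc_cells es') @ a') [] [] (enc_vec cs) [] [] k" by auto
  then show ?case using e
    by (intro exI[of _ "es # Rs"] exI[of _ "b # bs"] exI[of _ "es' # Rs'"] exI[of _ r']) simp
qed

section \<open>The counter of remaining columns\<close>

definition nat_digits :: "string \<Rightarrow> bool" where
  "nat_digits w \<longleftrightarrow> (\<forall>c\<in>set w. 0 \<le> digit_val c \<and> digit_val c \<le> 9)"

lemma val_nonneg: "nat_digits w \<Longrightarrow> val w \<ge> 0"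
  by (induction w) (auto simp: nat_digits_def)

lemma val_replicate: "val (replicate n (digit 9)) = 10 ^ n - 1" "val (replicate n (digit 0)) = 0"
  by (induction n) auto

text \<open>Either loop may be left too early, but then the required nonzero digit is not on top or
  \<open>Empty 8\<close> fails. The arithmetic is that \<open>n\<close> zeros below a digit
  \<open>e\<close> become \<open>n\<close> nines below \<open>e - 1\<close>.\<close>

lemma rel_decrement:
  assumes "rel decrement (st x a a' b b' c c' [] k) t" "nat_digits k"
  obtains k' where "t = st x a a' b b' c c' [] k'" "val k' = val k - 1" "nat_digits k'"
proof -
  from assms(1) obtain s1 s2 s3 e where
    s1: "rel (Star (block [Pop 9 (digit 0), Push 8 (digit 9)])) (st x a a' b b' c c' [] k) s1"
    and s2: "rel (require (1 \<le> digit_val e \<and> digit_val e \<le> 9)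
       (block [Pop 9 e, Push 9 (digit (digit_val e - 1))])) s1 s2"
    and s3: "rel (Star (block [Pop 8 (digit 9), Push 9 (digit 9)])) s2 s3" and t: "s3 8 = []"
        "t = s3"
    unfolding decrement_def by (simp only: rel_block_macros rel_block_simps rel_block_Nil) blast
  have "\<exists>n k1. k = replicate n (digit 0) @ k1 \<and> s = st x a a' b b' c c' (replicate n (digit 9)) k1"
    if "rel (Star (block [Pop 9 (digit 0), Push 8 (digit 9)])) (st x a a' b b' c c' [] k) s" for s
    using that[unfolded rel_Star]
  proof (induction rule: rtranclp_induct)
    case base
    show ?case by (rule exI[of _ 0]) simp
  next
    case (step r s)
    from step.IH obtain n k1 where n: "k = replicate n (digit 0) @ k1"
      "r = st x a a' b b' c c' (replicate n (digit 9)) k1" by blast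
    from step.hyps(2)[unfolded n(2)] obtain k2 where "k1 = digit 0 # k2"
      "s = st x a a' b b' c c' (digit 9 # replicate n (digit 9)) k2" by auto
    then show ?case using n
      by (intro exI[of _ "Suc n"] exI[of _ k2]) (simp add: replicate_app_Cons_same)
  qed
  from this[OF s1] obtain n k1 where k: "k = replicate n (digit 0) @ k1"
    and s1': "s1 = st x a a' b b' c c' (replicate n (digit 9)) k1" by auto
  from s2[unfolded s1'] obtain k2 where k1: "k1 = e # k2" and e: "1 \<le> digit_val e" "digit_val e \<le> 9"
    and s2': "s2 = st x a a' b b' c c' (replicate n (digit 9)) (digit (digit_val e - 1) # k2)"
        by auto
  have "\<exists>m l. replicate n (digit 9) = replicate m (digit 9) @ l \<and>
      s = st x a a' b b' c c' l (replicate m (digit 9) @ digit (digit_val e - 1) # k2)"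
    if "rel (Star (block [Pop 8 (digit 9), Push 9 (digit 9)])) s2 s" for s
    using that[unfolded rel_Star]
  proof (induction rule: rtranclp_induct)
    case base
    show ?case by (rule exI[of _ 0]) (simp add: s2')
  next
    case (step r s)
    from step.IH obtain m l where n: "replicate n (digit 9) = replicate m (digit 9) @ l"
      "r = st x a a' b b' c c' l (replicate m (digit 9) @ digit (digit_val e - 1) # k2)" by blast
    from step.hyps(2)[unfolded n(2)] obtain l2 where "l = digit 9 # l2"
      "s = st x a a' b b' c c' l2 (digit 9 # replicate m (digit 9) @
        digit (digit_val e - 1) # k2)" by auto
    then show ?case using n
      by (intro exI[of _ "Suc m"] exI[of _ l2]) (simp add: replicate_app_Cons_same)
  qed
  from this[OF s3] t obtain m where m: "replicate n (digit 9) = replicate m (digit 9)"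
    and t': "t = st x a a' b b' c c' [] (replicate m (digit 9) @ digit (digit_val e - 1) # k2)"
        by auto
  then have "m = n" by (metis length_replicate)
  moreover have "val (replicate n (digit 9) @ digit (digit_val e - 1) # k2) = val k - 1"
    using e by (simp add: k k1 val_append val_replicate algebra_simps)
  moreover have "nat_digits (replicate n (digit 9) @ digit (digit_val e - 1) # k2)"
    using assms(2) e by (auto simp: nat_digits_def k k1)
  ultimately show ?thesis using that t' by auto
qed

lemma rel_guess_vec:
  "rel (Star (block [Push 6 CHR '','', guess is_digit 6])) s t \<Longrightarrow>
    s = st x a a' b b' (enc_vec ds) c' z k \<Longrightarrow>
   \<forall>w\<in>set ds. digits w \<Longrightarrow> \<exists>cs. (\<forall>w\<in>set cs. digits w) \<and> t = st x a a' b b' (enc_vec cs) c' z k"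
  unfolding rel_Star
proof (induction arbitrary: ds rule: converse_rtranclp_induct)
  case (step s r)
  from step.hyps(1) obtain s' where "s' = st x a a' b b' (CHR '','' # enc_vec ds) c' z k"
    "rel (guess is_digit 6) s' r" unfolding step.prems by (auto simp: rel_block_macros)
  with rel_guess[of is_digit 6 s' r] obtain w where "digits w"
    "r = st x a a' b b' (w @ CHR '','' # enc_vec ds) c' z k" by auto
  then have "r = st x a a' b b' (enc_vec (w # ds)) c' z k" "digits w" by (auto simp: enc_vec_def)
  from step.IH[OF this(1)] this(2) step.prems(2) show ?case by auto
qed auto

lemma rel_pass:
  assumes "rel pass (st x (enc_rows Rs) [] [] [] [] [] [] k) t" "list_all wf_cells Rs"
      "nat_digits k"
  obtains cs bs Rs' k' where "rows_rel cs bs Rs Rs'" "val k' = val k - 1" "nat_digits k'"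
    "t = st x (enc_rows Rs') [] [] [] [] [] [] k'"
proof -
  from assms(1) obtain s1 s2 s3 s4 where
    s1: "rel decrement (st x (enc_rows Rs) [] [] [] [] [] [] k) s1"
    and s2: "rel (Star (block [Push 6 CHR '','', guess is_digit 6])) s1 s2"
    and s3: "rel (Star row) s2 s3" and e: "s3 2 = []" and s4: "rel (move 3 2) s3 s4"
    and t: "rel (clear (\<lambda>_. True) 6) s4 t"
    unfolding pass_def rel_block_Cons[of decrement] rel_block_simps rel_block_macros rel_block_Nil
        by blast
  from rel_decrement[OF s1 assms(3)] obtain k' where k': "val k' = val k - 1" "nat_digits k'"
    and "s1 = st x (enc_rows Rs) [] [] [] (enc_vec []) [] [] k'" by (auto simp: enc_vec_def)
  with rel_guess_vec[OF s2] obtain cs where cs: "\<forall>w\<in>set cs. digits w"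
    and s2': "s2 = st x (enc_rows Rs) [] [] [] (enc_vec cs) [] [] k'" by fastforce
  from rel_rows[OF s3 s2' cs] obtain Rs1 bs Rs' r where
    r: "enc_rows Rs = enc_rows Rs1 @ r" "list_all wf_cells Rs1" "rows_rel (map val cs) bs Rs1 Rs'"
    and s3': "s3 = st x r (rev (enc_rows Rs')) [] [] (enc_vec cs) [] [] k'" by auto
  \<comment> \<open>\<open>Empty 2\<close> guarantees that the whole matrix was traversed; unique
    readability then identifies the traversed rows with the given ones.\<close>
  from e s3' have "r = []" by simp
  then have "Rs1 = Rs" using r assms(2) enc_rows_inject by (metis append_Nil2)
  moreover have "t = st x (enc_rows Rs') [] [] [] [] [] [] k'"
    using rel_clear(1)[OF t] rel_move[OF _ s4] s3' \<open>r = []\<close> by simp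
  ultimately show ?thesis using that r(3) k' by blast
qed

section \<open>Reading the input\<close>

definition is_decimal :: "char \<Rightarrow> bool" where
  "is_decimal c \<longleftrightarrow> -52 \<le> digit_val c \<and> digit_val c \<le> -43"

text \<open>All digits of a negative number are negative, so the sign is passed on to every digit.\<close>

definition convert :: "int \<Rightarrow> char \<Rightarrow> char" where
  "convert s c = digit (s * (digit_val c + 52))"

text \<open>The digits are pushed in reading order, so the most significant one comes to lie at the
  bottom.\<close>

definition nat_string :: "int \<Rightarrow> nat \<Rightarrow> string" where
  "nat_string s n = rev (map (convert s) (enc_nat n))"

definition decimal :: "(char \<Rightarrow> bool) \<Rightarrow> int \<Rightarrow> nat \<Rightarrow> prog" where
  "decimal P s i = Choose (\<lambda>c. require (is_decimal c \<and> P c) (block [Pop 0 c,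
    Push i (convert s c)]))"

text \<open>A leading zero is refused, so that only canonical numerals of positive numbers are read,
  as produced by \<open>enc_nat\<close>.\<close>

definition read_nat :: "int \<Rightarrow> nat \<Rightarrow> prog" where
  "read_nat s i = block [decimal (\<lambda>c. c \<noteq> CHR ''0'') s i, Star (decimal (\<lambda>_. True) s i)]"

text \<open>The zeros are guessed before the digits are read, so they lie below them and act as
  leading zeros. Zero has its own branch because \<open>read_nat\<close> refuses it; in this way
  \<open>-0\<close>, which encodes nothing, is rejected.\<close>

definition read_int :: prog where
  "read_int = Choose (\<lambda>e.
     if e = CHR ''0'' then block [Pop 0 CHR ''+'', guess (\<lambda>c. c = digit 0) 2,
         block [Pop 0 CHR ''0'', Push 2 (digit 0)]]
     else if e = CHR ''+'' then block [Pop 0 CHR ''+'', guess (\<lambda>c. c = digit 0) 2, read_nat 1 2]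
     else block [Pop 0 CHR ''-'', guess (\<lambda>c. c = digit 0) 2, read_nat (-1) 2])"

definition read_cell :: "char \<Rightarrow> prog" where
  "read_cell s = block [Push 2 CHR ''u'', read_int, Pop 0 s]"

text \<open>Terminators are pushed before the contents they end, and each item lands above the
  previous one. Hence columns, and likewise rows, are stored in reverse order, which the proofs
  below undo by reflecting indices.\<close>

definition read_row :: prog where
  "read_row = block [Push 2 CHR ''|'', Star (read_cell CHR '',''), read_cell CHR '';'']"

definition read_instance :: prog where
  "read_instance = block [read_row, Star read_row, read_nat 1 9, Empty 0]"

definition verifier :: prog where
  "verifier = block [read_instance, Star pass, final]"

lemma digit_val_decimal: "d < 10 \<Longrightarrow> digit_val (char_of (48 + d :: nat)) = int d - 52"
proof -
  assume "d < 10"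
  have "nat (int d - 52 + 100) = 48 + d" by simp
  then have "char_of (48 + d) = digit (int d - 52)" by (simp only: digit_def)
  then show ?thesis using \<open>d < 10\<close> by simp
qed

lemma char_of_48 [simp]: "char_of (48 :: nat) = CHR ''0''"
proof -
  have "of_char (CHR ''0'') = (48 :: nat)" by (simp add: of_char_def)
  then show ?thesis by (metis char_of_char)
qed

lemma digit_val_inject: "digit_val c = digit_val d \<Longrightarrow> c = d"
  by (metis digit_digit_val)

lemma convert_decimal: "d < 10 \<Longrightarrow> convert s (char_of (48 + d :: nat)) = digit (s * int d)"
  by (simp add: convert_def digit_val_decimal)

lemma decimalE:
  assumes "is_decimal c"
  obtains d where "d < 10" "c = char_of (48 + d :: nat)"
proof -
  have "digit_val c = digit_val (char_of (48 + nat (digit_val c + 52)))"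
    using assms by (subst digit_val_decimal) (auto simp: is_decimal_def)
  from that[OF _ digit_val_inject[OF this]] assms show ?thesis by (auto simp: is_decimal_def)
qed

lemma enc_nat_snoc: "n \<ge> 1 \<Longrightarrow> d < 10 \<Longrightarrow> enc_nat (10 * n + d) = enc_nat n @ [char_of (48 + d)]"
  by (subst enc_nat.simps) simp

lemma nat_string_snoc: "n \<ge> 1 \<Longrightarrow> d < 10 \<Longrightarrow> nat_string s (10 * n +
    d) = digit (s * int d) # nat_string s n"
  by (simp add: nat_string_def enc_nat_snoc convert_decimal)

lemma enc_nat_digit: "d < 10 \<Longrightarrow> enc_nat d = [char_of (48 + d)]"
  by (simp add: enc_nat.simps)

lemma nat_string_digit: "d < 10 \<Longrightarrow> nat_string s d = [digit (s * int d)]"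
  by (simp add: nat_string_def enc_nat_digit convert_decimal)

lemma nat_induct_decimal [case_names digit snoc]:
  assumes "\<And>d. d < 10 \<Longrightarrow> P d" "\<And>n d. n \<ge> 1 \<Longrightarrow> d < 10 \<Longrightarrow> P n \<Longrightarrow> P (10 * n + d)"
  shows "P (n :: nat)"
proof (induction n rule: less_induct)
  case (less n)
  show ?case
  proof (cases "n < 10")
    case False
    have "P (10 * (n div 10) + n mod 10)" using False less by (intro assms(2)) auto
    then show ?thesis by simp
  qed (rule assms(1))
qed

lemma nat_string_props:
  assumes "\<bar>s\<bar> = 1"
  shows "val (nat_string s n) = s * int n" "digits (nat_string s n)" "s = 1 \<Longrightarrow>
      nat_digits (nat_string s n)"
proof -
  have s: "s = 1 \<or> s = -1" using assms by auto
  have "val (nat_string s n) = s * int n \<and> digits (nat_string s n) \<and> (s = 1 \<longrightarrow>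
      nat_digits (nat_string s n))"
  proof (induction n rule: nat_induct_decimal)
    case (digit d)
    then show ?case using s by (auto simp: nat_string_digit nat_digits_def)
  next
    case (snoc n d)
    then show ?case using s unfolding nat_string_snoc[OF snoc(1,2)]
      by (auto simp: nat_digits_def)
  qed
  then show "val (nat_string s n) = s * int n" "digits (nat_string s n)"
    "s = 1 \<Longrightarrow> nat_digits (nat_string s n)" by auto
qed

lemma length_nat_string: "length (nat_string s n) = length (enc_nat n)"
  by (simp add: nat_string_def)

lemma rel_decimal:
  assumes "rel (decimal P s i) r t" "i \<noteq> 0"
  obtains d w where "d < 10" "P (char_of (48 + d))" "r 0 = char_of (48 + d) # w"
    "t = r(0 := w, i := digit (s * int d) # r i)"
proof -
  from assms obtain c w where c: "is_decimal c" "P c" "r 0 = c # w"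
    "t = r(0 := w, i := convert s c # r i)" by (auto simp: decimal_def)
  obtain d :: nat where d: "d < 10" "c = char_of (48 + d)" using c(1) by (rule decimalE)
  show ?thesis
  proof (rule that)
    show "d < 10" by (rule d)
    show "P (char_of (48 + d))" using c(2) unfolding d(2) .
    show "r 0 = char_of (48 + d) # w" using c(3) unfolding d(2) .
    have "convert s c = digit (s * int d)" unfolding d(2) using d(1) by (rule convert_decimal)
    then show "t = r(0 := w, i := digit (s * int d) # r i)" using c(4) by (simp only:)
  qed
qed

lemma rel_read_nat:
  assumes "rel (read_nat s i) r t" "i \<noteq> 0"
  obtains n y where "n \<ge> 1" "r 0 = enc_nat n @ y" "t = r(0 := y, i := nat_string s n @ r i)"
proof -
  from assms(1) obtain r' where r': "rel (decimal (\<lambda>c. c \<noteq> CHR ''0'') s i) r r'"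
    and "(rel (decimal (\<lambda>_. True) s i))\<^sup>*\<^sup>* r' t"
    by (auto simp: read_nat_def rel_block_Cons rel_Star)
  from this(2) have "\<exists>n y. n \<ge> 1 \<and> r 0 = enc_nat n @ y \<and> t = r(0 := y, i := nat_string s n @ r i)"
  proof (induction rule: rtranclp_induct)
    case base
    from rel_decimal[OF r' assms(2)] obtain d w where d: "d < 10" "char_of (48 + d) \<noteq> CHR ''0''"
      "r 0 = char_of (48 + d) # w" "r' = r(0 := w, i := digit (s * int d) # r i)" .
    have "d \<noteq> 0" using d(2) by (intro notI) simp
    then show ?case using d
      by (intro exI[of _ d] exI[of _ w]) (simp add: enc_nat_digit nat_string_digit fun_upd_def)
  next
    case (step t u)
    then obtain n y where n: "n \<ge> 1" "r 0 = enc_nat n @ y" "t = r(0 := y, i := nat_string s n @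
        r i)" by blast
    from rel_decimal[OF step(2) assms(2)] obtain d w where d: "d < 10"
      "t 0 = char_of (48 + d) # w" "u = t(0 := w, i := digit (s * int d) # t i)" .
    have y: "y = char_of (48 + d) # w" using d(2) n(3) assms(2) by simp
    have "u = r(0 := w, i := nat_string s (10 * n + d) @ r i)"
      unfolding d(3) n(3) nat_string_snoc[OF n(1) d(1)] using assms(2) by (simp add: fun_eq_iff)
    moreover have "r 0 = enc_nat (10 * n + d) @ w" using n d y by (simp add: enc_nat_snoc)
    ultimately show ?case using n(1) by (intro exI[of _ "10 * n + d"]
        exI[of _ w]) (simp add: fun_eq_iff)
  qed
  then show ?thesis using that by blast
qed

text \<open>Any number of zeros may have been guessed; standing at the high end, they do not affect
  the value.\<close>

lemma rel_read_int:
  assumes "rel read_int (st x a [] [] [] [] [] [] k) t"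
  obtains v w y where "x = enc_int v @ y" "digits w" "val w = v" "t = st y (w @ a) [] [] [] [] []
      [] k"
proof -
  note result = that
  have zeros: "\<exists>n. s' = st y (replicate n (digit 0) @ a) [] [] [] [] [] [] k"
    if "rel (guess (\<lambda>c. c = digit 0) 2) (st y a [] [] [] [] [] [] k) s'" for y s'
  proof -
    from rel_guess[OF that] obtain w where "\<forall>c\<in>set w. c = digit 0" "s' = st y (w @ a) [] [] [] []
        [] [] k" by auto
    then show ?thesis using replicate_length_same[of w "digit 0"] by metis
  qed
  have zs: "digits (replicate n (digit 0))" for n by auto
  have num: thesis
    if s: "\<bar>s\<bar> = 1" and sg: "x = (if s < 0 then CHR ''-'' else CHR ''+'') # y"
      and r: "rel (guess (\<lambda>c. c = digit 0) 2) (st y a [] [] [] [] [] [] k) s'"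
          "rel (read_nat s 2) s' t" for s y s'
  proof -
    from zeros[OF r(1)] obtain z where s': "s' = st y (replicate z (digit 0) @ a) [] [] [] [] []
        [] k" by blast
    from rel_read_nat[OF r(2)] obtain n y' where n: "n \<ge> 1" "y = enc_nat n @ y'"
      "t = st y' (nat_string s n @ replicate z (digit 0) @ a) [] [] [] [] [] [] k"
      by (auto simp: s')
    show thesis
    proof (rule result)
      show "x = enc_int (s * int n) @ y'" using n s sg by (auto simp: enc_int_def abs_mult)
      show "digits (nat_string s n @ replicate z (digit 0))" using nat_string_props(2)[OF s] zs
          by auto
      show "val (nat_string s n @ replicate z (digit 0)) = s * int n"
        using nat_string_props(1)[OF s] by (simp add: val_append val_replicate)
      show "t = st y' ((nat_string s n @ replicate z (digit 0)) @ a) [] [] [] [] [] [] k" using n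
          by simp
    qed
  qed
  from assms consider
      y s' where "x = CHR ''+'' # y" "rel (guess (\<lambda>c. c = digit 0) 2) (st y a [] [] [] [] [] []
          k) s'"
        "rel (block [Pop 0 CHR ''0'', Push 2 (digit 0)]) s' t"
    | y s' where "x = CHR ''+'' # y" "rel (guess (\<lambda>c. c = digit 0) 2) (st y a [] [] [] [] [] []
        k) s'"
        "rel (read_nat 1 2) s' t"
    | y s' where "x = CHR ''-'' # y" "rel (guess (\<lambda>c. c = digit 0) 2) (st y a [] [] [] [] [] []
        k) s'"
        "rel (read_nat (-1) 2) s' t"
    by (auto simp: read_int_def rel_block_macros rel_block_Cons[of "read_nat _ _"] split: if_splits)
  then show thesis
  proof cases
    case (1 y s')
    from zeros[OF 1(2)] obtain z where s': "s' = st y (replicate z (digit 0) @ a) [] [] [] [] []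
        [] k" by blast
    from 1(3)[unfolded s'] obtain y' where "y = CHR ''0'' # y'"
      "t = st y' (digit 0 # replicate z (digit 0) @ a) [] [] [] [] [] [] k" by auto
    then show thesis using 1(1) zs
      by (intro that[of 0 y' "digit 0 # replicate z (digit 0)"])
        (auto simp: enc_int_def enc_nat.simps val_replicate)
  next
    case (2 y s')
    then show thesis by (intro num[of 1 y s']) auto
  next
    case (3 y s')
    then show thesis by (intro num[of "-1" y s']) auto
  qed
qed

text \<open>A row of the input as a list, without an index to recognise the last entry; meant for
  nonempty lists.\<close>

definition enc_line :: "int list \<Rightarrow> string" where
  "enc_line vs = concat (map (\<lambda>v. enc_int v @ '','') (butlast vs)) @ enc_int (last vs) @ '';''"

text \<open>The lengths of the digit strings are left open: the padding is guessed, and a pass gets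
  stuck on an entry if the lengths do not match.\<close>

definition initial_cells :: "cell list \<Rightarrow> int list \<Rightarrow> bool" where
  "initial_cells es vs \<longleftrightarrow> wf_cells es \<and> map (val \<circ> fst) es = vs \<and> (\<forall>e\<in>set es. \<not> snd e)"

lemma rel_read_cell:
  assumes "rel (read_cell c) (st x a [] [] [] [] [] [] k) t"
  obtains v e y where "x = enc_int v @ c # y" "initial_cells [e] [v]" "t = st y (enc_cell e @
      a) [] [] [] [] [] [] k"
proof -
  from assms obtain s where s: "rel read_int (st x (CHR ''u'' # a) [] [] [] [] [] [] k) s"
    and t: "\<exists>y. s 0 = c # y \<and> t = s(0 := y)" by (auto simp: read_cell_def rel_block_Cons[of
        read_int])
  from rel_read_int[OF s] obtain v w y where y: "x = enc_int v @ y" "digits w" "val w = v"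
    "s = st y (w @ CHR ''u'' # a) [] [] [] [] [] [] k" by metis
  from t[unfolded y(4)] obtain y' where "y = c # y'" "t = st y' (w @ CHR ''u'' # a) [] [] [] [] []
      [] k"
    by auto
  then show ?thesis using y
    by (intro that[of v y' "(w, False)"]) (auto simp: initial_cells_def enc_cell_def mark_def)
qed

lemma rel_read_row:
  assumes "rel read_row (st x a [] [] [] [] [] [] k) t"
  obtains vs es y where "vs \<noteq> []" "x = enc_line vs @ y" "initial_cells es (rev vs)"
    "t = st y (enc_cells es @ a) [] [] [] [] [] [] k"
proof -
  from assms obtain s where s: "(rel (read_cell CHR '',''))\<^sup>*\<^sup>* (st x (CHR ''|'' # a) [] [] [] []
      [] [] k) s"
    and t: "rel (read_cell CHR '';'') s t"
    by (auto simp: read_row_def rel_block_Cons[of "read_cell _"] rel_Star)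
  from s have "\<exists>vs es y. x = concat (map (\<lambda>v. enc_int v @ '','') vs) @ y \<and>
      initial_cells es (rev vs) \<and>
    s = st y (enc_cells es @ a) [] [] [] [] [] [] k"
  proof (induction rule: rtranclp_induct)
    case base
    show ?case by (rule exI[of _ "[]"], rule exI[of _ "[]"]) (simp add: initial_cells_def
        enc_cells_def)
  next
    case (step r s)
    then obtain vs es y where IH: "x = concat (map (\<lambda>v. enc_int v @ '','') vs) @ y"
        "initial_cells es (rev vs)"
      "r = st y (enc_cells es @ a) [] [] [] [] [] [] k" by blast
    from rel_read_cell[OF step(2)[unfolded IH(3)]] obtain v e z where "y = enc_int v @
        CHR '','' # z"
      "initial_cells [e] [v]" "s = st z (enc_cell e @ enc_cells es @ a) [] [] [] [] [] [] k"
        by metis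
    then show ?case using IH
      by (intro exI[of _ "vs @ [v]"] exI[of _ "e # es"] exI[of _ z]) (auto simp: initial_cells_def
          enc_cells_def)
  qed
  then obtain vs es y where x: "x = concat (map (\<lambda>v. enc_int v @ '','') vs) @ y"
      "initial_cells es (rev vs)"
    "s = st y (enc_cells es @ a) [] [] [] [] [] [] k" by blast
  from rel_read_cell[OF t[unfolded x(3)]] obtain v e z where "y = enc_int v @ CHR '';'' # z"
      "initial_cells [e] [v]" "t = st z (enc_cell e @ enc_cells es @ a) [] [] [] [] [] [] k"
        by metis
  then show ?thesis using x
    by (intro that[of "vs @ [v]" z "e # es"]) (auto simp: initial_cells_def enc_cells_def
        enc_line_def)
qed

lemma rel_read_instance:
  assumes "rel read_instance (st x [] [] [] [] [] [] [] []) t"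
  obtains vss k Rs where "vss \<noteq> []" "\<forall>vs\<in>set vss. vs \<noteq> []" "k \<ge> 1"
    "x = concat (map enc_line vss) @ enc_nat k" "list_all2 initial_cells Rs (map rev (rev vss))"
    "t = st [] (enc_rows Rs) [] [] [] [] [] [] (nat_string 1 k)"
proof -
  from assms obtain s1 s2 s3 where s1: "rel read_row (st x [] [] [] [] [] [] [] []) s1"
    and s2: "(rel read_row)\<^sup>*\<^sup>* s1 s2" and s3: "rel (read_nat 1 9) s2 s3" and t: "s3 0 = []"
        "t = s3"
    by (auto simp: read_instance_def rel_block_Cons[of read_row] rel_block_Cons[of "read_nat _ _"]
        rel_Star)
  from s2 have "\<exists>vss Rs y. vss \<noteq> [] \<and> (\<forall>vs\<in>set vss. vs \<noteq> []) \<and> x = concat (map enc_line vss) @ y \<and>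
    list_all2 initial_cells Rs (map rev (rev vss)) \<and> s2 = st y (enc_rows Rs) [] [] [] [] [] [] []"
  proof (induction rule: rtranclp_induct)
    case base
    from rel_read_row[OF s1] obtain vs es y where "vs \<noteq> []" "x = enc_line vs @ y"
        "initial_cells es (rev vs)"
      "s1 = st y (enc_cells es @ []) [] [] [] [] [] [] []" by metis
    then show ?case by (intro exI[of _ "[vs]"] exI[of _ "[es]"] exI[of _ y]) simp
  next
    case (step r s)
    then obtain vss Rs y where IH: "vss \<noteq> []" "\<forall>vs\<in>set vss. vs \<noteq> []"
        "x = concat (map enc_line vss) @ y"
      "list_all2 initial_cells Rs (map rev (rev vss))" "r = st y (enc_rows Rs) [] [] [] [] [] []
        []" by blast
    from rel_read_row[OF step(2)[unfolded IH(5)]] obtain vs es z where "vs \<noteq> []"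
        "y = enc_line vs @ z"
      "initial_cells es (rev vs)" "s = st z (enc_cells es @ enc_rows Rs) [] [] [] [] [] [] []"
        by metis
    then show ?case using IH
      by (intro exI[of _ "vss @ [vs]"] exI[of _ "es # Rs"] exI[of _ z]) auto
  qed
  then obtain vss Rs y where x: "vss \<noteq> []" "\<forall>vs\<in>set vss. vs \<noteq> []" "x = concat (map enc_line vss) @
      y"
      "list_all2 initial_cells Rs (map rev (rev vss))" "s2 = st y (enc_rows Rs) [] [] [] [] [] []
        []" by blast
  from rel_read_nat[OF s3[unfolded x(5)]] obtain n y' where n: "n \<ge> 1" "y = enc_nat n @ y'"
    "s3 = st y' (enc_rows Rs) [] [] [] [] [] [] (nat_string 1 n)" by auto
  have "y' = []" using t(1) n(3) by simp
  then show ?thesis using x n t(2) by (intro that[of vss n Rs]) auto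
qed

section \<open>Sequences of passes and soundness of the verifier\<close>

fun passes :: "(int list \<times> int list) list \<Rightarrow> cell list list \<Rightarrow> cell list list \<Rightarrow> bool" where
  "passes [] Rs Rs' \<longleftrightarrow> Rs' = Rs"
| "passes ((cs, bs) # ps) Rs Rs' \<longleftrightarrow> (\<exists>Qs. rows_rel cs bs Rs Qs \<and> passes ps Qs Rs')"

lemma rel_passes:
  "rel (Star pass) s t \<Longrightarrow> s = st x (enc_rows Rs) [] [] [] [] [] [] k \<Longrightarrow> list_all wf_cells Rs \<Longrightarrow>
    nat_digits k \<Longrightarrow>
   \<exists>ps Rs' k'. passes ps Rs Rs' \<and> val k = val k' + int (length ps) \<and> nat_digits k' \<and>
     t = st x (enc_rows Rs') [] [] [] [] [] [] k'"
  unfolding rel_Star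
proof (induction arbitrary: Rs k rule: converse_rtranclp_induct)
  case base
  show ?case unfolding base(1)
    by (rule exI[of _ "[]"], rule exI[of _ Rs], rule exI[of _ k]) (use base in auto)
next
  case (step s r)
  from rel_pass[OF step.hyps(1)[unfolded step.prems(1)] step.prems(2,3)] obtain cs bs Rs' k' where
    p: "rows_rel cs bs Rs Rs'" "val k' = val k - 1" "nat_digits k'"
    "r = st x (enc_rows Rs') [] [] [] [] [] [] k'" by metis
  from step.IH[OF p(4) rows_rel_wf[OF p(1) step.prems(2)] p(3)] obtain ps Qs l where
    q: "passes ps Rs' Qs" "val k' = val l + int (length ps)" "nat_digits l"
      "t = st x (enc_rows Qs) [] [] [] [] [] [] l" by blast
  show ?case
    by (rule exI[of _ "(cs, bs) # ps"], rule exI[of _ Qs], rule exI[of _ l]) (use p q in auto)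
qed

lemma cells_rel_nth:
  "cells_rel b cs es es' \<longleftrightarrow> length es = length cs \<and> length es' = length cs \<and>
     (\<forall>j<length cs. cell_rel b (cs ! j) (es ! j) (es' ! j))"
  by (induction b cs es es' rule: cells_rel.induct) (auto simp: All_less_Suc2)

lemma rows_rel_nth:
  "rows_rel cs bs Rs Rs' \<longleftrightarrow> length Rs = length bs \<and> length Rs' = length bs \<and>
     (\<forall>i<length bs. cells_rel (bs ! i) cs (Rs ! i) (Rs' ! i))"
  by (induction cs bs Rs Rs' rule: rows_rel.induct) (auto simp: All_less_Suc2)

text \<open>Each pass verifies the inequality at every entry, and a mark that is new at the end was
  set by some pass in which equality held. Each pass also fixes the dimensions, as its vectors have
  to match every row and the number of rows.\<close>

lemma passes_nth:
  "passes ps Rs Rs' \<Longrightarrow> i < length Rs \<Longrightarrow> j < length (Rs ! i) \<Longrightarrow>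
    length Rs' = length Rs \<and> length (Rs' ! i) = length (Rs ! i) \<and>
    (\<forall>(cs, bs)\<in>set ps. length bs = length Rs \<and> length cs = length (Rs ! i) \<and>
      val (fst (Rs ! i ! j)) \<le> bs ! i + cs ! j) \<and>
    (snd (Rs' ! i ! j) \<longrightarrow> snd (Rs ! i ! j) \<or> (\<exists>(cs, bs)\<in>set ps. val (fst (Rs ! i ! j)) = bs ! i +
        cs ! j))"
proof (induction ps Rs Rs' rule: passes.induct)
  case (2 cs bs ps Rs Rs')
  then obtain Qs where Q: "rows_rel cs bs Rs Qs" "passes ps Qs Rs'" by auto
  have q: "length Qs = length Rs" "length (Qs ! i) = length (Rs ! i)" "length bs = length Rs"
    "length cs = length (Rs ! i)" "cell_rel (bs ! i) (cs ! j) (Rs ! i ! j) (Qs ! i ! j)"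
    using Q(1) 2(3,4) by (auto simp: rows_rel_nth cells_rel_nth)
  have IH: "length Rs' = length Qs \<and> length (Rs' ! i) = length (Qs ! i) \<and>
    (\<forall>(cs, bs)\<in>set ps. length bs = length Qs \<and> length cs = length (Qs ! i) \<and>
      val (fst (Qs ! i ! j)) \<le> bs ! i + cs ! j) \<and>
    (snd (Rs' ! i ! j) \<longrightarrow> snd (Qs ! i ! j) \<or> (\<exists>(cs, bs)\<in>set ps. val (fst (Qs ! i ! j)) = bs ! i +
        cs ! j))"
    using 2(3,4) q by (intro 2(1)[OF Q(2)]) auto
  have "fst (Qs ! i ! j) = fst (Rs ! i ! j)" "val (fst (Rs ! i ! j)) \<le> bs ! i + cs ! j"
    "snd (Qs ! i ! j) \<longrightarrow> snd (Rs ! i ! j) \<or> val (fst (Rs ! i ! j)) = bs ! i + cs ! j"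
    using q(5) by (auto simp: cell_rel_def)
  then show ?case using IH q by auto
qed auto

lemma verifier_sound:
  assumes "rel verifier ((\<lambda>_. [])(0 := x)) t"
  obtains vss k Rs ps Rs' where "vss \<noteq> []" "\<forall>vs\<in>set vss. vs \<noteq> []" "k \<ge> 1"
    "x = concat (map enc_line vss) @ enc_nat k" "list_all2 initial_cells Rs (map rev (rev vss))"
    "passes ps Rs Rs'" "length ps \<le> k" "\<forall>R\<in>set Rs'. \<forall>e\<in>set R. snd e"
proof -
  have "(\<lambda>_. [])(0 := x) = st x [] [] [] [] [] [] [] []" by (auto simp: st_def fun_eq_iff)
  then obtain s1 s2 where s1: "rel read_instance (st x [] [] [] [] [] [] [] []) s1"
    and s2: "rel (Star pass) s1 s2" and t: "rel final s2 t"
    using assms by (auto simp: verifier_def rel_block_Cons[of read_instance]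
        rel_block_Cons[of final])
  from rel_read_instance[OF s1] obtain vss k Rs where
    vss: "vss \<noteq> []" "\<forall>vs\<in>set vss. vs \<noteq> []" "k \<ge> 1" "x = concat (map enc_line vss) @ enc_nat k"
    "list_all2 initial_cells Rs (map rev (rev vss))"
    and s1': "s1 = st [] (enc_rows Rs) [] [] [] [] [] [] (nat_string 1 k)" by metis
  have "list_all wf_cells Rs"
    using vss(5) by (auto simp: list_all2_conv_all_nth list_all_length initial_cells_def)
  from rel_passes[OF s2 s1' this nat_string_props(3)] obtain ps Rs' k' where
    ps: "passes ps Rs Rs'" "val (nat_string 1 k) = val k' + int (length ps)" "nat_digits k'"
    and s2': "s2 = st [] (enc_rows Rs') [] [] [] [] [] [] k'" by (metis abs_one)
  have "length ps \<le> k" using ps(2) val_nonneg[OF ps(3)] nat_string_props(1)[of 1 k] by simp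
  moreover have "\<forall>c\<in>set (enc_rows Rs'). c \<noteq> CHR ''u''"
    using rel_clear(2)[of _ 2 s2 t] t s2' by (simp add: final_def)
  then have "snd e" if "R \<in> set Rs'" "e \<in> set R" for R e
  proof -
    have "mark (snd e) \<in> set (enc_rows Rs')"
      using that by (auto simp: enc_rows_def enc_cells_def enc_cell_def intro!: bexI[of _ R]
          bexI[of _ e])
    then show ?thesis using \<open>\<forall>c\<in>set (enc_rows Rs'). c \<noteq> CHR ''u''\<close>
        by (auto simp: mark_def split: if_splits)
  qed
  ultimately show ?thesis using vss ps(1) by (intro that[of vss k Rs ps Rs']) auto
qed

section \<open>Completeness\<close>

lemma reachesI: "loop_free p \<Longrightarrow> rel p s t \<Longrightarrow> cost p \<le> n \<Longrightarrow> reaches p s n t"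
  by (rule reaches_mono[OF reaches_loop_free])

lemma reaches_cong: "reaches p s m t \<Longrightarrow> s = s' \<Longrightarrow> t = t' \<Longrightarrow> m \<le> n \<Longrightarrow> reaches p s' n t'"
  using reaches_mono by blast

lemma cost_block [simp]: "cost (block []) = 1" "cost (block (p # ps)) = Suc (cost p +
    cost (block ps))"
  by (simp_all add: block_def)

lemma loop_free_steps [simp]:
  "loop_free (digit_step tight)" "loop_free (entry_end m m')" "loop_free (decimal P s i)"
  by (simp_all add: digit_step_def entry_end_def decimal_def)

section \<open>Running time of an entry, a row and a pass\<close>

text \<open>Whether a step is \<open>tight\<close> depends on the entry, so the costs of both
  variants are added. In this and the following bounds additive constants are rounded up generously;
  only polynomial growth in \<open>X\<close> matters.\<close>

definition t_digits :: "nat \<Rightarrow> nat" where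
  "t_digits X = X * Suc (cost (digit_step True) + cost (digit_step False)) + 1"

lemma cost_digit_step: "cost (digit_step tight) \<le> cost (digit_step True) + cost (digit_step False)"
  by (cases tight) simp_all

text \<open>The slack is guessed as the digits of \<open>d\<close>, which determines all carries.
  They stay between -4 and 4, and the last one is 0 because the equation is exact and
  \<open>d\<close> has no more digits than \<open>a\<close>.\<close>

lemma reaches_digit_steps:
  assumes "length b = length a" "length c = length a" "digits a" "digits b" "digits c"
    "\<bar>z\<bar> \<le> 4" "0 \<le> d" "d < 10 ^ length a" "tight \<longrightarrow> d = 0" "z + val b + val c = val a + d"
  shows "reaches (Star (digit_step tight)) (st x (a @ a1) a' (b @ b1) b' (c @ c1) c' [digit z] k)
     (t_digits (length a)) (st x a1 (rev a @ a') b1 (rev b @ b') c1 (rev c @ c') [digit 0] k)"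
  using assms
proof (induction a arbitrary: b c z d a' b' c')
  case Nil
  then have "z = 0" by simp
  with Nil show ?case using reaches_Star0 by (simp add: t_digits_def)
next
  case (Cons a0 a)
  from Cons.prems obtain b0 b2 c0 c2 where bc: "b = b0 # b2" "c = c0 # c2"
    by (cases b; cases c) auto
  \<comment> \<open>The lowest slack digit and the carry it forces; the division is exact because
    the equation holds modulo ten.\<close>
  define d0 where "d0 = d mod 10"
  define z1 where "z1 = (z + digit_val b0 + digit_val c0 - digit_val a0 - d0) div 10"
  have d0: "0 \<le> d0" "d0 \<le> 9" by (auto simp: d0_def)
  have d: "d = d0 + 10 * (d div 10)" by (simp add: d0_def)
  have "z + digit_val b0 + digit_val c0 - digit_val a0 - d0 = 10 * (val a +
      d div 10 - val b2 - val c2)"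
    using Cons.prems(10) d unfolding bc by simp
  then have z1: "z + digit_val b0 + digit_val c0 = digit_val a0 + d0 + 10 * z1"
    "z1 = val a + d div 10 - val b2 - val c2" by (auto simp: z1_def)
  have dig: "\<bar>digit_val a0\<bar> \<le> 9" "\<bar>digit_val b0\<bar> \<le> 9" "\<bar>digit_val c0\<bar> \<le> 9"
    using Cons.prems unfolding bc is_digit_def by auto
  \<comment> \<open>\<open>10 * z1\<close> is z + b + c - a - d0 for single digits, which lies
    between -40 and 31.\<close>
  have z1': "\<bar>z1\<bar> \<le> 4" using z1(1) dig d0 Cons.prems(6) by linarith
  have tight: "tight \<longrightarrow> d0 = 0" "tight \<longrightarrow> d div 10 = 0" using Cons.prems(9) by (auto simp: d0_def)
  let ?s = "st x (a @ a1) (a0 # a') (b2 @ b1) (b0 # b') (c2 @ c1) (c0 # c') [digit z1] k"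
  let ?C = "cost (digit_step True) + cost (digit_step False)"
  have "reaches (digit_step tight) (st x ((a0 # a) @ a1) a' (b @ b1) b' (c @ c1) c' [digit z]
      k) ?C ?s"
  proof (rule reachesI)
    show "rel (digit_step tight) (st x ((a0 # a) @ a1) a' (b @ b1) b' (c @ c1) c' [digit z] k) ?s"
      unfolding rel_digit_step
      by (rule exI[of _ "digit z"], rule exI[of _ "digit z1"], rule exI[of _ b0], rule exI[of _ c0],
          rule exI[of _ a0], rule exI[of _ "digit d0"])
        (use bc Cons.prems d0 z1(1) z1' tight in auto)
  qed (simp_all add: cost_digit_step)
  moreover have "reaches (Star (digit_step tight)) ?s (t_digits (length a))
     (st x a1 (rev a @ a0 # a') b1 (rev b2 @ b0 # b') c1 (rev c2 @ c0 # c') [digit 0] k)"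
    using Cons.prems bc z1 z1' tight by (intro Cons.IH[where d = "d div 10"]) auto
  ultimately have "reaches (Star (digit_step tight)) (st x ((a0 # a) @ a1) a' (b @ b1) b' (c @
      c1) c' [digit z] k)
    (t_digits (length (a0 # a)))
    (st x a1 (rev a @ a0 # a') b1 (rev b2 @ b0 # b') c1 (rev c2 @ c0 # c') [digit 0] k)"
    by (rule reaches_Star) (simp add: t_digits_def)
  then show ?case by (simp add: bc)
qed

definition t_entry :: "nat \<Rightarrow> nat" where
  "t_entry X = t_digits X + 8 * X + 60"

text \<open>The best marking that a run can guess: set whenever equality holds, never
  dropped.\<close>

definition update_cell :: "int \<Rightarrow> int \<Rightarrow> cell \<Rightarrow> cell" where
  "update_cell b c e = (fst e, snd e \<or> val (fst e) = b + c)"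

text \<open>Equal lengths let the three numbers end together; the last inequality ensures that
  \<open>X\<close> digits suffice for the slack.\<close>

definition fits :: "nat \<Rightarrow> int \<Rightarrow> string \<Rightarrow> cell \<Rightarrow> bool" where
  "fits X b c e \<longleftrightarrow> length c = X \<and> length (fst e) = X \<and> digits c \<and> digits (fst e) \<and>
     val (fst e) \<le> b + val c \<and> b + val c < val (fst e) + 10 ^ X"

lemma reaches_entry:
  assumes b: "length b = X" "digits b" and "fits X (val b) d e"
  shows "reaches entry (st x (enc_cell e @ r) a' b [] (d @ '','' @ c) c' [] k) (t_entry X)
    (st x r (rev (enc_cell (update_cell (val b) (val d) e)) @ a') b [] c (rev (d @ '','') @ c') []
        k)"
proof -
  define w where "w = fst e"
  define m where "m = mark (snd e)"
  define m' where "m' = mark (snd e \<or> val w = val b + val d)"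
  define tight where "tight \<longleftrightarrow> m = CHR ''u'' \<and> m' = CHR ''v''"
  have w: "length w = X" "digits w" "length d = X" "digits d" "val w \<le> val b + val d"
     "val b + val d - val w < 10 ^ X"
    using assms(3) by (auto simp: fits_def w_def)
  have m: "{m, m'} \<subseteq> {CHR ''u'', CHR ''v''}" by (auto simp: m_def m'_def mark_def)
  \<comment> \<open>The tight variant occurs only if the cell receives its mark now, and then the
    slack vanishes.\<close>
  have tight: "tight \<longrightarrow> val b + val d - val w = 0"
    by (auto simp: tight_def m_def m'_def mark_def split: if_splits)
  let ?s0 = "st x (w @ m # r) a' b [] (d @ '','' @ c) c' [] k"
  let ?s1 = "st x (w @ m # r) a' b [] (d @ '','' @ c) c' [digit 0] k"
  let ?s2 = "st x (m # r) (rev w @ a') [] (rev b) ('','' @ c) (rev d @ c') [digit 0] k"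
  let ?s3 = "st x r (m' # rev w @ a') [] (rev b) c (rev (d @ '','') @ c') [] k"
  let ?s4 = "st x r (m' # rev w @ a') b [] c (rev (d @ '','') @ c') [] k"
  have 1: "reaches (Push 8 (digit 0)) ?s0 2 ?s1" by (rule reachesI) simp_all
  have "reaches (Star (digit_step tight)) (st x (w @ m # r) a' (b @ []) [] (d @ '','' @
      c) c' [digit 0] k)
      (t_digits (length w)) (st x (m # r) (rev w @ a') [] (rev b @ []) ('','' @ c) (rev d @
          c') [digit 0] k)"
    using w b tight by (intro reaches_digit_steps[where d = "val b + val d - val w"]) auto
  then have 2: "reaches (Star (digit_step tight)) ?s1 (t_digits X) ?s2" using w by simp
  have 3: "reaches (entry_end m m') ?s2 20 ?s3" by (rule reachesI) (simp_all add: entry_end_def)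
  have 4: "reaches (move 5 4) ?s3 (8 * X + 5) ?s4"
    using reaches_move[of 5 4 ?s3] b by simp
  have "reaches (block [Push 8 (digit 0), Star (digit_step tight), entry_end m m', move 5 4]) ?s0
      (t_digits X + 8 * X + 40) ?s4"
    by (rule reaches_mono[OF reaches_block[OF 1 reaches_block[OF 2 reaches_block[OF 3
        reaches_block[OF 4 reaches_block0]]]]]) simp
  then have "reaches entry ?s0 (Suc (Suc (t_digits X + 8 * X + 40))) ?s4" unfolding entry_def
    by (intro reaches_Choose[where c = m] reaches_Choose[where c = m'])
      (use m in \<open>simp add: tight_def del: insert_subset\<close>)
  then have "reaches entry ?s0 (t_entry X) ?s4" by (rule reaches_mono) (simp add: t_entry_def)
  then show ?thesis by (simp add: enc_cell_def update_cell_def w_def m_def m'_def)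
qed

definition update_cells :: "int \<Rightarrow> int list \<Rightarrow> cell list \<Rightarrow> cell list" where
  "update_cells b cs es = map2 (update_cell b) cs es"

definition update_rows :: "int list \<Rightarrow> int list \<Rightarrow> cell list list \<Rightarrow> cell list list" where
  "update_rows cs bs Rs = map2 (\<lambda>b. update_cells b cs) bs Rs"

lemma reaches_entries:
  assumes b: "length b = X" "digits b" and "list_all2 (fits X (val b)) cs es"
  shows "reaches (Star entry) (st x (concat (map enc_cell es) @ r) a' b [] (enc_vec cs @ c) c' [] k)
      (length es * Suc (t_entry X) + 1)
      (st x r (rev (concat (map enc_cell (update_cells (val b) (map val cs) es))) @ a') b [] c
        (rev (enc_vec cs) @ c') [] k)"
  using assms(3)
proof (induction arbitrary: a' c' rule: list_all2_induct)
  case Nil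
  show ?case using reaches_Star0 by (simp add: enc_vec_def update_cells_def)
next
  case (Cons d cs e es)
  let ?e = "update_cell (val b) (val d) e"
  from reaches_entry[OF b Cons(1)]
  have "reaches entry (st x (concat (map enc_cell (e # es)) @ r) a' b [] (enc_vec (d # cs) @
      c) c' [] k) (t_entry X)
    (st x (concat (map enc_cell es) @ r) (rev (enc_cell ?e) @ a') b [] (enc_vec cs @ c) (rev (d @
        '','') @ c') [] k)"
    by (simp add: enc_vec_def)
  from reaches_Star[OF this Cons.IH, of "length (e # es) * Suc (t_entry X) + 1"]
  show ?case by (simp add: enc_vec_def update_cells_def)
qed

definition t_row :: "nat \<Rightarrow> nat" where
  "t_row X = X * Suc (t_entry X) + 7 * X + 8 * (X * Suc X) + 60"

lemma length_enc_vec: "\<forall>w\<in>set cs. length w = X \<Longrightarrow> length (enc_vec cs) = length cs * Suc X"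
  by (induction cs) (auto simp: enc_vec_def)

lemma reaches_row:
  assumes b: "length b = X" "digits b" and fit: "list_all2 (fits X (val b)) cs es" and n:
      "length cs \<le> X"
  shows "reaches row (st x (enc_cells es @ r) a' [] [] (enc_vec cs) [] [] k) (t_row X)
      (st x r (rev (enc_cells (update_cells (val b) (map val cs) es)) @ a') [] [] (enc_vec cs) []
          [] k)"
proof -
  let ?es' = "update_cells (val b) (map val cs) es"
  let ?s0 = "st x (enc_cells es @ r) a' [] [] (enc_vec cs) [] [] k"
  let ?s1 = "st x (enc_cells es @ r) a' b [] (enc_vec cs) [] [] k"
  let ?s2 = "st x (CHR ''|'' # r) (rev (concat (map enc_cell ?es')) @ a') b [] []
      (rev (enc_vec cs)) [] k"
  let ?s3 = "st x r (rev (enc_cells ?es') @ a') b [] [] (rev (enc_vec cs)) [] k"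
  let ?s4 = "st x r (rev (enc_cells ?es') @ a') b [] (enc_vec cs) [] [] k"
  let ?s5 = "st x r (rev (enc_cells ?es') @ a') [] [] (enc_vec cs) [] [] k"
  have len: "length es = length cs" using list_all2_lengthD[OF fit] by simp
  have "\<forall>w\<in>set cs. length w = X" using fit
    by (induction rule: list_all2_induct) (auto simp: fits_def)
  from length_enc_vec[OF this] have len': "length (enc_vec cs) \<le> X * Suc X"
    using mult_le_mono1[OF n, of "Suc X"] by simp
  have 1: "reaches (guess is_digit 4) ?s0 (4 * X + 1) ?s1"
      using reaches_guess[of b is_digit 4 ?s0] b by simp
  have 2: "reaches (Star entry) ?s1 (X * Suc (t_entry X) + 1) ?s2"
    by (rule reaches_cong[OF reaches_entries[OF b fit, of x "CHR ''|'' # r" a' "[]" "[]" k]])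
      (use mult_le_mono1[OF n, of "Suc (t_entry X)"] len in \<open>simp_all add: enc_cells_def\<close>)
  have 3: "reaches (block [Pop 2 CHR ''|'', Push 3 CHR ''|'', Empty 6]) ?s2 10 ?s3"
    by (rule reachesI) (simp_all add: enc_cells_def)
  have 4: "reaches (move 7 6) ?s3 (8 * (X * Suc X) + 5) ?s4"
    by (rule reaches_cong[OF reaches_move[of 7 6 ?s3]]) (use len' in simp_all)
  have 5: "reaches (clear is_digit 4) ?s4 (3 * X + 5) ?s5"
    using reaches_clear[of ?s4 4 is_digit] b by simp
  show ?thesis unfolding row_def
    by (rule reaches_mono[OF reaches_block[OF 1 reaches_block[OF 2 reaches_block[OF 3
        reaches_block[OF 4
        reaches_block[OF 5 reaches_block0]]]]]]) (simp add: t_row_def)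
qed

lemma reaches_rows:
  assumes "list_all2 (\<lambda>b R. length b = X \<and> digits b \<and> list_all2 (fits X (val b)) cs R) bs Rs"
      "length cs \<le> X"
  shows "reaches (Star row) (st x (enc_rows Rs) a' [] [] (enc_vec cs) [] [] k) (length Rs * Suc
      (t_row X) + 1)
      (st x [] (rev (enc_rows (update_rows (map val cs) (map val bs) Rs)) @ a') [] []
          (enc_vec cs) [] [] k)"
  using assms(1)
proof (induction arbitrary: a' rule: list_all2_induct)
  case Nil
  show ?case using reaches_Star0 by (simp add: update_rows_def)
next
  case (Cons b bs R Rs)
  let ?R = "update_cells (val b) (map val cs) R"
  from reaches_row[of b X cs R x "enc_rows Rs" a' k] Cons(1) assms(2)
  have "reaches row (st x (enc_rows (R # Rs)) a' [] [] (enc_vec cs) [] [] k) (t_row X)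
    (st x (enc_rows Rs) (rev (enc_cells ?R) @ a') [] [] (enc_vec cs) [] [] k)" by simp
  from reaches_Star[OF this Cons.IH, of "length (R # Rs) * Suc (t_row X) + 1"]
  show ?case by (simp add: update_rows_def)
qed

text \<open>The effect of \<open>decrement\<close> as a function. Zeros arising at the high end are
  kept, so the counter never changes its length.\<close>

fun pred_string :: "string \<Rightarrow> string" where
  "pred_string [] = []"
| "pred_string (c # w) = (if digit_val c = 0 then digit 9 # pred_string w else digit (digit_val c
    - 1) # w)"

lemma pred_string:
  "nat_digits w \<Longrightarrow> val w > 0 \<Longrightarrow> val (pred_string w) = val w - 1 \<and> nat_digits (pred_string w) \<and>
    length (pred_string w) = length w"
proof (induction w)
  case (Cons c w)
  have c: "0 \<le> digit_val c" "digit_val c \<le> 9" "nat_digits w"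
    using Cons.prems(1) by (auto simp: nat_digits_def)
  show ?case
  proof (cases "digit_val c = 0")
    case True
    then have "val w > 0" using Cons.prems(2) by simp
    then have "val (pred_string w) = val w - 1 \<and> nat_digits (pred_string w) \<and>
        length (pred_string w) = length w"
      using Cons.IH c by blast
    then show ?thesis using True by (simp add: nat_digits_def)
  next
    case False
    then show ?thesis using c by (simp add: nat_digits_def)
  qed
qed simp

definition t_dec :: "nat \<Rightarrow> nat" where
  "t_dec X = 14 * X + 60 + cost (Choose (\<lambda>c. require (1 \<le> digit_val c \<and> digit_val c \<le> 9)
       (block [Pop 9 c, Push 9 (digit (digit_val c - 1))])))"

lemma pred_string_split:
  assumes "nat_digits w" "val w > 0"
  obtains n e v where "w = replicate n (digit 0) @ e # v" "1 \<le> digit_val e" "digit_val e \<le> 9"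
    "pred_string w = replicate n (digit 9) @ digit (digit_val e - 1) # v"
proof -
  have "\<exists>n e v. w = replicate n (digit 0) @ e # v \<and> 1 \<le> digit_val e \<and> digit_val e \<le> 9 \<and>
    pred_string w = replicate n (digit 9) @ digit (digit_val e - 1) # v"
    using assms
  proof (induction w)
    case (Cons c w)
    show ?case
    proof (cases "digit_val c = 0")
      case True
      then have c: "c = digit 0" by (metis digit_digit_val)
      from Cons True obtain n e v where "w = replicate n (digit 0) @ e # v" "1 \<le> digit_val e"
          "digit_val e \<le> 9"
        "pred_string w = replicate n (digit 9) @ digit (digit_val e - 1) # v"
          by (auto simp: nat_digits_def)
      then show ?thesis using c by (intro exI[of _ "Suc n"] exI[of _ e] exI[of _ v]) simp
    next
      case False
      then show ?thesis using Cons.prems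
        by (intro exI[of _ 0] exI[of _ c] exI[of _ w]) (auto simp: nat_digits_def)
    qed
  qed simp
  then show ?thesis using that by blast
qed

lemma reaches_decrement:
  assumes "nat_digits w" "val w > 0" "length w \<le> X"
  shows "reaches decrement (st x a a' b b' c c' [] w) (t_dec X) (st x a a' b b' c c' []
      (pred_string w))"
proof -
  obtain n e v where w: "w = replicate n (digit 0) @ e # v" "1 \<le> digit_val e" "digit_val e \<le> 9"
    "pred_string w = replicate n (digit 9) @ digit (digit_val e - 1) # v"
    using assms(1,2) by (rule pred_string_split)
  have n: "n \<le> X" using assms(3) w(1) by simp
  let ?st = "st x a a' b b' c c'"
  have 1: "reaches (Star (block [Pop 9 (digit 0), Push 8 (digit 9)])) (?st [] w) (7 * X + 1)
      (?st (replicate n (digit 9)) (e # v))"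
  proof -
    have "reaches (Star (block [Pop 9 (digit 0), Push 8 (digit 9)]))
        (?st z (replicate n (digit 0) @ e # v)) (n * Suc 6 + 1)
      (?st (replicate n (digit 9) @ z) (e # v))" for z
    proof (induction n arbitrary: z)
      case (Suc n)
      have "reaches (block [Pop 9 (digit 0), Push 8 (digit 9)])
          (?st z (replicate (Suc n) (digit 0) @ e # v)) 6
        (?st (digit 9 # z) (replicate n (digit 0) @ e # v))" by (rule reachesI) simp_all
      from reaches_Star[OF this Suc order_refl] show ?case by (simp add: replicate_app_Cons_same)
    qed (use reaches_Star0 in simp)
    from this[of "[]"] show ?thesis by (rule reaches_cong) (use n w(1) in simp_all)
  qed
  let ?C = "Choose (\<lambda>c. require (1 \<le> digit_val c \<and> digit_val c \<le> 9)
       (block [Pop 9 c, Push 9 (digit (digit_val c - 1))]))"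
  have 2: "reaches ?C (?st (replicate n (digit 9)) (e # v)) (cost ?C)
     (?st (replicate n (digit 9)) (digit (digit_val e - 1) # v))"
    using w(2,3) by (intro reachesI) auto
  have 3: "reaches (Star (block [Pop 8 (digit 9), Push 9 (digit 9)]))
      (?st (replicate n (digit 9)) (digit (digit_val e - 1) # v))
    (7 * X + 1) (?st [] (pred_string w))"
  proof -
    have "reaches (Star (block [Pop 8 (digit 9), Push 9 (digit 9)]))
        (?st (replicate n (digit 9)) z) (n * Suc 6 + 1)
      (?st [] (replicate n (digit 9) @ z))" for z
    proof (induction n arbitrary: z)
      case (Suc n)
      have "reaches (block [Pop 8 (digit 9), Push 9 (digit 9)])
          (?st (replicate (Suc n) (digit 9)) z) 6
        (?st (replicate n (digit 9)) (digit 9 # z))" by (rule reachesI) simp_all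
      from reaches_Star[OF this Suc order_refl] show ?case by (simp add: replicate_app_Cons_same)
    qed (use reaches_Star0 in simp)
    from this[of "digit (digit_val e - 1) # v"] show ?thesis unfolding w(4)
      by (rule reaches_cong) (use n in simp_all)
  qed
  have 4: "reaches (Empty 8) (?st [] (pred_string w)) 1 (?st [] (pred_string w))"
      by (rule reachesI) simp_all
  show ?thesis unfolding decrement_def
    by (rule reaches_mono[OF reaches_block[OF 1 reaches_block[OF 2 reaches_block[OF 3
        reaches_block[OF 4 reaches_block0]]]]])
      (simp add: t_dec_def)
qed

lemma reaches_guess_vec:
  assumes "\<forall>w\<in>set cs. length w = X \<and> digits w"
  shows "reaches (Star (block [Push 6 CHR '','', guess is_digit 6])) (st x a a' b b' ds c' z k)
    (length cs * Suc (4 * X + 10) + 1) (st x a a' b b' (enc_vec cs @ ds) c' z k)"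
  using assms
proof (induction cs arbitrary: ds rule: rev_induct)
  case Nil
  show ?case using reaches_Star0 by (simp add: enc_vec_def)
next
  case (snoc w cs)
  let ?s = "st x a a' b b'"
  have 1: "reaches (Push 6 CHR '','') (?s ds c' z k) 2 (?s ('','' @ ds) c' z k)"
      by (rule reachesI) simp_all
  have 2: "reaches (guess is_digit 6) (?s ('','' @ ds) c' z k) (4 * X + 1) (?s (w @ '','' @
      ds) c' z k)"
    using reaches_guess[of w is_digit 6 "?s ('','' @ ds) c' z k"] snoc.prems by simp
  have 3: "reaches (block [Push 6 CHR '','', guess is_digit 6]) (?s ds c' z k) (4 * X +
      10) (?s (w @ '','' @ ds) c' z k)"
    by (rule reaches_mono[OF reaches_block[OF 1 reaches_block[OF 2 reaches_block0]]]) simp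
  have "reaches (Star (block [Push 6 CHR '','', guess is_digit 6])) (?s (w @ '','' @ ds) c' z k)
    (length cs * Suc (4 * X + 10) + 1) (?s (enc_vec cs @ w @ '','' @ ds) c' z k)"
    using snoc by simp
  from reaches_Star[OF 3 this order_refl] show ?case by (simp add: enc_vec_def)
qed

definition t_pass :: "nat \<Rightarrow> nat" where
  "t_pass X = t_dec X + X * Suc (4 * X + 10) + X * Suc (t_row X) + 8 * (X * (X * Suc X + 1)) +
    3 * (X * Suc X) + 60"

lemma length_enc_rows:
  "\<forall>R\<in>set Rs. length R \<le> n \<and> (\<forall>e\<in>set R. length (fst e) = X) \<Longrightarrow>
    length (enc_rows Rs) \<le> length Rs * (n * Suc X + 1)"
proof (induction Rs)
  case (Cons R Rs)
  have "length (enc_cells R) = length R * Suc X + 1" if "\<forall>e\<in>set R. length (fst e) = X" for R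
    using that by (induction R) (auto simp: enc_cells_def enc_cell_def)
  then have "length (enc_cells R) \<le> n * Suc X + 1" using Cons.prems mult_le_mono1[of "length R" n
      "Suc X"] by simp
  then show ?case using Cons by simp
qed simp

lemma reaches_pass:
  assumes fit: "list_all2 (\<lambda>b R. length b = X \<and> digits b \<and> list_all2 (fits X (val b)) cs R) bs Rs"
    and n: "length cs \<le> X" "length Rs \<le> X" and k: "nat_digits k" "val k > 0" "length k \<le> X"
    and cs: "\<forall>w\<in>set cs. length w = X \<and> digits w"
  shows "reaches pass (st x (enc_rows Rs) [] [] [] [] [] [] k) (t_pass X)
    (st x (enc_rows (update_rows (map val cs) (map val bs) Rs)) [] [] [] [] [] [] (pred_string k))"
proof -
  let ?Rs = "update_rows (map val cs) (map val bs) Rs"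
  let ?k = "pred_string k"
  have len: "length (enc_vec cs) \<le> X * Suc X"
    using cs n(1) mult_le_mono1[OF n(1), of "Suc X"] by (simp add: length_enc_vec[of cs X])
  have "length (enc_rows ?Rs) \<le> length ?Rs * (X * Suc X + 1)"
  proof (intro length_enc_rows ballI conjI)
    fix R' assume "R' \<in> set ?Rs"
    then obtain b R where R: "(b, R) \<in> set (zip (map val bs) Rs)"
        "R' = update_cells b (map val cs) R"
      by (auto simp: update_rows_def)
    then obtain i where i: "i < length Rs" "R = Rs ! i" "i < length bs" by (auto simp: in_set_zip)
    have fitR: "list_all2 (fits X (val (bs ! i))) cs R" using fit i
        by (auto simp: list_all2_conv_all_nth)
    then show "length R' \<le> X" using n(1) R(2) by (simp add: update_cells_def)
    fix e assume "e \<in> set R'"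
    then obtain c e0 where "(c, e0) \<in> set (zip (map val cs) R)" "e = update_cell b c e0"
      using R(2) by (auto simp: update_cells_def)
    then have "e0 \<in> set R" "fst e = fst e0" by (auto simp: update_cell_def dest: set_zip_rightD)
    then show "length (fst e) = X" using fitR
      by (auto simp: list_all2_conv_all_nth fits_def in_set_conv_nth)
  qed
  also have "\<dots> \<le> X * (X * Suc X + 1)" using n(2) by (intro mult_le_mono1) (simp add:
      update_rows_def)
  finally have lenR: "length (enc_rows ?Rs) \<le> X * (X * Suc X + 1)" .
  have 1: "reaches decrement (st x (enc_rows Rs) [] [] [] [] [] [] k) (t_dec X)
      (st x (enc_rows Rs) [] [] [] [] [] [] ?k)"
    by (rule reaches_decrement[OF k])
  have 2: "reaches (Star (block [Push 6 CHR '','', guess is_digit 6])) (st x (enc_rows Rs) [] []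
      [] [] [] [] ?k)
     (X * Suc (4 * X + 10) + 1) (st x (enc_rows Rs) [] [] [] (enc_vec cs) [] [] ?k)"
    by (rule reaches_cong[OF reaches_guess_vec[OF cs, of x "enc_rows Rs" "[]" "[]" "[]" "[]" "[]"
        "[]" ?k]])
      (use mult_le_mono1[OF n(1), of "Suc (4 * X + 10)"] in simp_all)
  have 3: "reaches (Star row) (st x (enc_rows Rs) [] [] [] (enc_vec cs) [] [] ?k) (X * Suc
      (t_row X) + 1)
      (st x [] (rev (enc_rows ?Rs)) [] [] (enc_vec cs) [] [] ?k)"
    by (rule reaches_cong[OF reaches_rows[OF fit n(1), of x "[]" ?k]])
      (use mult_le_mono1[OF n(2), of "Suc (t_row X)"] in simp_all)
  have 4: "reaches (Empty 2) (st x [] (rev (enc_rows ?Rs)) [] [] (enc_vec cs) [] [] ?k) 1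
     (st x [] (rev (enc_rows ?Rs)) [] [] (enc_vec cs) [] [] ?k)" by (rule reachesI) simp_all
  have 5: "reaches (move 3 2) (st x [] (rev (enc_rows ?Rs)) [] [] (enc_vec cs) [] []
      ?k) (8 * (X * (X * Suc X + 1)) + 5)
     (st x (enc_rows ?Rs) [] [] [] (enc_vec cs) [] [] ?k)"
    by (rule reaches_cong[OF reaches_move[of 3 2 "st x [] (rev (enc_rows ?Rs)) [] []
        (enc_vec cs) [] [] ?k"]])
      (use lenR in simp_all)
  have 6: "reaches (clear (\<lambda>_. True) 6) (st x (enc_rows ?Rs) [] [] [] (enc_vec cs) [] []
      ?k) (3 * (X * Suc X) + 5)
     (st x (enc_rows ?Rs) [] [] [] [] [] [] ?k)"
    by (rule reaches_cong[OF reaches_clear[of "st x (enc_rows ?Rs) [] [] [] (enc_vec cs) [] []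
        ?k" 6 "\<lambda>_. True"]])
      (use len in simp_all)
  show ?thesis unfolding pass_def
    by (rule reaches_mono[OF reaches_block[OF 1 reaches_block[OF 2 reaches_block[OF 3
        reaches_block[OF 4
        reaches_block[OF 5 reaches_block[OF 6 reaches_block0]]]]]]]) (simp add: t_pass_def)
qed

section \<open>Running time of reading the input\<close>

lemma is_decimal_char_of: "d < 10 \<Longrightarrow> is_decimal (char_of (48 + d :: nat))"
  by (simp add: is_decimal_def digit_val_decimal)

lemma enc_nat_decimal:
  assumes "n \<ge> 1"
  obtains c ds where "enc_nat n = c # ds" "is_decimal c" "c \<noteq> CHR ''0''" "\<forall>d\<in>set ds. is_decimal d"
proof -
  have "\<exists>c ds. enc_nat n = c # ds \<and> is_decimal c \<and> c \<noteq> CHR ''0'' \<and> (\<forall>d\<in>set ds. is_decimal d)"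
    using assms
  proof (induction n rule: nat_induct_decimal)
    case (digit d)
    have "char_of (48 + d) \<noteq> CHR ''0''"
    proof
      assume "char_of (48 + d) = CHR ''0''"
      then have "digit_val (char_of (48 + d)) = digit_val (char_of (48 + 0 :: nat))" by simp
      then show False using digit by (subst (asm) (1 2) digit_val_decimal) auto
    qed
    then show ?case using digit by (simp add: enc_nat_digit is_decimal_char_of)
  next
    case (snoc n d)
    then obtain c ds where "enc_nat n = c # ds" "is_decimal c" "c \<noteq> CHR ''0''"
        "\<forall>d\<in>set ds. is_decimal d" by auto
    then show ?case using snoc by (simp add: enc_nat_snoc is_decimal_char_of)
  qed
  then show ?thesis using that by blast
qed

lemma length_enc_nat_le: "n < 10 ^ W \<Longrightarrow> W \<ge> 1 \<Longrightarrow> length (enc_nat n) \<le> W"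
proof (induction n arbitrary: W rule: nat_induct_decimal)
  case (digit d)
  then show ?case by (simp add: enc_nat_digit)
next
  case (snoc n d)
  then have n: "10 * n + d < 10 ^ W" "1 \<le> n" by auto
  then obtain V where W: "W = Suc V" by (cases W) auto
  then have V: "n < 10 ^ V" using n by simp
  then have "V \<ge> 1" using n(2) by (cases V) auto
  then show ?case using snoc V W by (simp add: enc_nat_snoc)
qed

definition t_num :: "int \<Rightarrow> nat \<Rightarrow> nat \<Rightarrow> nat" where
  "t_num s i X = cost (decimal (\<lambda>c. c \<noteq> CHR ''0'') s i) +
    X * Suc (cost (decimal (\<lambda>_. True) s i)) + 10"

lemma reaches_decimal:
  "is_decimal c \<Longrightarrow> P c \<Longrightarrow> i \<noteq> 0 \<Longrightarrow>
   reaches (decimal P s i) (r(0 := c # w, i := a)) (cost (decimal P s i)) (r(0 := w,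
       i := convert s c # a))"
  by (rule reachesI) (auto simp: decimal_def fun_eq_iff)

lemma reaches_decimals:
  "\<forall>c\<in>set ds. is_decimal c \<Longrightarrow> i \<noteq> 0 \<Longrightarrow>
   reaches (Star (decimal (\<lambda>_. True) s i)) (r(0 := ds @ y, i := a))
     (length ds * Suc (cost (decimal (\<lambda>_. True) s i)) + 1) (r(0 := y,
         i := rev (map (convert s) ds) @ a))"
proof (induction ds arbitrary: a)
  case Nil
  show ?case using reaches_Star0[of _ "r(0 := y, i := a)"]
    by (simp only: append.simps list.map rev.simps list.size mult_0 add_0)
next
  case (Cons c ds)
  have "reaches (decimal (\<lambda>_. True) s i) (r(0 := c # (ds @ y),
      i := a)) (cost (decimal (\<lambda>_. True) s i))
     (r(0 := ds @ y, i := convert s c # a))"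
    by (rule reaches_decimal) (use Cons.prems in auto)
  moreover have "reaches (Star (decimal (\<lambda>_. True) s i)) (r(0 := ds @ y, i := convert s c # a))
     (length ds * Suc (cost (decimal (\<lambda>_. True) s i)) + 1)
     (r(0 := y, i := rev (map (convert s) ds) @ convert s c # a))"
    by (rule Cons.IH) (use Cons.prems in auto)
  ultimately have "reaches (Star (decimal (\<lambda>_. True) s i)) (r(0 := c # (ds @ y), i := a))
     (length (c # ds) * Suc (cost (decimal (\<lambda>_. True) s i)) + 1)
     (r(0 := y, i := rev (map (convert s) ds) @ convert s c # a))"
    by (rule reaches_Star) simp
  then show ?case by (simp only: append.simps list.map rev.simps append_assoc)
qed

lemma reaches_read_nat:
  assumes "n \<ge> 1" "length (enc_nat n) \<le> X" "i \<noteq> 0"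
  shows "reaches (read_nat s i) (r(0 := enc_nat n @ y, i := a)) (t_num s i X) (r(0 := y,
      i := nat_string s n @ a))"
proof -
  obtain c ds where c: "enc_nat n = c # ds" "is_decimal c" "c \<noteq> CHR ''0''" "\<forall>d\<in>set ds. is_decimal d"
    using assms(1) by (rule enc_nat_decimal)
  have 1: "reaches (decimal (\<lambda>c. c \<noteq> CHR ''0'') s i) (r(0 := c # (ds @ y), i := a))
     (cost (decimal (\<lambda>c. c \<noteq> CHR ''0'') s i)) (r(0 := ds @ y, i := convert s c # a))"
    by (rule reaches_decimal) (use c assms in auto)
  have 2: "reaches (Star (decimal (\<lambda>_. True) s i)) (r(0 := ds @ y, i := convert s c # a))
     (length ds * Suc (cost (decimal (\<lambda>_. True) s i)) + 1)
     (r(0 := y, i := rev (map (convert s) ds) @ convert s c # a))"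
    by (rule reaches_decimals) (use c assms in auto)
  have "length ds \<le> X" using assms(2) c(1) by simp
  from mult_le_mono1[OF this, of "Suc (cost (decimal (\<lambda>_. True) s i))"]
  have "reaches (read_nat s i) (r(0 := c # (ds @ y), i := a)) (t_num s i X)
     (r(0 := y, i := rev (map (convert s) ds) @ convert s c # a))" unfolding read_nat_def
    by (intro reaches_mono[OF reaches_block[OF 1 reaches_block[OF 2 reaches_block0]]])
      (simp only: t_num_def)
  then show ?thesis
    by (simp only: c(1) nat_string_def append.simps list.map rev.simps append_assoc)
qed

text \<open>The guess of zeros that makes every number \<open>X\<close> digits long. They are
  appended because the high digits come last.\<close>

definition int_string :: "nat \<Rightarrow> int \<Rightarrow> string" where
  "int_string X v = nat_string (if v < 0 then -1 else 1) (nat \<bar>v\<bar>) @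
     replicate (X - length (enc_nat (nat \<bar>v\<bar>))) (digit 0)"

lemma int_string_props:
  assumes "\<bar>v\<bar> < 10 ^ X" "X \<ge> 1"
  shows "length (int_string X v) = X" "digits (int_string X v)" "val (int_string X v) = v"
    "length (enc_nat (nat \<bar>v\<bar>)) \<le> X"
proof -
  have "nat \<bar>v\<bar> < 10 ^ X" using assms(1) by (simp add: nat_less_iff)
  then show *: "length (enc_nat (nat \<bar>v\<bar>)) \<le> X" using assms(2) by (rule length_enc_nat_le)
  have s: "\<bar>if v < 0 then -1 else 1 :: int\<bar> = 1" by simp
  show "length (int_string X v) = X" using * by (simp add: int_string_def length_nat_string)
  show "digits (int_string X v)" using nat_string_props(2)[OF s, of "nat \<bar>v\<bar>"]
      by (auto simp: int_string_def)
  show "val (int_string X v) = v"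
    using nat_string_props(1)[OF s, of "nat \<bar>v\<bar>"] by (simp add: int_string_def val_append
        val_replicate)
qed

definition t_int :: "nat \<Rightarrow> nat" where
  "t_int X = t_num 1 2 X + t_num (-1) 2 X + 4 * X + 60"

lemma reaches_read_int:
  assumes "\<bar>v\<bar> < 10 ^ X" "X \<ge> 1"
  shows "reaches read_int (st (enc_int v @ y) a [] [] [] [] [] [] k) (t_int X)
    (st y (int_string X v @ a) [] [] [] [] [] [] k)"
proof -
  define n where "n = nat \<bar>v\<bar>"
  define z where "z = replicate (X - length (enc_nat n)) (digit 0)"
  define sg where "sg = (if v < 0 then CHR ''-'' else CHR ''+'')"
  let ?st = "\<lambda>x a. st x a [] [] [] [] [] [] k"
  have x: "enc_int v @ y = sg # enc_nat n @ y" by (simp add: enc_int_def sg_def n_def)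
  have 1: "reaches (Pop 0 sg) (?st (sg # w) a) 1 (?st w a)" for w by (rule reachesI) simp_all
  have 2: "reaches (guess (\<lambda>c. c = digit 0) 2) (?st w a) (4 * X + 1) (?st w (z @ a))" for w
    by (rule reaches_cong[OF reaches_guess[of z "\<lambda>c. c = digit 0" 2 "?st w a"]]) (auto simp: z_def)
  show ?thesis
  proof (cases "n = 0")
    case True
    then have "v = 0" by (simp add: n_def)
    have 3: "reaches (block [Pop 0 CHR ''0'', Push 2 (digit 0)]) (?st (CHR ''0'' # y) (z @ a)) 10
        (?st y (digit 0 # z @ a))"
      by (rule reachesI) simp_all
    have sg: "sg = CHR ''+''" using \<open>v = 0\<close> by (simp add: sg_def)
    have "reaches read_int (?st (sg # CHR ''0'' # y) a) (t_int X) (?st y (digit 0 # z @ a))"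
      unfolding read_int_def
      by (rule reaches_mono, rule reaches_Choose[where c = "CHR ''0''"],
          simp only: if_True sg[symmetric] simp_thms,
          rule reaches_block[OF 1 reaches_block[OF 2 reaches_block[OF 3 reaches_block0]]]) (simp
              add: t_int_def)
    then show ?thesis unfolding x using True \<open>v = 0\<close>
      by (simp add: int_string_def n_def z_def enc_nat_digit nat_string_digit)
  next
    case False
    define s where "s = (if v < 0 then -1 else 1 :: int)"
    \<comment> \<open>Any choice other than \<open>0\<close> and \<open>+\<close> selects the
      negative branch of \<open>read_int\<close>.\<close>
    define e where "e = (if v < 0 then CHR ''1'' else CHR ''+'')"
    have len: "length (enc_nat n) \<le> X" using int_string_props(4)[OF assms] by (simp add: n_def)
    have "reaches (read_nat s 2) ((?st [] [])(0 := enc_nat n @ y, 2 := z @ a)) (t_num s 2 X)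
       ((?st [] [])(0 := y, 2 := nat_string s n @ z @ a))"
      by (rule reaches_read_nat) (use False len in auto)
    then have 3: "reaches (read_nat s 2) (?st (enc_nat n @ y) (z @ a)) (t_num s 2 X)
        (?st y (nat_string s n @ z @ a))"
      by simp
    have "reaches (block [Pop 0 sg, guess (\<lambda>c. c = digit 0) 2, read_nat s 2])
        (?st (sg # enc_nat n @ y) a)
       (t_num s 2 X + 4 * X + 10) (?st y (nat_string s n @ z @ a))"
      by (rule reaches_mono[OF reaches_block[OF 1 reaches_block[OF 2 reaches_block[OF 3
          reaches_block0]]]]) simp
    then have "reaches read_int (?st (sg # enc_nat n @ y) a) (Suc (t_num s 2 X + 4 * X + 10))
        (?st y (nat_string s n @ z @ a))"
      unfolding read_int_def by (intro reaches_Choose[where c = e]) (cases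
          "v < 0"; simp add: e_def s_def sg_def)
    then have "reaches read_int (?st (sg # enc_nat n @ y) a) (t_int X) (?st y (nat_string s n @
        z @ a))"
      by (rule reaches_mono) (simp add: t_int_def s_def)
    then show ?thesis unfolding x by (simp add: int_string_def n_def z_def s_def)
  qed
qed

definition initial_cell :: "nat \<Rightarrow> int \<Rightarrow> cell" where
  "initial_cell X v = (int_string X v, False)"

lemma reaches_read_cell:
  assumes "\<bar>v\<bar> < 10 ^ X" "X \<ge> 1"
  shows "reaches (read_cell c) (st (enc_int v @ c # y) a [] [] [] [] [] [] k) (t_int X + 10)
    (st y (enc_cell (initial_cell X v) @ a) [] [] [] [] [] [] k)"
proof -
  let ?st = "\<lambda>x a. st x a [] [] [] [] [] [] k"
  have 1: "reaches (Push 2 CHR ''u'') (?st (enc_int v @ c # y) a) 2 (?st (enc_int v @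
      c # y) (CHR ''u'' # a))"
    by (rule reachesI) simp_all
  have 3: "reaches (Pop 0 c) (?st (c # y) (int_string X v @ CHR ''u'' # a)) 1
      (?st y (int_string X v @ CHR ''u'' # a))"
    by (rule reachesI) simp_all
  have "reaches (read_cell c) (?st (enc_int v @ c # y) a) (t_int X + 10) (?st y (int_string X v @
      CHR ''u'' # a))"
    unfolding read_cell_def
    by (rule reaches_mono[OF reaches_block[OF 1 reaches_block[OF reaches_read_int[OF assms]
        reaches_block[OF 3 reaches_block0]]]]) simp
  then show ?thesis by (simp add: initial_cell_def enc_cell_def mark_def)
qed

definition t_read_row :: "nat \<Rightarrow> nat" where
  "t_read_row X = X * Suc (t_int X + 10) + t_int X + 60"

lemma reaches_read_row:
  assumes vs: "\<forall>v\<in>set vs. \<bar>v\<bar> < 10 ^ X" "X \<ge> 1" "vs \<noteq> []" "length vs \<le> X"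
  shows "reaches read_row (st (enc_line vs @ y) a [] [] [] [] [] [] k) (t_read_row X)
    (st y (enc_cells (rev (map (initial_cell X) vs)) @ a) [] [] [] [] [] [] k)"
proof -
  let ?st = "\<lambda>x a. st x a [] [] [] [] [] [] k"
  let ?cells = "\<lambda>vs. concat (map enc_cell (rev (map (initial_cell X) vs)))"
  have star: "reaches (Star (read_cell CHR '','')) (?st (concat (map (\<lambda>v. enc_int v @ '','') us) @
      y) a)
     (length us * Suc (t_int X + 10) + 1) (?st y (?cells us @ a))" if
         "\<forall>v\<in>set us. \<bar>v\<bar> < 10 ^ X" for us y a
    using that
  proof (induction us arbitrary: a)
    case Nil
    show ?case using reaches_Star0 by simp
  next
    case (Cons u us)
    have "reaches (read_cell CHR '','') (?st (concat (map (\<lambda>v. enc_int v @ '','') (u # us)) @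
        y) a) (t_int X + 10)
       (?st (concat (map (\<lambda>v. enc_int v @ '','') us) @ y) (enc_cell (initial_cell X u) @ a))"
      using reaches_read_cell[of u X "CHR '',''" _ a k] Cons.prems vs(2) by simp
    from reaches_Star[OF this Cons.IH, of "length (u # us) * Suc (t_int X + 10) + 1"]
    show ?case using Cons.prems by simp
  qed
  have "enc_cells (rev (map (initial_cell X) (us @ [u]))) @ a
      = enc_cell (initial_cell X u) @ ?cells us @ CHR ''|'' # a" for us u
    by (simp add: enc_cells_def)
  from this[of "butlast vs" "last vs"] have cells: "enc_cells (rev (map (initial_cell X) vs)) @ a
      = enc_cell (initial_cell X (last vs)) @ ?cells (butlast vs) @ CHR ''|'' # a"
    unfolding append_butlast_last_id[OF vs(3)] .
  let ?x = "concat (map (\<lambda>v. enc_int v @ '','') (butlast vs)) @ enc_int (last vs) @ CHR '';'' # y"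
  have 1: "reaches (Push 2 CHR ''|'') (?st ?x a) 2 (?st ?x (CHR ''|'' # a))"
      by (rule reachesI) simp_all
  have "\<forall>v\<in>set (butlast vs). \<bar>v\<bar> < 10 ^ X" using vs(1) by (meson in_set_butlastD)
  note 2 = star[OF this, of "enc_int (last vs) @ CHR '';'' # y" "CHR ''|'' # a"]
  have 3: "reaches (read_cell CHR '';'') (?st (enc_int (last vs) @
      CHR '';'' # y) (?cells (butlast vs) @ CHR ''|'' # a))
     (t_int X + 10) (?st y (enc_cell (initial_cell X (last vs)) @ ?cells (butlast vs) @
         CHR ''|'' # a))"
    by (rule reaches_read_cell) (use vs in auto)
  have "reaches read_row (?st ?x a) (t_read_row X) (?st y (enc_cell (initial_cell X (last vs)) @
      ?cells (butlast vs) @ CHR ''|'' # a))"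
    unfolding read_row_def
  proof (rule reaches_mono[OF reaches_block[OF 1 reaches_block[OF 2 reaches_block[OF 3
      reaches_block0]]]])
    have "length (butlast vs) \<le> X" using vs(4) by simp
    from mult_le_mono1[OF this, of "Suc (t_int X + 10)"]
    show "Suc (2 + Suc (length (butlast vs) * Suc (t_int X + 10) + 1 + Suc (t_int X + 10 +
        1))) \<le> t_read_row X"
      by (simp only: t_read_row_def)
  qed
  then show ?thesis by (simp add: cells enc_line_def)
qed

definition t_read :: "nat \<Rightarrow> nat" where
  "t_read X = X * Suc (t_read_row X) + t_read_row X + t_num 1 9 X + 60"

lemma reaches_read_instance:
  assumes vss: "\<forall>vs\<in>set vss. (\<forall>v\<in>set vs. \<bar>v\<bar> < 10 ^ X) \<and> vs \<noteq> [] \<and> length vs \<le> X" "X \<ge> 1" "vss \<noteq> []"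
    "length vss \<le> X" and k: "k \<ge> 1" "length (enc_nat k) \<le> X"
  shows "reaches read_instance (st (concat (map enc_line vss) @ enc_nat k) [] [] [] [] [] [] []
      []) (t_read X)
    (st [] (enc_rows (rev (map (\<lambda>vs. rev (map (initial_cell X) vs)) vss))) [] [] [] [] [] []
        (nat_string 1 k))"
proof -
  let ?st = "\<lambda>x a. st x a [] [] [] [] [] [] []"
  let ?rows = "\<lambda>vss. enc_rows (rev (map (\<lambda>vs. rev (map (initial_cell X) vs)) vss))"
  let ?t = "t_read_row X"
  have star: "reaches (Star read_row) (?st (concat (map enc_line uss) @
      y) a) (length uss * Suc ?t + 1) (?st y (?rows uss @ a))"
    if "\<forall>vs\<in>set uss. (\<forall>v\<in>set vs. \<bar>v\<bar> < 10 ^ X) \<and> vs \<noteq> [] \<and> length vs \<le> X" for uss y a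
    using that
  proof (induction uss arbitrary: a)
    case Nil
    show ?case using reaches_Star0 by simp
  next
    case (Cons u uss)
    have "reaches read_row (?st (concat (map enc_line (u # uss)) @ y) a) ?t
       (?st (concat (map enc_line uss) @ y) (enc_cells (rev (map (initial_cell X) u)) @ a))"
      using reaches_read_row[of u X "concat (map enc_line uss) @ y" a "[]"] Cons.prems vss(2)
          by simp
    from reaches_Star[OF this Cons.IH, of "length (u # uss) * Suc ?t + 1"]
    show ?case using Cons.prems by simp
  qed
  obtain u uss where u: "vss = u # uss" using vss(3) by (cases vss) auto
  have 1: "reaches read_row (?st (concat (map enc_line vss) @ enc_nat k) []) ?t
      (?st (concat (map enc_line uss) @ enc_nat k) (?rows [u]))"
    using reaches_read_row[of u X "concat (map enc_line uss) @ enc_nat k" "[]" "[]"] vss u by simp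
  have 2: "reaches (Star read_row) (?st (concat (map enc_line uss) @
      enc_nat k) (?rows [u])) (length uss * Suc ?t + 1)
      (?st (enc_nat k) (?rows vss))"
    using star[of uss "enc_nat k" "?rows [u]"] vss u by simp
  have 3: "reaches (read_nat 1 9) (?st (enc_nat k) (?rows vss)) (t_num 1 9 X)
      (st [] (?rows vss) [] [] [] [] [] [] (nat_string 1 k))"
    using reaches_read_nat[OF k, of 9 1 "?st [] (?rows vss)" "[]" "[]"] by simp
  have 4: "reaches (Empty 0) (st [] (?rows vss) [] [] [] [] [] [] (nat_string 1 k)) 1
      (st [] (?rows vss) [] [] [] [] [] [] (nat_string 1 k))" by (rule reachesI) simp_all
  show ?thesis unfolding read_instance_def
  proof (rule reaches_mono[OF reaches_block[OF 1 reaches_block[OF 2 reaches_block[OF 3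
      reaches_block[OF 4 reaches_block0]]]]])
    have "length uss \<le> X" using vss(4) u by simp
    from mult_le_mono1[OF this, of "Suc ?t"]
    show "Suc (?t + Suc (length uss * Suc ?t + 1 + Suc (t_num 1 9 X + Suc (1 + 1)))) \<le> t_read X"
      by (simp only: t_read_def)
  qed
qed

section \<open>The accepting run\<close>

definition cell_grid :: "nat \<Rightarrow> nat \<Rightarrow> nat \<Rightarrow> (nat \<Rightarrow> nat \<Rightarrow> int) \<Rightarrow> (nat \<Rightarrow> nat \<Rightarrow> bool) \<Rightarrow> cell list
    list" where
  "cell_grid X m n a \<mu> = map (\<lambda>i. map (\<lambda>j. (int_string X (a i j), \<mu> i j)) [0..<n]) [0..<m]"

definition t_verify :: "nat \<Rightarrow> nat" where
  "t_verify X = t_read X + X * X * Suc (t_pass X) + 3 * (X * (X * Suc X + 1)) + 60"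

lemma rev_map_upt: "rev (map f [0..<n]) = map (\<lambda>i. f (n - 1 - i)) [0..<n]"
  by (rule nth_equalityI) (auto simp: rev_nth)

text \<open>The single parameter \<open>X\<close> bounds the dimensions and serves as the common
  number of digits. The number of passes is bounded by \<open>q \<le> X * X\<close> rather than by
  \<open>k\<close>, which may be exponential.\<close>

lemma verifier_complete:
  fixes a :: "nat \<Rightarrow> nat \<Rightarrow> int" and b c :: "nat \<Rightarrow> nat \<Rightarrow> int"
  assumes dim: "1 \<le> m" "m \<le> X" "1 \<le> n" "n \<le> X"
    and k: "k \<ge> 1" "length (enc_nat k) \<le> X" "q \<le> k" "q \<le> X * X"
    and a: "\<And>i j. i < m \<Longrightarrow> j < n \<Longrightarrow> \<bar>a i j\<bar> < 10 ^ X"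
    and b: "\<And>i t. i < m \<Longrightarrow> t < q \<Longrightarrow> \<bar>b i t\<bar> < 10 ^ X"
    and c: "\<And>t j. t < q \<Longrightarrow> j < n \<Longrightarrow> \<bar>c t j\<bar> < 10 ^ X"
    and le: "\<And>i j t. i < m \<Longrightarrow> j < n \<Longrightarrow> t < q \<Longrightarrow> a i j \<le> b i t + c t j \<and> b i t + c t j < a i j + 10 ^ X"
    and eq: "\<And>i j. i < m \<Longrightarrow> j < n \<Longrightarrow> \<exists>t<q. a i j = b i t + c t j"
  shows "\<exists>s. reaches verifier ((\<lambda>_. [])(0 := concat (map (\<lambda>i. enc_line (map (a i) [0..<n]))
      [0..<m]) @ enc_nat k))
     (t_verify X) s"
proof -
  have X: "X \<ge> 1" using dim by simp
  \<comment> \<open>The data in the order in which they are stored, with rows and columns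
    reversed.\<close>
  define \<alpha> where "\<alpha> = (\<lambda>i j. a (m - 1 - i) (n - 1 - j))"
  define \<beta> where "\<beta> = (\<lambda>t i. b (m - 1 - i) t)"
  define \<gamma> where "\<gamma> = (\<lambda>t j. c t (n - 1 - j))"
  have \<alpha>: "\<bar>\<alpha> i j\<bar> < 10 ^ X" if "i < m" "j < n" for i j using a that by (simp add: \<alpha>_def)
  have \<beta>: "\<bar>\<beta> t i\<bar> < 10 ^ X" if "i < m" "t < q" for i t using b that by (simp add: \<beta>_def)
  have \<gamma>: "\<bar>\<gamma> t j\<bar> < 10 ^ X" if "t < q" "j < n" for t j using c that by (simp add: \<gamma>_def)
  have le': "\<alpha> i j \<le> \<beta> t i + \<gamma> t j \<and> \<beta> t i + \<gamma> t j < \<alpha> i j + 10 ^ X" if "i < m" "j < n"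
      "t < q" for i j t
    using le that by (simp add: \<alpha>_def \<beta>_def \<gamma>_def)
  have eq': "\<exists>t<q. \<alpha> i j = \<beta> t i + \<gamma> t j" if "i < m" "j < n" for i j
    using eq that by (simp add: \<alpha>_def \<beta>_def \<gamma>_def)
  define vss where "vss = map (\<lambda>i. map (a i) [0..<n]) [0..<m]"
  \<comment> \<open>The matrix after \<open>t\<close> passes: an entry is marked if one of the first
    \<open>t\<close> columns attains it.\<close>
  define R where "R = (\<lambda>t. cell_grid X m n \<alpha> (\<lambda>i j. \<exists>s<t. \<alpha> i j = \<beta> s i + \<gamma> s j))"
  define ks where "ks = (\<lambda>t. (pred_string ^^ t) (nat_string 1 k))"
  define \<sigma> where "\<sigma> = (\<lambda>t. st [] (enc_rows (R t)) [] [] [] [] [] [] (ks t))"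
  have R0: "rev (map (\<lambda>vs. rev (map (initial_cell X) vs)) vss) = R 0"
    by (simp add: vss_def R_def cell_grid_def rev_map_upt initial_cell_def \<alpha>_def comp_def)
  have 1: "reaches read_instance (st (concat (map enc_line vss) @ enc_nat k) [] [] [] [] [] [] []
      []) (t_read X) (\<sigma> 0)"
    unfolding \<sigma>_def ks_def funpow_0 R0[symmetric]
    by (rule reaches_read_instance) (use dim X k a in \<open>auto simp: vss_def\<close>)
  have ks: "nat_digits (ks t) \<and> val (ks t) = int (k - t) \<and> length (ks t) \<le> X" if "t \<le> q" for t
    using that
  proof (induction t)
    case 0
    then show ?case using nat_string_props(1,3)[of 1 k] k(2) by (simp add: ks_def length_nat_string)
  next
    case (Suc t)
    then have IH: "nat_digits (ks t)" "val (ks t) = int (k - t)" "length (ks t) \<le> X" by auto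
    moreover have "k - t > 0" using Suc.prems k(3) by simp
    ultimately show ?case using pred_string[of "ks t"] by (simp add: ks_def)
  qed
  have step: "reaches pass (\<sigma> t) (t_pass X) (\<sigma> (Suc t))" if t: "t < q" for t
  proof -
    define bs where "bs = map (\<lambda>i. int_string X (\<beta> t i)) [0..<m]"
    define cs where "cs = map (\<lambda>j. int_string X (\<gamma> t j)) [0..<n]"
    have vb: "map val bs = map (\<beta> t) [0..<m]"
      using int_string_props(3)[OF \<beta>[OF _ t] X] by (simp add: bs_def)
    have vc: "map val cs = map (\<gamma> t) [0..<n]"
      using int_string_props(3)[OF \<gamma>[OF t] X] by (simp add: cs_def)
    have upd: "update_rows (map val cs) (map val bs) (R t) = R (Suc t)"
      unfolding vb vc R_def cell_grid_def update_rows_def update_cells_def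
      using int_string_props(3)[OF \<alpha> X]
      by (auto simp: map2_map_map update_cell_def less_Suc_eq)
    have fit: "list_all2 (\<lambda>b R. length b = X \<and> digits b \<and> list_all2 (fits X (val b)) cs R) bs (R t)"
      using int_string_props[OF \<alpha> X] int_string_props[OF \<beta>[OF _ t] X] int_string_props[OF \<gamma>[OF t]
          X] le'[OF _ _ t]
      by (simp add: R_def cell_grid_def bs_def cs_def list_all2_conv_all_nth fits_def)
    have cs: "\<forall>w\<in>set cs. length w = X \<and> digits w"
      using int_string_props[OF \<gamma>[OF t] X] by (auto simp: cs_def)
    have kt: "nat_digits (ks t)" "val (ks t) > 0" "length (ks t) \<le> X" using ks[of t] t k(3) by auto
    have len: "length cs \<le> X" "length (R t) \<le> X" using dim
        by (simp_all add: cs_def R_def cell_grid_def)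
    show ?thesis using reaches_pass[OF fit len kt cs, of "[]"] by (simp add: upd \<sigma>_def ks_def)
  qed
  have 2: "reaches (Star pass) (\<sigma> 0) (q * Suc (t_pass X) + 1) (\<sigma> q)"
    by (rule reaches_iterate) (rule step)
  have marked: "\<forall>ch\<in>set (enc_rows (R q)). ch \<noteq> CHR ''u''"
  proof -
    have d: "ch \<noteq> CHR ''u''" if "ch \<in> set (int_string X (\<alpha> i j))" "i < m" "j < n" for ch i j
      using int_string_props(2)[OF \<alpha>[OF that(2,3)] X] that(1) not_digit by metis
    show ?thesis using eq' d
      by (auto simp: R_def cell_grid_def enc_rows_def enc_cells_def enc_cell_def mark_def)
  qed
  have "length (enc_rows (R q)) \<le> length (R q) * (n * Suc X + 1)"
    by (rule length_enc_rows) (use int_string_props(1)[OF \<alpha> X] in \<open>auto simp: R_def cell_grid_def\<close>)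
  also have "\<dots> \<le> X * (X * Suc X + 1)"
    using dim by (intro mult_le_mono add_le_mono) (simp_all add: R_def cell_grid_def)
  finally have len: "length (enc_rows (R q)) \<le> X * (X * Suc X + 1)" .
  have 3: "reaches final (\<sigma> q) (3 * (X * (X * Suc X + 1)) + 5) ((\<sigma> q)(2 := []))"
    unfolding final_def
    by (rule reaches_cong[OF reaches_clear[of "\<sigma> q" 2]]) (use marked len in \<open>simp_all add: \<sigma>_def\<close>)
  have init: "(\<lambda>_. [])(0 := x) = st x [] [] [] [] [] [] [] []" for x
      by (auto simp: st_def fun_eq_iff)
  have "reaches verifier (st (concat (map enc_line vss) @ enc_nat k) [] [] [] [] [] [] [] [])
      (t_verify X) ((\<sigma> q)(2 := []))"
    unfolding verifier_def
  proof (rule reaches_mono[OF reaches_block[OF 1 reaches_block[OF 2 reaches_block[OF 3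
      reaches_block0]]]])
    show "Suc (t_read X + Suc (q * Suc (t_pass X) + 1 + Suc (3 * (X * (X * Suc X + 1)) + 5 +
        1))) \<le> t_verify X"
      using mult_le_mono1[OF k(4), of "Suc (t_pass X)"] unfolding t_verify_def by linarith
  qed
  then show ?thesis unfolding init by (auto simp: vss_def comp_def)
qed

section \<open>Small integer factorizations\<close>

text \<open>Rounding \<open>b\<close> down and \<open>c\<close> up keeps the inequalities because \<open>a\<close> is integral. Then the
  constraints compare the points \<open>b i\<close> and \<open>- c j\<close> of the integer line, and gaps longer than \<open>M\<close>
  can be shortened: \<open>\<phi>\<close> counts only the integers that are within \<open>M\<close> above some point.\<close>

lemma small_integer_solution:
  fixes a :: "nat \<Rightarrow> nat \<Rightarrow> int" and b c :: "nat \<Rightarrow> real" and M :: nat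
  assumes a: "\<And>i j. i < m \<Longrightarrow> j < n \<Longrightarrow> \<bar>a i j\<bar> < int M"
    and le: "\<And>i j. i < m \<Longrightarrow> j < n \<Longrightarrow> real_of_int (a i j) \<le> b i + c j"
  obtains b' c' :: "nat \<Rightarrow> int" where
    "\<And>i. 0 \<le> b' i \<and> b' i \<le> int ((m + n) * M)" "\<And>j. c' j \<le> 0 \<and> - c' j \<le> int ((m + n) * M)"
    "\<And>i j. i < m \<Longrightarrow> j < n \<Longrightarrow> a i j \<le> b' i + c' j"
    "\<And>i j. i < m \<Longrightarrow> j < n \<Longrightarrow> real_of_int (a i j) = b i + c j \<Longrightarrow> a i j = b' i + c' j"
proof -
  define B where "B = (\<lambda>i. \<lfloor>b i\<rfloor>)"
  define Y where "Y = (\<lambda>j. - \<lceil>c j\<rceil>)"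
  have BY: "a i j \<le> B i - Y j" if "i < m" "j < n" for i j
  proof -
    have "real_of_int (a i j) - c j \<le> b i" using le[OF that] by simp
    \<comment> \<open>An integer below the real number \<open>b i\<close> is also below its floor;
      this is where the integrality of \<open>a\<close> enters.\<close>
    then have "real_of_int (a i j - \<lceil>c j\<rceil>) \<le> b i" using le_of_int_ceiling[of "c j"] by linarith
    then have "a i j - \<lceil>c j\<rceil> \<le> \<lfloor>b i\<rfloor>" by (simp only: le_floor_iff)
    then show ?thesis by (simp add: B_def Y_def)
  qed
  have eqBY: "a i j = B i - Y j" if "i < m" "j < n" "real_of_int (a i j) = b i + c j" for i j
  proof -
    have "c j = - b i + of_int (a i j)" using that(3) by simp
    then have "\<lceil>c j\<rceil> = - \<lfloor>b i\<rfloor> + a i j" by (simp only: ceiling_add_of_int ceiling_minus)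
    then show ?thesis by (simp add: B_def Y_def)
  qed
  define P where "P = B ` {..<m} \<union> Y ` {..<n}"
  define V where "V = (\<Union>s\<in>P. {s..<s + int M})"
  define \<phi> where "\<phi> = (\<lambda>p. int (card {q\<in>V. q < p}))"
  have finP: "finite P" and cardP: "card P \<le> m + n"
    unfolding P_def by (auto intro!: order_trans[OF card_Un_le]
        add_mono order_trans[OF card_image_le])
  have finV: "finite V" using finP by (simp add: V_def)
  \<comment> \<open>Every point contributes one block of \<open>M\<close> integers, so \<phi> takes
    values up to \<open>(m + n) * M\<close> only.\<close>
  have "card V \<le> (\<Sum>s\<in>P. card {s..<s + int M})" unfolding V_def by (rule card_UN_le[OF finP])
  also have "\<dots> = card P * M" by simp
  also have "\<dots> \<le> (m + n) * M" using cardP by simp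
  finally have cardV: "card V \<le> (m + n) * M" .
  have \<phi>: "0 \<le> \<phi> p" "\<phi> p \<le> int ((m + n) * M)" for p
  proof -
    have "card {q\<in>V. q < p} \<le> card V" by (rule card_mono[OF finV]) auto
    from order_trans[OF this cardV] show "\<phi> p \<le> int ((m + n) * M)"
      by (simp only: \<phi>_def of_nat_le_iff)
  qed (simp add: \<phi>_def)
  have diff: "\<phi> p - \<phi> s = int (card {q\<in>V. s \<le> q \<and> q < p})" if "s \<le> p" for s p
  proof -
    have "{q\<in>V. q < p} = {q\<in>V. q < s} \<union> {q\<in>V. s \<le> q \<and> q < p}" using that by auto
    moreover have "card ({q\<in>V. q < s} \<union> {q\<in>V. s \<le> q \<and> q < p})
        = card {q\<in>V. q < s} + card {q\<in>V. s \<le> q \<and> q < p}"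
      by (rule card_Un_disjoint) (use finV in auto)
    ultimately have "card {q\<in>V. q < p} = card {q\<in>V. q < s} + card {q\<in>V. s \<le> q \<and> q < p}"
      by (simp only:)
    then show ?thesis unfolding \<phi>_def by linarith
  qed
  have near: "\<phi> p - \<phi> s = p - s" if "s \<in> P" "s \<le> p" "p - s \<le> int M" for s p
  proof -
    \<comment> \<open>All integers between \<open>s\<close> and a point at distance at most
      \<open>M\<close> lie in the block of \<open>s\<close>, so nothing is cut out there.\<close>
    have "{q\<in>V. s \<le> q \<and> q < p} = {s..<p}" using that by (auto simp: V_def intro!: bexI[of _ s])
    then show ?thesis using diff[OF that(2)] that(2) by simp
  qed
  have far: "\<phi> p - \<phi> s \<ge> int M" if "s \<in> P" "s + int M \<le> p" for s p
  proof -
    have "{s..<s + int M} \<subseteq> {q\<in>V. s \<le> q \<and> q < p}" using that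
        by (auto simp: V_def intro!: bexI[of _ s])
    from card_mono[OF _ this] have "M \<le> card {q\<in>V. s \<le> q \<and> q < p}" using finV by simp
    then show ?thesis using diff[of s p] that(2) by simp
  qed
  have main: "a i j \<le> \<phi> (B i) - \<phi> (Y j) \<and> (a i j = B i - Y j \<longrightarrow> a i j = \<phi> (B i) - \<phi> (Y j))"
    if ij: "i < m" "j < n" for i j
  proof -
    have P: "B i \<in> P" "Y j \<in> P" using ij by (auto simp: P_def)
    note aij = a[OF ij] BY[OF ij]
    consider "B i < Y j" | "Y j \<le> B i" "B i - Y j \<le> int M" | "Y j + int M < B i" by linarith
    then show ?thesis
    proof cases
      case 1
      \<comment> \<open>Here \<open>Y j - B i\<close> is at most \<open>- a i j\<close>, hence less
        than \<open>M\<close>, so this gap is preserved as well.\<close>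
      then have "\<phi> (Y j) - \<phi> (B i) = Y j - B i" using P aij by (intro near) auto
      then show ?thesis using aij by auto
    next
      case 2
      then have "\<phi> (B i) - \<phi> (Y j) = B i - Y j" using P by (intro near) auto
      then show ?thesis using aij by auto
    next
      case 3
      \<comment> \<open>A long gap may shrink, but to no less than \<open>M\<close>, which still
        exceeds \<open>a i j\<close>; equality cannot hold in this case.\<close>
      then have "\<phi> (B i) - \<phi> (Y j) \<ge> int M" using P by (intro far) auto
      then show ?thesis using aij 3 by auto
    qed
  qed
  show ?thesis
  proof (rule that[of "\<lambda>i. \<phi> (B i)" "\<lambda>j. - \<phi> (Y j)"])
    show "0 \<le> \<phi> (B i) \<and> \<phi> (B i) \<le> int ((m + n) * M)" for i using \<phi> by blast
    show "- \<phi> (Y j) \<le> 0 \<and> - (- \<phi> (Y j)) \<le> int ((m + n) * M)" for j using \<phi>[of "Y j"] by linarith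
    show "a i j \<le> \<phi> (B i) + - \<phi> (Y j)" if "i < m" "j < n" for i j using main[OF that] by simp
    show "a i j = \<phi> (B i) + - \<phi> (Y j)" if "i < m" "j < n" "real_of_int (a i j) = b i + c j" for i j
      using main[OF that(1,2)] eqBY[OF that] by simp
  qed
qed

section \<open>Tropical factorizations with few columns and small entries\<close>

lemma trop_mat_mult_nth:
  "i < dim_row B \<Longrightarrow> j < dim_col C \<Longrightarrow>
   trop_mat_mult B C $$ (i, j) = Min ((\<lambda>t. B $$ (i, t) + C $$ (t, j)) ` {..<dim_col B})"
  by (simp add: trop_mat_mult_def)

text \<open>A minimum over a finite nonempty set is an attained lower bound. This form separates the
  inequalities, needed for all columns, from the witness of equality.\<close>

lemma trop_factorization_iff:
  assumes "B \<in> carrier_mat (dim_row A) k" "C \<in> carrier_mat k (dim_col A)" "k \<ge> 1"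
  shows "is_trop_factorization A k B C \<longleftrightarrow> (\<forall>i<dim_row A. \<forall>j<dim_col A.
    (\<forall>t<k. A $$ (i, j) \<le> B $$ (i, t) + C $$ (t, j)) \<and> (\<exists>t<k. A $$ (i, j) = B $$ (i, t) + C $$ (t,
        j)))"
proof -
  have "A $$ (i, j) = trop_mat_mult B C $$ (i, j) \<longleftrightarrow>
    (\<forall>t<k. A $$ (i, j) \<le> B $$ (i, t) + C $$ (t, j)) \<and> (\<exists>t<k. A $$ (i, j) = B $$ (i, t) + C $$ (t,
        j))"
    if "i < dim_row A" "j < dim_col A" for i j
  proof -
    have "0 \<in> {..<k}" using assms(3) by simp
    then have ne: "(\<lambda>t. B $$ (i, t) + C $$ (t, j)) ` {..<k} \<noteq> {}" by blast
    have eq: "trop_mat_mult B C $$ (i, j) = Min ((\<lambda>t. B $$ (i, t) + C $$ (t, j)) ` {..<k})"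
      using assms that trop_mat_mult_nth[of i B j C] by auto
    show ?thesis unfolding eq eq_Min_iff[OF finite_imageI[OF finite_lessThan] ne] by blast
  qed
  moreover have "A = trop_mat_mult B C \<longleftrightarrow>
     (\<forall>i<dim_row A. \<forall>j<dim_col A. A $$ (i, j) = trop_mat_mult B C $$ (i, j))"
    using assms by (auto simp: mat_eq_iff trop_mat_mult_def)
  ultimately show ?thesis using assms by (simp add: is_trop_factorization_def)
qed

text \<open>Needed because \<open>factor_rank\<close> is a \<open>LEAST\<close>, which has its
  defining property only if some factorization exists.\<close>

lemma trop_factorization_exists:
  assumes "dim_row A \<ge> 1" "dim_col A \<ge> 1"
  shows "\<exists>k B C. is_trop_factorization A k B C"
proof -
  let ?m = "dim_row A" and ?n = "dim_col A"
  define D where "D = Max ((\<lambda>(i, j). \<bar>A $$ (i, j)\<bar>) ` ({..<?m} \<times> {..<?n}))"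
  have D: "\<bar>A $$ (i, j)\<bar> \<le> D" if "i < ?m" "j < ?n" for i j
    unfolding D_def using that by (intro Max_ge) (auto intro!: image_eqI[of _ _ "(i, j)"])
  \<comment> \<open>Two entries differ by at most \<open>2 * D\<close>, so the off-diagonal terms
    are never below the diagonal one, which is the entry itself.\<close>
  have "is_trop_factorization A ?n A (mat ?n ?n (\<lambda>(t, j). if t = j then 0 else 2 * D))"
  proof (subst trop_factorization_iff)
    show "\<forall>i<?m. \<forall>j<?n.
       (\<forall>t<?n. A $$ (i, j) \<le> A $$ (i, t) + mat ?n ?n (\<lambda>(t, j). if t = j then 0 else 2 * D) $$ (t,
           j)) \<and>
       (\<exists>t<?n. A $$ (i, j) = A $$ (i, t) + mat ?n ?n (\<lambda>(t, j). if t = j then 0 else 2 * D) $$ (t,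
           j))"
    proof (intro allI impI conjI)
      fix i j t assume "i < ?m" "j < ?n" "t < ?n"
      then show "A $$ (i, j) \<le> A $$ (i, t) + mat ?n ?n (\<lambda>(t,
          j). if t = j then 0 else 2 * D) $$ (t, j)"
        using D[of i j] D[of i t] by auto
    next
      fix i j assume "i < ?m" "j < ?n"
      then show "\<exists>t<?n. A $$ (i, j) = A $$ (i, t) + mat ?n ?n (\<lambda>(t,
          j). if t = j then 0 else 2 * D) $$ (t, j)"
        by (intro exI[of _ j]) auto
    qed
  qed (use assms in auto)
  then show ?thesis by blast
qed

text \<open>Once an equality witness is fixed for every entry, the conditions on different columns
  no longer interact, and each column with its row can be made small separately. The bound does not
  depend on the real factorization.\<close>

lemma small_factorization:
  fixes A :: "int mat" and M :: nat
  defines "m \<equiv> dim_row A" and "n \<equiv> dim_col A"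
  assumes dim: "m \<ge> 1" "n \<ge> 1" and rank: "factor_rank (map_mat real_of_int A) \<le> k"
    and M: "\<And>i j. i < m \<Longrightarrow> j < n \<Longrightarrow> \<bar>A $$ (i, j)\<bar> < int M"
  obtains q and b c :: "nat \<Rightarrow> nat \<Rightarrow> int" where "q \<le> k" "q \<le> m * n"
    "\<And>i t. 0 \<le> b i t \<and> b i t \<le> int ((m + n) * M)" "\<And>t j. c t j \<le> 0 \<and> - c t j \<le> int ((m + n) * M)"
    "\<And>i j t. i < m \<Longrightarrow> j < n \<Longrightarrow> t < q \<Longrightarrow> A $$ (i, j) \<le> b i t + c t j"
    "\<And>i j. i < m \<Longrightarrow> j < n \<Longrightarrow> \<exists>t<q. A $$ (i, j) = b i t + c t j"
proof -
  define r where "r = factor_rank (map_mat real_of_int A)"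
  have "\<exists>B C. is_trop_factorization (map_mat real_of_int A) r B C" unfolding r_def factor_rank_def
    by (rule LeastI_ex, rule trop_factorization_exists) (use dim in \<open>auto simp: m_def n_def\<close>)
  then obtain B C where fact: "is_trop_factorization (map_mat real_of_int A) r B C" by blast
  then have BC: "B \<in> carrier_mat m r" "C \<in> carrier_mat r n" "r \<ge> 1"
    by (auto simp: is_trop_factorization_def m_def n_def)
  have "is_trop_factorization (map_mat real_of_int A) r B C \<longleftrightarrow>
     (\<forall>i<dim_row (map_mat real_of_int A). \<forall>j<dim_col (map_mat real_of_int A).
      (\<forall>t<r. map_mat real_of_int A $$ (i, j) \<le> B $$ (i, t) + C $$ (t, j)) \<and>
      (\<exists>t<r. map_mat real_of_int A $$ (i, j) = B $$ (i, t) + C $$ (t, j)))"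
    by (rule trop_factorization_iff) (use BC in \<open>simp_all add: m_def n_def\<close>)
  with fact have le: "\<And>i j t. i < m \<Longrightarrow> j < n \<Longrightarrow> t < r \<Longrightarrow> real_of_int (A $$ (i, j)) \<le> B $$ (i, t) +
      C $$ (t, j)"
    and "\<And>i j. i < m \<Longrightarrow> j < n \<Longrightarrow> \<exists>t<r. real_of_int (A $$ (i, j)) = B $$ (i, t) + C $$ (t, j)"
    by (auto simp: m_def n_def)
  then obtain \<tau> where \<tau>: "\<And>i j. i < m \<Longrightarrow> j < n \<Longrightarrow> \<tau> i j < r \<and> real_of_int (A $$ (i, j)) = B $$ (i,
      \<tau> i j) + C $$ (\<tau> i j, j)"
    by metis
  define T where "T = (\<lambda>(i, j). \<tau> i j) ` ({..<m} \<times> {..<n})"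
  have T: "T \<subseteq> {..<r}" "finite T" "card T \<le> m * n"
    using \<tau> card_image_le[of "{..<m} \<times> {..<n}" "\<lambda>(i, j). \<tau> i j"]
    by (auto simp: T_def card_cartesian_product)
  define q where "q = card T"
  obtain h where h: "bij_betw h {0..<q} T" using ex_bij_betw_nat_finite[OF T(2)] q_def by auto
  have hr: "h t < r" if "t < q" for t using bij_betwE[OF h] T(1) that by auto
  have "\<exists>b' c' :: nat \<Rightarrow> int. (\<forall>i. 0 \<le> b' i \<and> b' i \<le> int ((m + n) * M)) \<and>
    (\<forall>j. c' j \<le> 0 \<and> - c' j \<le> int ((m + n) * M)) \<and>
    (\<forall>i j. i < m \<longrightarrow> j < n \<longrightarrow> A $$ (i, j) \<le> b' i + c' j \<and>
      (real_of_int (A $$ (i, j)) = B $$ (i, t) + C $$ (t, j) \<longrightarrow> A $$ (i, j) = b' i + c' j))"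
    if t: "t < r" for t
  proof -
    obtain b' c' :: "nat \<Rightarrow> int" where
      "\<And>i. 0 \<le> b' i \<and> b' i \<le> int ((m + n) * M)" "\<And>j. c' j \<le> 0 \<and> - c' j \<le> int ((m + n) * M)"
      "\<And>i j. i < m \<Longrightarrow> j < n \<Longrightarrow> A $$ (i, j) \<le> b' i + c' j"
      "\<And>i j. i < m \<Longrightarrow> j < n \<Longrightarrow> real_of_int (A $$ (i, j)) = B $$ (i, t) + C $$ (t, j) \<Longrightarrow> A $$ (i,
        j) = b' i + c' j"
      by (rule small_integer_solution[of m n "\<lambda>i j. A $$ (i, j)" M "\<lambda>i. B $$ (i, t)" "\<lambda>j. C $$ (t,
          j)"])
        (use M le t in auto)
    then show ?thesis by (intro exI[of _ b'] exI[of _ c']) auto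
  qed
  then have "\<forall>t. \<exists>b' c' :: nat \<Rightarrow> int. t < r \<longrightarrow> (\<forall>i. 0 \<le> b' i \<and> b' i \<le> int ((m + n) * M)) \<and>
    (\<forall>j. c' j \<le> 0 \<and> - c' j \<le> int ((m + n) * M)) \<and>
    (\<forall>i j. i < m \<longrightarrow> j < n \<longrightarrow> A $$ (i, j) \<le> b' i + c' j \<and>
      (real_of_int (A $$ (i, j)) = B $$ (i, t) + C $$ (t, j) \<longrightarrow> A $$ (i, j) = b' i + c' j))" by blast
  then obtain \<beta> \<gamma> :: "nat \<Rightarrow> nat \<Rightarrow> int" where bc: "\<And>t. t < r \<Longrightarrow> (\<forall>i. 0 \<le> \<beta> t i \<and> \<beta> t i \<le> int ((m +
      n) * M)) \<and>
    (\<forall>j. \<gamma> t j \<le> 0 \<and> - \<gamma> t j \<le> int ((m + n) * M)) \<and>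
    (\<forall>i j. i < m \<longrightarrow> j < n \<longrightarrow> A $$ (i, j) \<le> \<beta> t i + \<gamma> t j \<and>
      (real_of_int (A $$ (i, j)) = B $$ (i, t) + C $$ (t, j) \<longrightarrow> A $$ (i, j) = \<beta> t i + \<gamma> t j))"
    by metis
  \<comment> \<open>The default 0 beyond the \<open>q\<close> columns keeps the size bounds valid
    for all indices.\<close>
  define b where "b = (\<lambda>i t. if t < q then \<beta> (h t) i else 0)"
  define c where "c = (\<lambda>t j. if t < q then \<gamma> (h t) j else 0)"
  show ?thesis
  proof (rule that[of q b c])
    have "q \<le> r" using card_mono[OF _ T(1)] by (simp add: q_def)
    then show "q \<le> k" using rank by (simp add: r_def)
    show "q \<le> m * n" using T(3) by (simp add: q_def)
    show "0 \<le> b i t \<and> b i t \<le> int ((m + n) * M)" for i t using bc[OF hr, of t] by (simp add: b_def)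
    show "c t j \<le> 0 \<and> - c t j \<le> int ((m + n) * M)" for t j using bc[OF hr, of t]
        by (simp add: c_def)
    show "A $$ (i, j) \<le> b i t + c t j" if "i < m" "j < n" "t < q" for i j t
      using bc[OF hr, of t] that by (simp add: b_def c_def)
    show "\<exists>t<q. A $$ (i, j) = b i t + c t j" if ij: "i < m" "j < n" for i j
    proof -
      have "\<tau> i j \<in> T" using ij by (auto simp: T_def)
      then obtain t where t: "t < q" "h t = \<tau> i j" using h by (auto simp: bij_betw_def)
      then have "A $$ (i, j) = \<beta> (h t) i + \<gamma> (h t) j" using \<tau>[OF ij] bc[of "\<tau> i j"] ij by simp
      then show ?thesis using t by (intro exI[of _ t]) (simp add: b_def c_def)
    qed
  qed
qed

text \<open>Integer factors are real factors, so an integral certificate bounds the rank over the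
  reals.\<close>

lemma factor_rank_leI:
  fixes A :: "int mat" and b c :: "nat \<Rightarrow> nat \<Rightarrow> int"
  assumes "dim_row A = m" "dim_col A = n" "q \<ge> 1"
    and le: "\<And>i j t. i < m \<Longrightarrow> j < n \<Longrightarrow> t < q \<Longrightarrow> A $$ (i, j) \<le> b i t + c t j"
    and eq: "\<And>i j. i < m \<Longrightarrow> j < n \<Longrightarrow> \<exists>t<q. A $$ (i, j) = b i t + c t j"
  shows "factor_rank (map_mat real_of_int A) \<le> q"
proof -
  let ?B = "mat m q (\<lambda>(i, t). real_of_int (b i t))" and ?C = "mat q n (\<lambda>(t,
      j). real_of_int (c t j))"
  have "is_trop_factorization (map_mat real_of_int A) q ?B ?C"
  proof (subst trop_factorization_iff)
    show "\<forall>i<dim_row (map_mat real_of_int A). \<forall>j<dim_col (map_mat real_of_int A).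
       (\<forall>t<q. map_mat real_of_int A $$ (i, j) \<le> ?B $$ (i, t) + ?C $$ (t, j)) \<and>
       (\<exists>t<q. map_mat real_of_int A $$ (i, j) = ?B $$ (i, t) + ?C $$ (t, j))"
    proof (intro allI impI conjI)
      fix i j t
      assume ij: "i < dim_row (map_mat real_of_int A)" "j < dim_col (map_mat real_of_int A)" and
          t: "t < q"
      then show "map_mat real_of_int A $$ (i, j) \<le> ?B $$ (i, t) + ?C $$ (t, j)"
        using le[of i j t] assms(1,2) by (simp flip: of_int_add)
    next
      fix i j
      assume ij: "i < dim_row (map_mat real_of_int A)" "j < dim_col (map_mat real_of_int A)"
      then obtain t where "t < q" "A $$ (i, j) = b i t + c t j" using eq[of i j] assms(1,2) by auto
      then show "\<exists>t<q. map_mat real_of_int A $$ (i, j) = ?B $$ (i, t) + ?C $$ (t, j)"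
        using ij assms(1,2) by (intro exI[of _ t]) simp
    qed
  qed (use assms in auto)
  then show ?thesis unfolding factor_rank_def by (intro Least_le) blast
qed

section \<open>Membership in NP\<close>

lemma uses_stacks_verifier: "uses_stacks 10 verifier"
  by (simp add: verifier_def read_instance_def read_row_def read_cell_def read_int_def read_nat_def
      decimal_def pass_def decrement_def row_def entry_def entry_end_def digit_step_def final_def)

lemma enc_mat_enc_line:
  assumes "dim_col A \<ge> 1"
  shows "enc_mat A = concat (map (\<lambda>i. enc_line (map (\<lambda>j. A $$ (i,
      j)) [0..<dim_col A])) [0..<dim_row A])"
proof -
  obtain n where n: "dim_col A = Suc n" using assms by (cases "dim_col A") auto
  have "concat (map (\<lambda>j. enc_int (A $$ (i, j)) @ [if Suc j = Suc n then CHR '';'' else CHR '',''])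
      [0..<Suc n])
      = enc_line (map (\<lambda>j. A $$ (i, j)) [0..<Suc n])" for i
  proof -
    have "concat (map (\<lambda>j. enc_int (A $$ (i, j)) @ [if j = n then CHR '';'' else CHR '',''])
        [0..<n])
        = concat (map (\<lambda>j. enc_int (A $$ (i, j)) @ '','') [0..<n])"
      by (rule arg_cong[where f = concat], rule map_cong) auto
    then show ?thesis by (simp add: enc_line_def comp_def)
  qed
  then show ?thesis by (simp only: enc_mat_def n)
qed

section \<open>The size of an instance\<close>

lemma less_power_length_enc_nat: "n < 10 ^ length (enc_nat n)"
proof (induction n rule: nat_induct_decimal)
  case (snoc n d)
  then have "n + 1 \<le> 10 ^ length (enc_nat n)" by simp
  then show ?case using snoc by (simp add: enc_nat_snoc)
qed (simp add: enc_nat_digit)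

lemma length_le_length_concat: "xs \<in> set xss \<Longrightarrow> length xs \<le> length (concat xss)"
  by (induction xss) auto

lemma entry_bound:
  assumes "i < dim_row A" "j < dim_col A"
  shows "\<bar>A $$ (i, j)\<bar> < 10 ^ length (enc_mat A)"
proof -
  let ?e = "\<lambda>i j. enc_int (A $$ (i, j)) @ [if Suc j = dim_col A then CHR '';'' else CHR '','']"
  let ?r = "\<lambda>i. concat (map (?e i) [0..<dim_col A])"
  have "length (enc_nat (nat \<bar>A $$ (i, j)\<bar>)) \<le> length (?e i j)" by (simp add: enc_int_def)
  also have "\<dots> \<le> length (?r i)" by (rule length_le_length_concat) (use assms in auto)
  also have "\<dots> \<le> length (enc_mat A)" unfolding enc_mat_def
    by (rule length_le_length_concat) (use assms in auto)
  finally have "(10::nat) ^ length (enc_nat (nat \<bar>A $$ (i, j)\<bar>)) \<le> 10 ^ length (enc_mat A)" by simp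
  then have "nat \<bar>A $$ (i, j)\<bar> < 10 ^ length (enc_mat A)"
    using less_power_length_enc_nat[of "nat \<bar>A $$ (i, j)\<bar>"] by linarith
  then have "int (nat \<bar>A $$ (i, j)\<bar>) < int (10 ^ length (enc_mat A))"
      by (simp only: of_nat_less_iff)
  then show ?thesis by simp
qed

text \<open>In the length formula the logarithms are nonnegative, and each entry contributes at
  least three characters.\<close>

lemma dim_bound: "dim_row A * dim_col A \<le> length (enc_mat A)"
proof -
  have "0 \<le> (\<Sum>i<dim_row A. \<Sum>j<dim_col A. \<lfloor>log 10 (max \<bar>real_of_int (A $$ (i, j))\<bar> 1)\<rfloor>)"
    by (intro sum_nonneg) simp
  then have "int (dim_row A * dim_col A) \<le> int (length (enc_mat A))"
    unfolding length_enc_mat by simp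
  then show ?thesis by (simp only: of_nat_le_iff)
qed

lemma double_less_power: "1 \<le> N \<Longrightarrow> 2 * N + 1 < (10 :: int) ^ nat N" for N :: int
proof -
  have "2 * int k + 1 < 10 ^ k" if "1 \<le> k" for k
    using that by (induction k rule: dec_induct) auto
  from this[of "nat N"] show "1 \<le> N \<Longrightarrow> 2 * N + 1 < (10 :: int) ^ nat N" by simp
qed

section \<open>Polynomial time bounds\<close>

definition is_poly :: "(nat \<Rightarrow> nat) \<Rightarrow> bool" where
  "is_poly f \<longleftrightarrow> (\<exists>p. \<forall>n. f n = poly p n)"

lemma is_poly_intros:
  "is_poly (\<lambda>n. c)" "is_poly (\<lambda>n. n)"
  "is_poly f \<Longrightarrow> is_poly (\<lambda>n. Suc (f n))"
  "is_poly f \<Longrightarrow> is_poly g \<Longrightarrow> is_poly (\<lambda>n. f n + g n)"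
  "is_poly f \<Longrightarrow> is_poly g \<Longrightarrow> is_poly (\<lambda>n. f n * g n)"
proof -
  show "is_poly (\<lambda>n. c)" unfolding is_poly_def by (rule exI[of _ "[:c:]"]) simp
  show "is_poly (\<lambda>n. n)" unfolding is_poly_def by (rule exI[of _ "[:0, 1:]"]) simp
  show add: "is_poly (\<lambda>n. f n + g n)" if "is_poly f" "is_poly g" for f g
    using that unfolding is_poly_def by (metis poly_add)
  show "is_poly (\<lambda>n. f n * g n)" if "is_poly f" "is_poly g" for f g
    using that unfolding is_poly_def by (metis poly_mult)
  show "is_poly (\<lambda>n. Suc (f n))" if "is_poly f"
    using add[OF that, of "\<lambda>_. 1"] \<open>is_poly (\<lambda>n. c)\<close>
    unfolding is_poly_def by (metis Suc_eq_plus1 poly_add poly_1)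
qed

text \<open>The costs of the fixed loop-free pieces do not depend on \<open>N\<close> and count as
  constants, so closure under sums and products suffices.\<close>

lemma is_poly_t_verify: "is_poly (\<lambda>N. t_verify (2 * N))"
  unfolding t_verify_def t_read_def t_read_row_def t_int_def t_num_def t_pass_def t_dec_def
      t_row_def
    t_entry_def t_digits_def
  by (intro is_poly_intros)

section \<open>The language and its verifier\<close>

text \<open>Strings that encode no instance are outside, so the verifier also has to check the
  format.\<close>

definition problem :: "string set" where
  "problem = {enc_instance A k | (A :: int mat) (k :: nat).
      dim_row A \<ge> 1 \<and> dim_col A \<ge> 1 \<and> k \<ge> 1 \<and> factor_rank (map_mat real_of_int A) \<le> k}"

text \<open>A pass compares all rows with the same vector, so the rows have equal length and the
  input really is a matrix. There is at least one pass, because the cells start unmarked and end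
  marked.\<close>

lemma verifier_accepts_only_problem:
  assumes "rel verifier ((\<lambda>_. [])(0 := x)) s"
  shows "x \<in> problem"
proof -
  obtain vss k Rs ps Rs' where vss: "vss \<noteq> []" "\<forall>vs\<in>set vss. vs \<noteq> []" and k: "k \<ge> 1"
    and x: "x = concat (map enc_line vss) @ enc_nat k"
    and Rs: "list_all2 initial_cells Rs (map rev (rev vss))"
    and ps: "passes ps Rs Rs'" "length ps \<le> k" and marked: "\<forall>R\<in>set Rs'. \<forall>e\<in>set R. snd e"
    using assms by (rule verifier_sound)
  define m where "m = length vss"
  have m: "m \<ge> 1" "length Rs = m" using vss list_all2_lengthD[OF Rs] by (auto simp: m_def Suc_le_eq)
  have cells: "initial_cells (Rs ! i) (rev (vss ! (m - 1 - i)))" if "i < m" for i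
    using list_all2_nthD[OF Rs, of i] that m(2) by (simp add: rev_nth m_def)
  have lenR: "length (Rs ! i) = length (vss ! (m - 1 - i))" if "i < m" for i
    using cells[OF that] by (metis initial_cells_def length_map length_rev)
  have val: "val (fst (Rs ! i ! j)) = vss ! (m - 1 - i) ! (length (Rs ! i) - 1 - j)"
      "\<not> snd (Rs ! i ! j)"
    if "i < m" "j < length (Rs ! i)" for i j
  proof -
    have "val (fst (Rs ! i ! j)) = map (val \<circ> fst) (Rs ! i) ! j" using that(2) by simp
    also have "\<dots> = rev (vss ! (m - 1 - i)) ! j" using cells[OF that(1)]
        by (simp add: initial_cells_def)
    finally show "val (fst (Rs ! i ! j)) = vss ! (m - 1 - i) ! (length (Rs ! i) - 1 - j)"
      using that lenR[OF that(1)] by (simp add: rev_nth)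
    show "\<not> snd (Rs ! i ! j)" using cells[OF that(1)] that(2) by (simp add: initial_cells_def)
  qed
  have result: "(\<forall>(cs, bs)\<in>set ps. length bs = m \<and> length cs = length (Rs ! i) \<and>
      val (fst (Rs ! i ! j)) \<le> bs ! i + cs ! j) \<and> (\<exists>(cs,
          bs)\<in>set ps. val (fst (Rs ! i ! j)) = bs ! i + cs ! j)"
    if ij: "i < m" "j < length (Rs ! i)" for i j
  proof -
    have "i < length Rs" using ij m(2) by simp
    note p = passes_nth[OF ps(1) this ij(2)]
    have "Rs' ! i \<in> set Rs'" using p ij m(2) by (intro nth_mem) simp
    moreover have "Rs' ! i ! j \<in> set (Rs' ! i)" using p ij by (intro nth_mem) simp
    ultimately have "snd (Rs' ! i ! j)" using marked by blast
    then show ?thesis using p val(2)[OF ij] unfolding m(2) by blast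
  qed
  have pos: "length (Rs ! i) > 0" if "i < m" for i
  proof -
    have "vss ! (m - 1 - i) \<in> set vss" using that by (intro nth_mem) (simp add: m_def)
    then show ?thesis using vss(2) lenR[OF that] by auto
  qed
  define n where "n = length (fst (hd ps))"
  have "ps \<noteq> []" using result[of 0 0] pos[of 0] m by auto
  have n: "length (Rs ! i) = n" if "i < m" for i
  proof -
    have "hd ps \<in> set ps" using \<open>ps \<noteq> []\<close> by simp
    from bspec[OF conjunct1[OF result[OF that pos[OF that]]] this] show ?thesis
      by (simp add: n_def case_prod_beta)
  qed
  have n1: "n \<ge> 1" using pos[of 0] n[of 0] m by simp
  have lenv: "length (vss ! i) = n" if "i < m" for i
    using lenR[of "m - 1 - i"] n[of "m - 1 - i"] that by simp
  define A where "A = mat m n (\<lambda>(i, j). vss ! i ! j)"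
  have row: "map (\<lambda>j. A $$ (i, j)) [0..<n] = vss ! i" if "i < m" for i
    by (rule nth_equalityI) (use that lenv[OF that] in \<open>auto simp: A_def\<close>)
  have dims: "dim_row A = m" "dim_col A = n" by (simp_all add: A_def)
  have "enc_mat A = concat (map (\<lambda>i. enc_line (map (\<lambda>j. A $$ (i, j)) [0..<n])) [0..<m])"
    using enc_mat_enc_line[of A] n1 by (simp only: dims)
  also have "\<dots> = concat (map (\<lambda>i. enc_line (vss ! i)) [0..<m])"
    by (rule arg_cong[where f = concat], rule map_cong) (simp_all only: row atLeast_upt set_upt
        atLeastLessThan_iff)
  also have "map (\<lambda>i. enc_line (vss ! i)) [0..<m] = map enc_line vss"
    by (rule nth_equalityI) (auto simp: m_def)
  finally have enc: "x = enc_instance A k" by (simp add: x enc_instance_def)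
  have Aij: "A $$ (i, j) = val (fst (Rs ! (m - 1 - i) ! (n - 1 - j)))" if "i < m" "j < n" for i j
    using val(1)[of "m - 1 - i" "n - 1 - j"] n[of "m - 1 - i"] that by (simp add: A_def)
  have "factor_rank (map_mat real_of_int A) \<le> length ps"
  \<comment> \<open>Pass number \<open>t\<close> supplies column \<open>t\<close> of
    \<open>B\<close> and row \<open>t\<close> of \<open>C\<close>; the reflected indices undo the
    reversal caused by reading.\<close>
  proof (rule factor_rank_leI[where b = "\<lambda>i t. snd (ps ! t) ! (m - 1 - i)" and c =
      "\<lambda>t j. fst (ps ! t) ! (n - 1 - j)"])
    show "dim_row A = m" "dim_col A = n" by (rule dims)+
    show "length ps \<ge> 1" using \<open>ps \<noteq> []\<close> by (simp add: Suc_le_eq)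
  next
    fix i j t assume ij: "i < m" "j < n" and t: "t < length ps"
    have "m - 1 - i < m" "n - 1 - j < length (Rs ! (m - 1 - i))" using ij n[of "m - 1 - i"] by auto
    from bspec[OF conjunct1[OF result[OF this]] nth_mem[OF t]]
    show "A $$ (i, j) \<le> snd (ps ! t) ! (m - 1 - i) + fst (ps ! t) ! (n - 1 - j)"
      by (simp add: Aij[OF ij] case_prod_beta)
  next
    fix i j assume ij: "i < m" "j < n"
    have "m - 1 - i < m" "n - 1 - j < length (Rs ! (m - 1 - i))" using ij n[of "m - 1 - i"] by auto
    from conjunct2[OF result[OF this]] obtain p where "p \<in> set ps" "A $$ (i,
        j) = snd p ! (m - 1 - i) + fst p ! (n - 1 - j)"
      unfolding Aij[OF ij] case_prod_beta by blast
    then show "\<exists>t<length ps. A $$ (i, j) = snd (ps ! t) ! (m - 1 - i) + fst (ps ! t) ! (n - 1 - j)"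
      by (metis in_set_conv_nth)
  qed
  then show ?thesis unfolding problem_def using ps(2) k m n1 enc
    by (intro CollectI exI[of _ A] exI[of _ k]) (auto simp: A_def)
qed

text \<open>With input length \<open>N\<close>, the entries are below \<open>10 ^ N\<close> and the
  small factors are bounded by \<open>(m + n) * 10 ^ N\<close>. Taking \<open>2 * N\<close> digits
  leaves room for these numbers and for the slack.\<close>

lemma verifier_accepts_problem:
  assumes "x \<in> problem"
  shows "\<exists>s. reaches verifier ((\<lambda>_. [])(0 := x)) (t_verify (2 * length x)) s"
proof -
  from assms obtain A :: "int mat" and k where x: "x = enc_instance A k"
    and dim: "dim_row A \<ge> 1" "dim_col A \<ge> 1" and k: "k \<ge> 1"
    and rank: "factor_rank (map_mat real_of_int A) \<le> k"
    by (auto simp: problem_def)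
  define m where "m = dim_row A"
  define n where "n = dim_col A"
  define N where "N = length x"
  have len: "length (enc_mat A) \<le> N" "length (enc_nat k) \<le> N"
      by (simp_all add: N_def x enc_instance_def)
  have mn: "m * n \<le> N" using dim_bound[of A] len by (simp add: m_def n_def)
  have "m \<le> m * n" "n \<le> m * n" using dim by (simp_all add: m_def n_def)
  moreover have "1 \<le> m" using dim by (simp add: m_def)
  ultimately have mN: "m \<le> N" "n \<le> N" "N \<ge> 1" using mn by linarith+
  have A: "\<bar>A $$ (i, j)\<bar> < int (10 ^ N)" if "i < m" "j < n" for i j
  proof -
    have "(10::int) ^ length (enc_mat A) \<le> 10 ^ N" using len by simp
    moreover have "\<bar>A $$ (i, j)\<bar> < 10 ^ length (enc_mat A)"
      by (rule entry_bound) (use that in \<open>simp_all add: m_def n_def\<close>)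
    ultimately have "\<bar>A $$ (i, j)\<bar> < 10 ^ N" by linarith
    then show ?thesis by simp
  qed
  obtain q and b c :: "nat \<Rightarrow> nat \<Rightarrow> int" where q: "q \<le> k" "q \<le> m * n"
    and b: "\<And>i t. 0 \<le> b i t \<and> b i t \<le> int ((m + n) * 10 ^ N)"
    and c: "\<And>t j. c t j \<le> 0 \<and> - c t j \<le> int ((m + n) * 10 ^ N)"
    and le: "\<And>i j t. i < m \<Longrightarrow> j < n \<Longrightarrow> t < q \<Longrightarrow> A $$ (i, j) \<le> b i t + c t j"
    and eq: "\<And>i j. i < m \<Longrightarrow> j < n \<Longrightarrow> \<exists>t<q. A $$ (i, j) = b i t + c t j"
    by (rule small_factorization[of A k "10 ^ N", folded m_def n_def, OF dim[folded m_def n_def]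
        rank A])
      (assumption, assumption, rule that, assumption+)
  \<comment> \<open>The slack is less than \<open>(m + n) * 10 ^ N + 10 ^ N\<close>, since
    \<open>c\<close> is nonpositive and \<open>A\<close> exceeds \<open>- (10 ^ N)\<close>. As
    \<open>m + n\<close> is at most \<open>2 * N\<close>, the factor \<open>2 * N + 1\<close> has to
    be less than \<open>10 ^ N\<close>.\<close>
  have "2 * int N + 1 < 10 ^ N" using double_less_power[of "int N"] mN by simp
  then have "(2 * int N + 1) * 10 ^ N < 10 ^ N * 10 ^ N" by (intro mult_strict_right_mono) auto
  then have pow: "(2 * int N + 1) * 10 ^ N < 10 ^ (2 * N)" by (simp only: mult_2 power_add)
  have "int ((m + n) * 10 ^ N) \<le> 2 * int N * 10 ^ N" 
    using mult_right_mono[of "int (m + n)" "2 * int N" "10 ^ N :: int"] mN by simp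
  moreover have "(2 * int N + 1) * 10 ^ N = 2 * int N * 10 ^ N + 10 ^ N"
      by (simp add: distrib_right)
  ultimately have B: "int ((m + n) * 10 ^ N) + 10 ^ N < 10 ^ (2 * N)" using pow by linarith
  have pos: "(0::int) < 10 ^ N" "0 \<le> int ((m + n) * 10 ^ N)" by simp_all
  have "\<exists>s. reaches verifier ((\<lambda>_. [])(0 := concat (map (\<lambda>i. enc_line (map (\<lambda>j. A $$ (i,
      j)) [0..<n])) [0..<m]) @ enc_nat k))
     (t_verify (2 * N)) s"
  proof (rule verifier_complete)
    show "1 \<le> m" "1 \<le> n" using dim by (simp_all add: m_def n_def)
    show "m \<le> 2 * N" "n \<le> 2 * N" "length (enc_nat k) \<le> 2 * N" using mN len by auto
    show "q \<le> 2 * N * (2 * N)"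
    proof -
      have "m * n \<le> (2 * N) * (2 * N)" using mN by (intro mult_le_mono) auto
      then show ?thesis using q by linarith
    qed
    show "\<bar>A $$ (i, j)\<bar> < 10 ^ (2 * N)" if "i < m" "j < n" for i j
      using A[OF that] B pos unfolding of_nat_power of_nat_numeral by linarith
    show "\<bar>b i t\<bar> < 10 ^ (2 * N)" for i t using b[of i t] B pos by linarith
    show "\<bar>c t j\<bar> < 10 ^ (2 * N)" for t j using c[of t j] B pos by linarith
    show "A $$ (i, j) \<le> b i t + c t j \<and> b i t + c t j < A $$ (i, j) + 10 ^ (2 * N)"
      if "i < m" "j < n" "t < q" for i j t
    proof -
      have "- (10 ^ N) < A $$ (i, j)" using A[OF that(1,2)] unfolding of_nat_power of_nat_numeral
          by linarith
      then show ?thesis using le[OF that] b[of i t] c[of t j] B by linarith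
    qed
  qed (use k q eq in auto)
  moreover have "x = concat (map (\<lambda>i. enc_line (map (\<lambda>j. A $$ (i, j)) [0..<n])) [0..<m]) @
      enc_nat k"
    using enc_mat_enc_line[of A] dim by (simp add: x enc_instance_def m_def n_def)
  ultimately show ?thesis by (simp add: N_def)
qed

theorem theorem2p3:
  "{enc_instance A k | (A :: int mat) (k :: nat).
      dim_row A \<ge> 1 \<and> dim_col A \<ge> 1 \<and> k \<ge> 1 \<and>
      factor_rank (map_mat real_of_int A) \<le> k} \<in> NP"
proof -
  obtain q where q: "\<And>N. t_verify (2 * N) = poly q N" using is_poly_t_verify unfolding is_poly_def
      by blast
  have "problem \<in> NP"
  proof (rule NP_I)
    show "uses_stacks 10 verifier" by (rule uses_stacks_verifier)
    show "x \<in> problem" if "exec verifier ((\<lambda>_. [])(0 := x)) k s" for x k s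
      using verifier_accepts_only_problem that unfolding rel_def by blast
    show "\<exists>k s. exec verifier ((\<lambda>_. [])(0 := x)) k s \<and> k \<le> poly q (length x)" if "x \<in> problem" for x
      using verifier_accepts_problem[OF that] unfolding reaches_def q by blast
  qed simp
  then show ?thesis unfolding problem_def .
qed

end
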